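(* Let $(\Lambda, w, \mathscr{H}, \varepsilon)$ be an input datum over the field $k$, and let $\mathfrak{h} = \mathfrak{t} \oplus \mathfrak{l}$ be the associated $k$-vector space with its $k$-bilinear bracket $[\cdot,\cdot]$ (both defined in the context). Then, with bracket $[\cdot,\cdot]$, the vector space $\mathfrak{h}$ is a semisimple Lie algebra over $k$ with Cartan subalgebra $\mathfrak{t}$ and corresponding root lattice $\Lambda$ (where $\alpha \in \Lambda$ is viewed as a linear functional on $\mathfrak{t} = \operatorname{Hom}(\Lambda,k)$ by evaluation).
   Context: A lattice is a finitely generated free $\mathbb{Z}$-module $\Lambda$ with a symmetric positive-definite bilinear form $(\cdot,\cdot):\Lambda\times\Lambda\to\mathbb{Z}$; $\operatorname{Aut}(\Lambda)$ is the group of $\mathbb{Z}$-linear bijections preserving the form. $\Lambda$ is a simply laced root lattice if it is generated by its set of roots $\Phi=\{\alpha\in\Lambda : (\alpha,\alpha)=2\}$. For $\gamma\in\Lambda$, $\gamma^\vee\in\operatorname{Hom}(\Lambda,\mathbb{Z})$ is $\gamma^\vee(\alpha)=(\gamma,\alpha)$. An automorphism $w\in\operatorname{Aut}(\Lambda)$ is elliptic if the group of coinvariants $\Lambda_w=\Lambda/(1-w)\Lambda$ is finite. Setting: $\Lambda$ is a simply laced root lattice, $w$ an elliptic automorphism of $\Lambda$ of order $d$, $k$ a field of characteristic zero containing a primitive $d$th root of unity $\zeta$, and $1\to\langle\zeta\rangle\to\mathscr{H}\to\Lambda_w\to1$ a central extension with commutator pairing $\langle\cdot,\cdot\rangle:\Lambda_w\times\Lambda_w\to\langle\zeta\rangle$.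 Let $\widetilde\Lambda=\Lambda\times_{\Lambda_w}\mathscr{H}$, a central extension of $\Lambda$ by $\langle\zeta\rangle$; its commutator pairing on $\Lambda$ (the pullback of that on $\Lambda_w$) is also written $\langle\cdot,\cdot\rangle$, so $\tilde\alpha\tilde\beta=\langle\alpha,\beta\rangle\tilde\beta\tilde\alpha$. Let $\widetilde\Phi$ be the preimage of $\Phi$ in $\widetilde\Lambda$; for $\tilde\alpha\in\widetilde\Phi$ write $\alpha$ for its image in $\Phi$. The quadruple $(\Lambda,w,\mathscr{H},\varepsilon)$ is an input datum if $\varepsilon:\Lambda\times\Lambda\to k^\times$ is bilinear (multiplicative in each variable) and: (1) $\varepsilon(\alpha,\beta)/\varepsilon(\beta,\alpha)=-\langle\beta,\alpha\rangle$ whenever $(\alpha,\beta)=-1$; (2) $\varepsilon(w\alpha,w\beta)=\varepsilon(\alpha,\beta)$ for all $\alpha,\beta\in\Lambda$. Construction of $\mathfrak{h}$: $\mathfrak{t}=\operatorname{Hom}(\Lambda,k)$, which is spanned by $\{\alpha^\vee:\alpha\in\Phi\}$; $\mathfrak{l}$ is the $k$-vector space generated by symbols $X_{\tilde\alpha}$, $\tilde\alpha\in\widetilde\Phi$, modulo the relations $X_{\zeta\tilde\alpha}=\zeta X_{\tilde\alpha}$; $\mathfrak{h}=\mathfrak{t}\oplus\mathfrak{l}$. The bracket is the $k$-bilinear map with $[\mathfrak{t},\mathfrak{t}]=0$, $[\alpha^\vee,X_{\tilde\beta}]=-[X_{\tilde\beta},\alpha^\vee]=(\alpha,\beta)X_{\tilde\beta}$,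 and $[X_{\tilde\alpha},X_{\tilde\beta}]=\varepsilon(\alpha,\beta)\,\tilde\alpha\tilde\beta\,\alpha^\vee$ if $\alpha+\beta=0$ (here $\tilde\alpha\tilde\beta\in\langle\zeta\rangle\subset k^\times$ acts as a scalar), $[X_{\tilde\alpha},X_{\tilde\beta}]=\varepsilon(\alpha,\beta)X_{\tilde\alpha\tilde\beta}$ if $\alpha+\beta\in\Phi$, and $[X_{\tilde\alpha},X_{\tilde\beta}]=0$ otherwise. *)

theory Defs
  imports
    "HOL-Library.Poly_Mapping"
    "HOL-Algebra.Module"
    "HOL-Algebra.Free_Abelian_Groups"
    "HOL-Algebra.Algebraic_Closure_Type"
begin

section \<open>Modules\<close>

definition lin_span :: "('r, 'a) ring_scheme \<Rightarrow> ('r, 'v, 'm) module_scheme \<Rightarrow> 'v set \<Rightarrow> 'v set"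
  where "lin_span R M S = \<Inter>{N. submodule N R M \<and> S \<subseteq> N}"

definition free_module :: "'a set \<Rightarrow> ('k::field, 'a \<Rightarrow>\<^sub>0 'k) module"
  where "free_module S =
    \<lparr>carrier = {f. Poly_Mapping.keys f \<subseteq> S}, monoid.mult = undefined, one = undefined,
     ring.zero = 0, add = (+), module.smult = (\<lambda>c. Poly_Mapping.map ((*) c))\<rparr>"

definition quotient_module :: "('r, 'v, 'm) module_scheme \<Rightarrow> 'v set \<Rightarrow> ('r, 'v set) module"
  where "quotient_module M N =
    \<lparr>carrier = a_rcosets\<^bsub>M\<^esub> N, monoid.mult = undefined, one = undefined,
     ring.zero = N, add = set_add M, module.smult = (\<lambda>c C. \<Union>x\<in>C. N +>\<^bsub>M\<^esub> (c \<odot>\<^bsub>M\<^esub> x))\<rparr>"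

definition direct_sum_module ::
    "('r, 'u, 'm) module_scheme \<Rightarrow> ('r, 'v, 'n) module_scheme \<Rightarrow> ('r, 'u \<times> 'v) module"
  where "direct_sum_module M N =
    \<lparr>carrier = carrier M \<times> carrier N, monoid.mult = undefined, one = undefined,
     ring.zero = (\<zero>\<^bsub>M\<^esub>, \<zero>\<^bsub>N\<^esub>),
     add = (\<lambda>(u, v) (u', v'). (u \<oplus>\<^bsub>M\<^esub> u', v \<oplus>\<^bsub>N\<^esub> v')),
     module.smult = (\<lambda>c (u, v). (c \<odot>\<^bsub>M\<^esub> u, c \<odot>\<^bsub>N\<^esub> v))\<rparr>"

definition bilinear_op ::
    "('r, 'a) ring_scheme \<Rightarrow> ('r, 'v, 'm) module_scheme \<Rightarrow> ('v \<Rightarrow> 'v \<Rightarrow> 'v) \<Rightarrow> bool"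
  where "bilinear_op R M b \<longleftrightarrow>
    (\<forall>x\<in>carrier M. \<forall>y\<in>carrier M. b x y \<in> carrier M) \<and>
    (\<forall>x\<in>carrier M. \<forall>y\<in>carrier M. \<forall>z\<in>carrier M. b (x \<oplus>\<^bsub>M\<^esub> y) z = b x z \<oplus>\<^bsub>M\<^esub> b y z) \<and>
    (\<forall>x\<in>carrier M. \<forall>y\<in>carrier M. \<forall>z\<in>carrier M. b z (x \<oplus>\<^bsub>M\<^esub> y) = b z x \<oplus>\<^bsub>M\<^esub> b z y) \<and>
    (\<forall>c\<in>carrier R. \<forall>x\<in>carrier M. \<forall>y\<in>carrier M. b (c \<odot>\<^bsub>M\<^esub> x) y = c \<odot>\<^bsub>M\<^esub> b x y) \<and>
    (\<forall>c\<in>carrier R. \<forall>x\<in>carrier M. \<forall>y\<in>carrier M. b x (c \<odot>\<^bsub>M\<^esub> y) = c \<odot>\<^bsub>M\<^esub> b x y)"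


section \<open>Lie algebras\<close>

text \<open>
  A Lie algebra is a \<^typ>\<open>('r, 'v) module\<close> whose multiplication field holds the bracket;
  the field \<^const>\<open>one\<close> carries no meaning.
\<close>

locale lie_algebra = R?: field R + module R L for R and L (structure) +
  assumes bracket_bilinear: "bilinear_op R L (\<otimes>\<^bsub>L\<^esub>)"
    and bracket_self: "x \<in> carrier L \<Longrightarrow> x \<otimes>\<^bsub>L\<^esub> x = \<zero>\<^bsub>L\<^esub>"
    and jacobi: "\<lbrakk>x \<in> carrier L; y \<in> carrier L; z \<in> carrier L\<rbrakk> \<Longrightarrow>
      x \<otimes>\<^bsub>L\<^esub> (y \<otimes>\<^bsub>L\<^esub> z) \<oplus>\<^bsub>L\<^esub> y \<otimes>\<^bsub>L\<^esub> (z \<otimes>\<^bsub>L\<^esub> x) \<oplus>\<^bsub>L\<^esub> z \<otimes>\<^bsub>L\<^esub> (x \<otimes>\<^bsub>L\<^esub> y) = \<zero>\<^bsub>L\<^esub>"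

definition lie_subalgebra ::
    "('r, 'a) ring_scheme \<Rightarrow> ('r, 'v, 'm) module_scheme \<Rightarrow> 'v set \<Rightarrow> bool"
  where "lie_subalgebra R L A \<longleftrightarrow>
    submodule A R L \<and> (\<forall>x\<in>A. \<forall>y\<in>A. x \<otimes>\<^bsub>L\<^esub> y \<in> A)"

definition lie_ideal ::
    "('r, 'a) ring_scheme \<Rightarrow> ('r, 'v, 'm) module_scheme \<Rightarrow> 'v set \<Rightarrow> bool"
  where "lie_ideal R L I \<longleftrightarrow>
    submodule I R L \<and> (\<forall>x\<in>carrier L. \<forall>y\<in>I. x \<otimes>\<^bsub>L\<^esub> y \<in> I)"

definition bracket_span ::
    "('r, 'a) ring_scheme \<Rightarrow> ('r, 'v, 'm) module_scheme \<Rightarrow> 'v set \<Rightarrow> 'v set \<Rightarrow> 'v set"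
  where "bracket_span R L A B = lin_span R L {x \<otimes>\<^bsub>L\<^esub> y | x y. x \<in> A \<and> y \<in> B}"

definition lie_solvable ::
    "('r, 'a) ring_scheme \<Rightarrow> ('r, 'v, 'm) module_scheme \<Rightarrow> 'v set \<Rightarrow> bool"
  where "lie_solvable R L A \<longleftrightarrow>
    (\<exists>n. ((\<lambda>B. bracket_span R L B B) ^^ n) A = {\<zero>\<^bsub>L\<^esub>})"

definition lie_nilpotent ::
    "('r, 'a) ring_scheme \<Rightarrow> ('r, 'v, 'm) module_scheme \<Rightarrow> 'v set \<Rightarrow> bool"
  where "lie_nilpotent R L A \<longleftrightarrow> (\<exists>n. (bracket_span R L A ^^ n) A = {\<zero>\<^bsub>L\<^esub>})"

text \<open>Semisimple means finite-dimensional with zero radical, so the zero algebra is included.\<close>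

locale semisimple_lie_algebra = lie_algebra +
  assumes finite_dimensional: "\<exists>S. finite S \<and> S \<subseteq> carrier L \<and> lin_span R L S = carrier L"
    and solvable_ideal_trivial: "\<lbrakk>lie_ideal R L I; lie_solvable R L I\<rbrakk> \<Longrightarrow> I = {\<zero>\<^bsub>L\<^esub>}"

definition lie_normalizer :: "('r, 'v, 'm) module_scheme \<Rightarrow> 'v set \<Rightarrow> 'v set"
  where "lie_normalizer L A = {x \<in> carrier L. \<forall>y\<in>A. x \<otimes>\<^bsub>L\<^esub> y \<in> A}"

definition cartan_subalgebra ::
    "('r, 'a) ring_scheme \<Rightarrow> ('r, 'v, 'm) module_scheme \<Rightarrow> 'v set \<Rightarrow> bool"
  where "cartan_subalgebra R L A \<longleftrightarrow>
    lie_subalgebra R L A \<and> lie_nilpotent R L A \<and> lie_normalizer L A = A"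

definition dual_group ::
    "('r, 'a) ring_scheme \<Rightarrow> ('r, 'v, 'm) module_scheme \<Rightarrow> 'v set \<Rightarrow> ('v \<Rightarrow> 'r) monoid"
  where "dual_group R M A =
    \<lparr>carrier = {\<phi> \<in> A \<rightarrow>\<^sub>E carrier R.
        (\<forall>x\<in>A. \<forall>y\<in>A. \<phi> (x \<oplus>\<^bsub>M\<^esub> y) = \<phi> x \<oplus>\<^bsub>R\<^esub> \<phi> y) \<and>
        (\<forall>c\<in>carrier R. \<forall>x\<in>A. \<phi> (c \<odot>\<^bsub>M\<^esub> x) = c \<otimes>\<^bsub>R\<^esub> \<phi> x)},
     monoid.mult = (\<lambda>\<phi> \<psi>. \<lambda>x\<in>A. \<phi> x \<oplus>\<^bsub>R\<^esub> \<psi> x),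
     one = (\<lambda>x\<in>A. \<zero>\<^bsub>R\<^esub>)\<rparr>"

definition weight_space :: "('r, 'v, 'm) module_scheme \<Rightarrow> 'v set \<Rightarrow> ('v \<Rightarrow> 'r) \<Rightarrow> 'v set"
  where "weight_space L A \<phi> = {x \<in> carrier L. \<forall>a\<in>A. a \<otimes>\<^bsub>L\<^esub> x = \<phi> a \<odot>\<^bsub>L\<^esub> x}"

definition lie_roots ::
    "('r, 'a) ring_scheme \<Rightarrow> ('r, 'v, 'm) module_scheme \<Rightarrow> 'v set \<Rightarrow> ('v \<Rightarrow> 'r) set"
  where "lie_roots R L A =
    {\<phi> \<in> carrier (dual_group R L A). \<phi> \<noteq> \<one>\<^bsub>dual_group R L A\<^esub> \<and> weight_space L A \<phi> \<noteq> {\<zero>\<^bsub>L\<^esub>}}"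

text \<open>
  Over a field that is not algebraically closed, \<^const>\<open>lie_roots\<close> accounts for every root
  only if the adjoint action of the subalgebra is diagonalizable over that field.
\<close>

definition lie_split ::
    "('r, 'a) ring_scheme \<Rightarrow> ('r, 'v, 'm) module_scheme \<Rightarrow> 'v set \<Rightarrow> bool"
  where "lie_split R L A \<longleftrightarrow>
    lin_span R L (\<Union>\<phi>\<in>carrier (dual_group R L A). weight_space L A \<phi>) = carrier L"

definition root_lattice_group ::
    "('r, 'a) ring_scheme \<Rightarrow> ('r, 'v, 'm) module_scheme \<Rightarrow> 'v set \<Rightarrow> ('v \<Rightarrow> 'r) monoid"
  where "root_lattice_group R L A = subgroup_generated (dual_group R L A) (lie_roots R L A)"


section \<open>Root lattices\<close>

definition additive_group :: "'l::ab_group_add monoid"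
  where "additive_group = \<lparr>carrier = UNIV, monoid.mult = (+), one = 0\<rparr>"

locale integral_lattice =
  fixes form :: "'l::ab_group_add \<Rightarrow> 'l \<Rightarrow> int"
  assumes free_finite_rank: "\<exists>n::nat. (additive_group :: 'l monoid) \<cong> free_Abelian_group {..<n}"
    and form_add: "form (x + y) z = form x z + form y z"
    and form_sym: "form x y = form y x"
    and form_pos: "x \<noteq> 0 \<Longrightarrow> 0 < form x x"
begin

definition roots :: "'l set"
  where "roots = {\<alpha>. form \<alpha> \<alpha> = 2}"

definition coroot :: "'l \<Rightarrow> 'l \<Rightarrow> 'k::field"
  where "coroot \<gamma> = (\<lambda>\<alpha>. of_int (form \<gamma> \<alpha>))"

definition automorphisms :: "('l \<Rightarrow> 'l) set"
  where "automorphisms = {w. bij w \<and> additive w \<and> (\<forall>x y. form (w x) (w y) = form x y)}"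

end

locale simply_laced_root_lattice = integral_lattice +
  assumes generated_by_roots: "generate additive_group roots = UNIV"

definition one_minus_image :: "('l::ab_group_add \<Rightarrow> 'l) \<Rightarrow> 'l set"
  where "one_minus_image w = range (\<lambda>x. x - w x)"

definition coinvariants :: "('l::ab_group_add \<Rightarrow> 'l) \<Rightarrow> 'l set monoid"
  where "coinvariants w = additive_group Mod one_minus_image w"

definition coinvariant_class :: "('l::ab_group_add \<Rightarrow> 'l) \<Rightarrow> 'l \<Rightarrow> 'l set"
  where "coinvariant_class w \<alpha> = one_minus_image w #>\<^bsub>additive_group\<^esub> \<alpha>"

definition power_group :: "'k::field \<Rightarrow> 'k monoid"
  where "power_group \<zeta> = \<lparr>carrier = range (\<lambda>n::nat. \<zeta> ^ n), monoid.mult = (*), one = 1\<rparr>"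

locale central_extension = group E
  for A :: "'a monoid" and E :: "'e monoid" (structure) and Q :: "'q monoid"
    and \<iota> :: "'a \<Rightarrow> 'e" and \<pi> :: "'e \<Rightarrow> 'q" +
  assumes \<iota>_mon: "\<iota> \<in> mon A E"
    and \<pi>_epi: "\<pi> \<in> epi E Q"
    and exact: "\<iota> ` carrier A = kernel E Q \<pi>"
    and central: "\<lbrakk>z \<in> carrier A; g \<in> carrier E\<rbrakk> \<Longrightarrow> \<iota> z \<otimes> g = g \<otimes> \<iota> z"
begin

definition commutator_pairing :: "'q \<Rightarrow> 'q \<Rightarrow> 'a"
  where "commutator_pairing x y = (THE z. z \<in> carrier A \<and>
    (\<forall>g\<in>carrier E. \<forall>h\<in>carrier E. \<pi> g = x \<and> \<pi> h = y \<longrightarrow> g \<otimes> h = \<iota> z \<otimes> (h \<otimes> g)))"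

end


section \<open>Input data and the associated algebra\<close>

locale extension_datum =
  simply_laced_root_lattice form +
  central_extension "power_group \<zeta>" H "coinvariants w" \<iota> \<pi>
  for form :: "'l::ab_group_add \<Rightarrow> 'l \<Rightarrow> int"
    and w :: "'l \<Rightarrow> 'l"
    and d :: nat
    and \<zeta> :: "'k::field_char_0"
    and H :: "'h monoid" (structure)
    and \<iota> :: "'k \<Rightarrow> 'h"
    and \<pi> :: "'h \<Rightarrow> 'l set" +
  assumes w_automorphism: "w \<in> automorphisms"
    and w_elliptic: "finite (carrier (coinvariants w))"
    and w_order: "0 < d" "w ^^ d = id" "\<lbrakk>0 < m; m < d\<rbrakk> \<Longrightarrow> w ^^ m \<noteq> id"
    and \<zeta>_primitive: "\<zeta> ^ d = 1" "\<lbrakk>0 < m; m < d\<rbrakk> \<Longrightarrow> \<zeta> ^ m \<noteq> 1"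
begin

definition pairing :: "'l \<Rightarrow> 'l \<Rightarrow> 'k"
  where "pairing \<alpha> \<beta> =
    commutator_pairing (coinvariant_class w \<alpha>) (coinvariant_class w \<beta>)"

definition ext_lattice :: "('l \<times> 'h) monoid"
  where "ext_lattice = (additive_group \<times>\<times> H)
    \<lparr>carrier := {(\<alpha>, h). h \<in> carrier H \<and> \<pi> h = coinvariant_class w \<alpha>}\<rparr>"

definition ext_incl :: "'k \<Rightarrow> 'l \<times> 'h"
  where "ext_incl z = (0, \<iota> z)"

definition ext_roots :: "('l \<times> 'h) set"
  where "ext_roots = {a \<in> carrier ext_lattice. fst a \<in> roots}"

text \<open>\<open>scalar_of\<close> is meaningful only on the preimage of \<open>0\<close> in \<open>ext_lattice\<close>.\<close>

definition scalar_of :: "'l \<times> 'h \<Rightarrow> 'k"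
  where "scalar_of = inv_into (carrier (power_group \<zeta>)) ext_incl"

definition torus :: "('k, 'l \<Rightarrow> 'k) module"
  where "torus = \<lparr>carrier = {f. additive f}, monoid.mult = undefined, one = undefined,
    ring.zero = (\<lambda>_. 0), add = (\<lambda>f g x. f x + g x), module.smult = (\<lambda>c f x. c * f x)\<rparr>"

definition symbol_relations :: "('l \<times> 'h \<Rightarrow>\<^sub>0 'k) set"
  where "symbol_relations = lin_span ring_of_type_algebra (free_module ext_roots)
    {Poly_Mapping.single (ext_incl \<zeta> \<otimes>\<^bsub>ext_lattice\<^esub> a) 1 - Poly_Mapping.single a \<zeta> | a.
       a \<in> ext_roots}"

definition root_part :: "('k, ('l \<times> 'h \<Rightarrow>\<^sub>0 'k) set) module"
  where "root_part = quotient_module (free_module ext_roots) symbol_relations"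

definition root_vec :: "'l \<times> 'h \<Rightarrow> ('l \<times> 'h \<Rightarrow>\<^sub>0 'k) set"
  where "root_vec a = symbol_relations +>\<^bsub>free_module ext_roots\<^esub> Poly_Mapping.single a 1"

definition hspace :: "('k, ('l \<Rightarrow> 'k) \<times> ('l \<times> 'h \<Rightarrow>\<^sub>0 'k) set) module"
  where "hspace = direct_sum_module torus root_part"

definition in_torus :: "('l \<Rightarrow> 'k) \<Rightarrow> ('l \<Rightarrow> 'k) \<times> ('l \<times> 'h \<Rightarrow>\<^sub>0 'k) set"
  where "in_torus f = (f, \<zero>\<^bsub>root_part\<^esub>)"

definition in_root_part :: "('l \<times> 'h \<Rightarrow>\<^sub>0 'k) set \<Rightarrow> ('l \<Rightarrow> 'k) \<times> ('l \<times> 'h \<Rightarrow>\<^sub>0 'k) set"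
  where "in_root_part v = (\<zero>\<^bsub>torus\<^esub>, v)"

definition hcartan :: "(('l \<Rightarrow> 'k) \<times> ('l \<times> 'h \<Rightarrow>\<^sub>0 'k) set) set"
  where "hcartan = in_torus ` carrier torus"

definition evaluation :: "'l \<Rightarrow> ('l \<Rightarrow> 'k) \<times> ('l \<times> 'h \<Rightarrow>\<^sub>0 'k) set \<Rightarrow> 'k"
  where "evaluation \<alpha> = (\<lambda>x\<in>hcartan. fst x \<alpha>)"

end

locale input_datum = extension_datum form w d \<zeta> H \<iota> \<pi>
  for form :: "'l::ab_group_add \<Rightarrow> 'l \<Rightarrow> int"
    and w :: "'l \<Rightarrow> 'l"
    and d :: nat
    and \<zeta> :: "'k::field_char_0"
    and H :: "'h monoid" (structure)
    and \<iota> :: "'k \<Rightarrow> 'h"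
    and \<pi> :: "'h \<Rightarrow> 'l set" +
  fixes \<epsilon> :: "'l \<Rightarrow> 'l \<Rightarrow> 'k"
  assumes \<epsilon>_nonzero: "\<epsilon> \<alpha> \<beta> \<noteq> 0"
    and \<epsilon>_left: "\<epsilon> (\<alpha> + \<beta>) \<gamma> = \<epsilon> \<alpha> \<gamma> * \<epsilon> \<beta> \<gamma>"
    and \<epsilon>_right: "\<epsilon> \<gamma> (\<alpha> + \<beta>) = \<epsilon> \<gamma> \<alpha> * \<epsilon> \<gamma> \<beta>"
    and \<epsilon>_commutator: "form \<alpha> \<beta> = - 1 \<Longrightarrow> \<epsilon> \<alpha> \<beta> / \<epsilon> \<beta> \<alpha> = - pairing \<beta> \<alpha>"
    and \<epsilon>_invariant: "\<epsilon> (w \<alpha>) (w \<beta>) = \<epsilon> \<alpha> \<beta>"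
begin

definition is_bracket :: "(('l \<Rightarrow> 'k) \<times> ('l \<times> 'h \<Rightarrow>\<^sub>0 'k) set \<Rightarrow> ('l \<Rightarrow> 'k) \<times> ('l \<times> 'h \<Rightarrow>\<^sub>0 'k) set \<Rightarrow>
    ('l \<Rightarrow> 'k) \<times> ('l \<times> 'h \<Rightarrow>\<^sub>0 'k) set) \<Rightarrow> bool"
  where "is_bracket br \<longleftrightarrow>
    bilinear_op ring_of_type_algebra hspace br \<and>
    (\<forall>f\<in>carrier torus. \<forall>g\<in>carrier torus. br (in_torus f) (in_torus g) = \<zero>\<^bsub>hspace\<^esub>) \<and>
    (\<forall>\<alpha>\<in>roots. \<forall>b\<in>ext_roots.
       br (in_torus (coroot \<alpha>)) (in_root_part (root_vec b)) =
         of_int (form \<alpha> (fst b)) \<odot>\<^bsub>hspace\<^esub> in_root_part (root_vec b) \<and>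
       br (in_root_part (root_vec b)) (in_torus (coroot \<alpha>)) =
         - of_int (form \<alpha> (fst b)) \<odot>\<^bsub>hspace\<^esub> in_root_part (root_vec b)) \<and>
    (\<forall>a\<in>ext_roots. \<forall>b\<in>ext_roots.
       br (in_root_part (root_vec a)) (in_root_part (root_vec b)) =
        (if fst a + fst b = 0 then
           (\<epsilon> (fst a) (fst b) * scalar_of (a \<otimes>\<^bsub>ext_lattice\<^esub> b)) \<odot>\<^bsub>hspace\<^esub> in_torus (coroot (fst a))
         else if fst a + fst b \<in> roots then
           \<epsilon> (fst a) (fst b) \<odot>\<^bsub>hspace\<^esub> in_root_part (root_vec (a \<otimes>\<^bsub>ext_lattice\<^esub> b))
         else \<zero>\<^bsub>hspace\<^esub>))"

text \<open>
  Exactly one bilinear map on the carrier satisfies \<open>is_bracket\<close>, since the coroots of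
  the roots span the torus; the choice below only affects values outside the carrier.
\<close>

definition halgebra :: "('k, ('l \<Rightarrow> 'k) \<times> ('l \<times> 'h \<Rightarrow>\<^sub>0 'k) set) module"
  where "halgebra = hspace\<lparr>monoid.mult := (SOME br. is_bracket br)\<rparr>"

end

end

theory Submission
  imports Defs "HOL-Library.Function_Algebras" "HOL-Library.Product_Plus"
begin

text \<open>
  A set-theoretic section \<open>\<alpha> \<mapsto> (\<alpha>, sec \<alpha>)\<close> of the central extension of the lattice turns the symbols
  \<open>X\<close> into honest basis vectors \<open>e \<alpha>\<close> indexed by the roots, and the bracket becomes
  \<open>[e \<alpha>, e \<beta>] = \<eta> \<alpha> \<beta> e (\<alpha> + \<beta>)\<close>, where \<open>\<eta>\<close> is the product of the bilinear \<open>\<epsilon>\<close> with the 2-cocycle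
  of the section. So \<open>\<eta>\<close> is a normalized 2-cocycle, and condition (1) says exactly that
  \<open>\<eta> \<alpha> \<beta> = - \<eta> \<beta> \<alpha>\<close> whenever \<open>form \<alpha> \<beta> = - 1\<close>. These two properties give the Jacobi identity, by a
  case analysis on the three pairwise products of roots, which lie between \<open>-2\<close> and \<open>2\<close>.

  Gram--Schmidt shows that the coroots of the roots span the torus, so the bracket is determined by
  its values on generators. A nonzero ideal contains some \<open>e \<alpha>\<close>, because torus elements separate the
  roots; hence it contains a copy of the perfect algebra \<open>sl\<^sub>2\<close> and cannot be solvable.
\<close>

section \<open>Root lattices\<close>

text \<open>The symbols live in a quotient whose elements are cosets, and the bracket is a choice
  constrained only by its values on generators; neither is convenient for computing. So the Lie
  theory is done in a model of pairs of functions on the lattice with an explicit bracket and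
  carried over by a coordinate bijection. The transfer is used twice: pulling the model bracket back
  shows that a bracket with the prescribed values exists, and uniqueness then puts the chosen
  bracket into the same coordinates. The cocycle law of \<open>\<eta>\<close> has two sources:
  associativity in the extension for the section, bimultiplicativity for \<open>\<epsilon>\<close>.
  The commutator pairing is the quotient of the section cocycle by its transpose, so it cancels
  against the pairing in condition (1) and leaves a bare sign. For opposite roots
  \<open>\<eta>\<close> is symmetric by the cocycle law, and the sign of the bracket comes from the
  coroot. Characteristic zero enters through division by form values and by 2.\<close>

lemma comm_group_additive_group: "comm_group (additive_group :: 'a::ab_group_add monoid)"
proof (rule comm_groupI)
  show "\<exists>y\<in>carrier additive_group. y \<otimes>\<^bsub>additive_group\<^esub> x = \<one>\<^bsub>additive_group\<^esub>" for x :: 'a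
    by (rule bexI[of _ "- x"]) (simp_all add: additive_group_def)
qed (simp_all add: additive_group_def add.assoc add.commute)

lemma inv_additive_group: "inv\<^bsub>additive_group\<^esub> x = - (x :: 'a::ab_group_add)"
proof -
  interpret comm_group "additive_group :: 'a monoid" by (rule comm_group_additive_group)
  show ?thesis by (rule inv_equality) (simp_all add: additive_group_def)
qed

section \<open>Inner products and finiteness of the roots\<close>

context integral_lattice
begin

lemma form_add_right: "form z (x + y) = form z x + form z y"
  using form_add form_sym by metis

lemma additive_form: "additive (\<lambda>x. form x y)"
  by (simp add: additive_def form_add)

lemma additive_form_right: "additive (form x)"
  by (simp add: additive_def form_add_right)

lemma form_simps [simp]:
  "form 0 x = 0" "form x 0 = 0" "form (- x) y = - form x y" "form x (- y) = - form x y"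
  "form (x - y) z = form x z - form y z" "form z (x - y) = form z x - form z y"
  using additive.zero[OF additive_form] additive.zero[OF additive_form_right]
    additive.minus[OF additive_form] additive.minus[OF additive_form_right]
    additive.diff[OF additive_form] additive.diff[OF additive_form_right]
  by blast+

lemma form_self_eq_0_iff [simp]: "form x x = 0 \<longleftrightarrow> x = 0"
  using form_pos[of x] by (cases "x = 0") auto

lemma form_self_nonneg: "0 \<le> form x x"
  using form_pos[of x] by (cases "x = 0") auto

lemma mem_roots: "\<alpha> \<in> roots \<longleftrightarrow> form \<alpha> \<alpha> = 2"
  by (simp add: roots_def)

lemma zero_not_root [simp]: "0 \<notin> roots"
  by (simp add: mem_roots)

lemma uminus_root [simp]: "- \<alpha> \<in> roots \<longleftrightarrow> \<alpha> \<in> roots"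
  by (simp add: mem_roots)

lemma root_form_bounds:
  assumes "\<alpha> \<in> roots" "\<beta> \<in> roots"
  shows "- 2 \<le> form \<alpha> \<beta>" "form \<alpha> \<beta> \<le> 2"
    "form \<alpha> \<beta> = - 2 \<longleftrightarrow> \<alpha> + \<beta> = 0" "form \<alpha> \<beta> = 2 \<longleftrightarrow> \<alpha> = \<beta>"
proof -
  have s: "form (\<alpha> + \<beta>) (\<alpha> + \<beta>) = 4 + 2 * form \<alpha> \<beta>"
    using assms by (simp add: mem_roots form_add form_add_right form_sym[of \<beta> \<alpha>])
  have d: "form (\<alpha> - \<beta>) (\<alpha> - \<beta>) = 4 - 2 * form \<alpha> \<beta>"
    using assms by (simp add: mem_roots form_sym[of \<beta> \<alpha>])
  show "- 2 \<le> form \<alpha> \<beta>" using s form_self_nonneg[of "\<alpha> + \<beta>"] by simp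
  show "form \<alpha> \<beta> \<le> 2" using d form_self_nonneg[of "\<alpha> - \<beta>"] by simp
  show "form \<alpha> \<beta> = - 2 \<longleftrightarrow> \<alpha> + \<beta> = 0"
    using s form_self_eq_0_iff[of "\<alpha> + \<beta>"] by auto
  show "form \<alpha> \<beta> = 2 \<longleftrightarrow> \<alpha> = \<beta>"
    using d form_self_eq_0_iff[of "\<alpha> - \<beta>"] by auto
qed

lemma root_add_root_iff:
  assumes "\<alpha> \<in> roots" "\<beta> \<in> roots"
  shows "\<alpha> + \<beta> \<in> roots \<longleftrightarrow> form \<alpha> \<beta> = - 1"
  using assms by (auto simp: mem_roots form_add form_add_right form_sym[of \<beta> \<alpha>])

text \<open>Reduction modulo 3 is injective on roots, and its target is finite because the rank is
  finite. Two congruent roots differ by 3g for some lattice vector g, so 9 (g,g) is the norm of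
  their difference, which is at most 8; hence g = 0. The modulus 2 would not do, since \<alpha> and
  -\<alpha> are congruent modulo 2.\<close>

lemma finite_roots: "finite roots"
proof -
  obtain n :: nat and \<phi> :: "'l \<Rightarrow> nat \<Rightarrow>\<^sub>0 int"
    where \<phi>: "\<phi> \<in> iso additive_group (free_Abelian_group {..<n})"
    using free_finite_rank by (auto simp: is_iso_def)
  have add: "\<phi> (x + y) = \<phi> x + \<phi> y" for x y
    using \<phi> by (auto simp: iso_def hom_def additive_group_def)
  have keys: "Poly_Mapping.keys (\<phi> x) \<subseteq> {..<n}" for x
    using \<phi> by (auto simp: iso_def hom_def additive_group_def Pi_def)
  have inj: "inj \<phi>"
    using \<phi> by (auto simp: iso_def bij_betw_def additive_group_def)
  have "range \<phi> = {p. Poly_Mapping.keys p \<subseteq> {..<n}}"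
    using \<phi> by (auto simp: iso_def bij_betw_def additive_group_def)
  then have surj: "\<exists>x. \<phi> x = p" if "Poly_Mapping.keys p \<subseteq> {..<n}" for p
    using that by (metis (mono_tags) mem_Collect_eq rangeE)
  have diff: "\<phi> (x - y) = \<phi> x - \<phi> y" for x y
    using additive.diff[of \<phi>] add by (simp add: additive_def)
  define r where "r x = (\<lambda>i\<in>{..<n}. Poly_Mapping.lookup (\<phi> x) i mod 3)" for x
  have "inj_on r roots"
  proof (rule inj_onI)
    fix x y assume xy: "x \<in> roots" "y \<in> roots" "r x = r y"
    have mod3: "Poly_Mapping.lookup (\<phi> (x - y)) i mod 3 = 0" for i
    proof (cases "i < n")
      case True
      then have "Poly_Mapping.lookup (\<phi> x) i mod 3 = Poly_Mapping.lookup (\<phi> y) i mod 3"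
        using fun_cong[OF xy(3), of i] by (simp add: r_def)
      then show ?thesis
        by (simp add: diff lookup_minus mod_eq_dvd_iff dvd_imp_mod_0)
    next
      case False
      then have "i \<notin> Poly_Mapping.keys (\<phi> (x - y))" using keys by auto
      then show ?thesis by (simp add: in_keys_iff)
    qed
    define q where "q = Poly_Mapping.map (\<lambda>c. c div 3) (\<phi> (x - y))"
    have q: "Poly_Mapping.lookup q i = Poly_Mapping.lookup (\<phi> (x - y)) i div 3" for i
      by (simp add: q_def map.rep_eq when_def)
    have "Poly_Mapping.keys q \<subseteq> Poly_Mapping.keys (\<phi> (x - y))"
      by (auto simp: in_keys_iff q)
    then have "Poly_Mapping.keys q \<subseteq> {..<n}"
      using keys by blast
    then obtain g where g: "\<phi> g = q" using surj by blast
    have "\<phi> (g + g + g) = \<phi> (x - y)"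
    proof (rule poly_mapping_eqI)
      fix i
      show "Poly_Mapping.lookup (\<phi> (g + g + g)) i = Poly_Mapping.lookup (\<phi> (x - y)) i"
        unfolding add g lookup_add q using mod3[of i] by presburger
    qed
    then have ggg: "g + g + g = x - y" using inj by (simp add: inj_eq)
    moreover have "form (g + g + g) (g + g + g) = 9 * form g g"
      by (simp add: form_add form_add_right)
    ultimately have "form (x - y) (x - y) = 9 * form g g" by metis
    moreover have "form (x - y) (x - y) = 4 - 2 * form x y"
      using xy by (simp add: mem_roots form_sym[of y x])
    ultimately have "form g g \<le> 0" using root_form_bounds(1)[OF xy(1,2)] by linarith
    then have "g = 0" using form_pos[of g] by force
    then show "x = y" using ggg by simp
  qed
  moreover have "finite (r ` roots)"
  proof (rule finite_subset)
    show "r ` roots \<subseteq> {..<n} \<rightarrow>\<^sub>E {0..<3}"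
      by (rule image_subsetI) (simp add: r_def restrict_PiE_iff)
  qed (simp add: finite_PiE)
  ultimately show ?thesis using finite_imageD by blast
qed


section \<open>Integer multiples and integral Gram-Schmidt\<close>

definition zmult :: "int \<Rightarrow> 'l \<Rightarrow> 'l"
  where "zmult n x = (\<Sum>i<nat n. x) - (\<Sum>i<nat (- n). x)"

text \<open>One of the two sums in \<open>zmult\<close> is always empty, according to the sign of
  \<open>n\<close>, so an additive map passes through the other one termwise.\<close>

lemma additive_zmult:
  fixes f :: "'l \<Rightarrow> 'r::ring_1"
  assumes "additive f"
  shows "f (zmult n x) = of_int n * f x"
proof -
  interpret additive f by fact
  show ?thesis by (cases "n \<ge> 0") (simp_all add: zmult_def diff sum minus)
qed

lemma form_zmult [simp]: "form (zmult n x) y = n * form x y" "form y (zmult n x) = n * form y x"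
  using additive_zmult[OF additive_form, of n x y] additive_zmult[OF additive_form_right, of y n x]
  by simp_all

text \<open>Gram--Schmidt: \<open>u\<close> is a positive multiple of the component of \<open>s\<close> orthogonal to \<open>S\<close>.\<close>

lemma orthogonal_component:
  assumes "finite S"
  shows "\<exists>u. \<exists>n>0. (\<forall>p\<in>S. form u p = 0) \<and>
    (\<forall>f::'l \<Rightarrow> 'k::field_char_0. additive f \<longrightarrow> (\<forall>p\<in>S. f p = 0) \<longrightarrow> f u = of_int n * f s) \<and>
    (\<forall>z. (\<forall>p\<in>S. form z p = 0) \<longrightarrow> form z u = n * form z s)"
  using assms
proof (induction S arbitrary: s rule: finite_induct)
  case empty
  show ?case by (rule exI[of _ s], rule exI[of _ 1]) simp
next
  case (insert p S)
  obtain v m where v: "m > 0" "\<And>q. q \<in> S \<Longrightarrow> form v q = 0"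
    "\<And>f::'l \<Rightarrow> 'k. additive f \<Longrightarrow> (\<forall>p\<in>S. f p = 0) \<Longrightarrow> f v = of_int m * f p"
    "\<And>z. (\<forall>p\<in>S. form z p = 0) \<Longrightarrow> form z v = m * form z p"
    using insert.IH[of p] by blast
  obtain y n where y: "n > 0" "\<And>q. q \<in> S \<Longrightarrow> form y q = 0"
    "\<And>f::'l \<Rightarrow> 'k. additive f \<Longrightarrow> (\<forall>p\<in>S. f p = 0) \<Longrightarrow> f y = of_int n * f s"
    "\<And>z. (\<forall>p\<in>S. form z p = 0) \<Longrightarrow> form z y = n * form z s"
    using insert.IH[of s] by blast
  show ?case
  proof (cases "v = 0")
    case True
    \<comment> \<open>Here \<open>p\<close> depends rationally on \<open>S\<close>, so orthogonality
      to \<open>S\<close> already implies orthogonality to \<open>p\<close>.\<close>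
    have "form y p = 0" using v(1) v(4)[of y] y(2) True by simp
    then show ?thesis
      using y by (intro exI[of _ y] exI[of _ n]) simp
  next
    case False
    \<comment> \<open>The vectors \<open>v\<close> and \<open>y\<close> are the scaled components of
      \<open>p\<close> and \<open>s\<close> orthogonal to \<open>S\<close>. Subtracting from
      \<open>y\<close> its projection onto \<open>v\<close> needs division by
      \<open>form v v\<close>; multiplying through by this number keeps \<open>u\<close> in the
      lattice, and is why the factor becomes \<open>form v v * n\<close>.\<close>
    define u where "u = zmult (form v v) y - zmult (form v y) v"
    have uS: "form u q = 0" if "q \<in> S" for q
      using that v(2) y(2) by (simp add: u_def)
    \<comment> \<open>For vectors orthogonal to \<open>S\<close>, pairing with \<open>p\<close> and
      pairing with \<open>v\<close> agree up to the positive factor \<open>m\<close>, so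
      orthogonality to \<open>v\<close> suffices.\<close>
    have "m * form u p = form u v" using v(4)[of u] uS by simp
    also have "\<dots> = 0" by (simp add: u_def form_sym[of y v])
    finally have "form u p = 0" using v(1) by simp
    moreover have "f u = of_int (form v v * n) * f s"
      if f: "additive f" "\<forall>q\<in>insert p S. f q = 0" for f :: "'l \<Rightarrow> 'k"
      using v(3)[of f] y(3)[of f] f
      by (simp add: u_def additive.diff[OF f(1)] additive_zmult[OF f(1)])
    moreover have "form z u = form v v * n * form z s"
      if z: "\<forall>q\<in>insert p S. form z q = 0" for z
      using v(4)[of z] y(4)[of z] z by (simp add: u_def)
    moreover have "form v v * n > 0" using y(1) False form_pos by simp
    ultimately show ?thesis
      using uS by (intro exI[of _ u] exI[of _ "form v v * n"]) simp
  qed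
qed

end

section \<open>Coroots span the torus\<close>

context simply_laced_root_lattice
begin

lemma root_generated_induct [case_names zero root uminus add]:
  assumes "P 0" "\<And>\<alpha>. \<alpha> \<in> roots \<Longrightarrow> P \<alpha>" "\<And>\<alpha>. P \<alpha> \<Longrightarrow> P (- \<alpha>)"
    "\<And>x y. P x \<Longrightarrow> P y \<Longrightarrow> P (x + y)"
  shows "P (x::'a)"
proof -
  have "x \<in> generate additive_group roots" by (simp add: generated_by_roots)
  then show ?thesis
  proof (induction rule: generate.induct)
    case one then show ?case using assms(1) by (simp add: additive_group_def)
  next
    case (inv h) then show ?case using assms(2,3) by (simp add: inv_additive_group)
  next
    case (eng h1 h2) then show ?case using assms(4) by (simp add: additive_group_def)
  qed (use assms(2) in simp)
qed

lemma additive_eqI_roots: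
  fixes f g :: "'a \<Rightarrow> 'b::ab_group_add"
  assumes "additive f" "additive g" "\<And>\<alpha>. \<alpha> \<in> roots \<Longrightarrow> f \<alpha> = g \<alpha>"
  shows "f x = g x"
proof (induction x rule: root_generated_induct)
qed (use assms in \<open>simp_all add: additive.zero additive.minus additive.add\<close>)

text \<open>The spanning statement in the form of an induction rule. An additive function is
  determined by its values on the finitely many roots. These values are matched one root at a time:
  the correction at a new root is a multiple of the coroot of a vector orthogonal to the roots
  treated before, so the earlier values are not disturbed.\<close>

lemma additive_coroot_induct [consumes 1, case_names zero coroot add scale]:
  fixes f :: "'a \<Rightarrow> 'k::field_char_0"
  assumes f: "additive f"
    and P0: "P (\<lambda>_. 0)"
    and Pc: "\<And>\<alpha>. \<alpha> \<in> roots \<Longrightarrow> P (coroot \<alpha>)"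
    and Pa: "\<And>g h. additive g \<Longrightarrow> P g \<Longrightarrow> additive h \<Longrightarrow> P h \<Longrightarrow> P (\<lambda>x. g x + h x)"
    and Ps: "\<And>c g. additive g \<Longrightarrow> P g \<Longrightarrow> P (\<lambda>x. c * g x)"
  shows "P f"
proof -
  have ac: "additive (coroot \<gamma> :: 'a \<Rightarrow> 'k)" for \<gamma>
    by (simp add: additive_def coroot_def form_add_right)
  have as: "additive (\<lambda>x. c * coroot \<gamma> x)" for c :: 'k and \<gamma>
    by (simp add: additive_def coroot_def form_add_right algebra_simps)
  \<comment> \<open>The correction vectors from Gram-Schmidt are lattice vectors that need not be
    roots, so the property is first extended from roots to all of the lattice.\<close>
  have PC: "P (coroot \<gamma>)" for \<gamma>
  proof (induction \<gamma> rule: root_generated_induct)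
    case zero show ?case using P0 by (simp add: coroot_def)
  next
    case (root \<alpha>) then show ?case by (rule Pc)
  next
    case (uminus \<alpha>) then show ?case using Ps[OF ac, of \<alpha> "- 1"] by (simp add: coroot_def)
  next
    case (add x y) then show ?case using Pa[OF ac _ ac, of x y] by (simp add: coroot_def form_add)
  qed
  have "\<exists>g. additive g \<and> P g \<and> (\<forall>s\<in>S. f s = g s)" if "finite S" for S
    using that
  proof (induction S rule: finite_induct)
    case empty
    then show ?case using P0 by (intro exI[of _ "\<lambda>_. 0"]) (simp add: additive_def)
  next
    case (insert s S)
    then obtain g where g: "additive g" "P g" "\<forall>s\<in>S. f s = g s" by blast
    define h where "h x = f x - g x" for x
    have h: "additive h" using f g(1) by (simp add: h_def additive_def)
    have hS: "\<forall>s\<in>S. h s = 0" using g(3) by (simp add: h_def)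
    obtain u n where u: "n > 0" "\<forall>p\<in>S. form u p = 0"
      "\<And>f::'a \<Rightarrow> 'k. additive f \<Longrightarrow> (\<forall>p\<in>S. f p = 0) \<Longrightarrow> f u = of_int n * f s"
      "\<And>z. (\<forall>p\<in>S. form z p = 0) \<Longrightarrow> form z u = n * form z s"
      using orthogonal_component[OF insert.hyps(1), of s, where ?'k = 'k] by blast
    show ?case
    proof (cases "u = 0")
      case True
      \<comment> \<open>If the orthogonal component of \<open>s\<close> vanishes, the values on
        \<open>S\<close> force the value at \<open>s\<close>:
        \<open>of_int n * h s = h 0 = 0\<close>, so \<open>g\<close> already agrees with
        \<open>f\<close> there.\<close>
      then have "h s = 0" using u(1) u(3)[OF h hS] additive.zero[OF h] by simp
      then show ?thesis using g by (intro exI[of _ g]) (simp add: h_def)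
    next
      case False
      \<comment> \<open>Chosen so that \<open>c * coroot u s = h s\<close>: pairing \<open>u\<close>
        with itself gives \<open>form u u = n * form u s\<close>, hence \<open>form u s\<close> is
        \<open>form u u / n\<close>.\<close>
      define c where "c = h s * of_int n / of_int (form u u)"
      have "form u u = n * form u s" using u(2,4) by blast
      then have "c * coroot u s = h s"
        using False u(1) by (auto simp: c_def coroot_def field_simps)
      then have "f t = g t + c * coroot u t" if "t \<in> insert s S" for t
        using that g(3) u(2) by (auto simp: h_def coroot_def)
      moreover have "P (\<lambda>x. g x + c * coroot u x)"
        using g PC ac as by (intro Pa Ps) auto
      moreover have "additive (\<lambda>x. g x + c * coroot u x)"
        using g(1) as[of c u] by (simp add: additive_def algebra_simps)
      ultimately show ?thesis by blast
    qed
  qed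
  from this[OF finite_roots] obtain g where g: "additive g" "P g" "\<forall>s\<in>roots. f s = g s" by blast
  then have "f = g" using additive_eqI_roots[OF f g(1)] by blast
  then show ?thesis using g(2) by simp
qed

end

section \<open>The Lie algebra of a root system with a 2-cocycle\<close>

text \<open>This isolates what the Lie algebra needs from the extension and from
  \<open>\<epsilon>\<close>. The sign condition concerns the pairs whose sum is a root; pairs with
  sum zero are governed by \<open>cocycle_opposite\<close>.\<close>

locale root_cocycle = simply_laced_root_lattice form
  for form :: "'l::ab_group_add \<Rightarrow> 'l \<Rightarrow> int" +
  fixes \<eta> :: "'l \<Rightarrow> 'l \<Rightarrow> 'k::field_char_0"
  assumes cocycle: "\<eta> \<alpha> \<beta> * \<eta> (\<alpha> + \<beta>) \<gamma> = \<eta> \<beta> \<gamma> * \<eta> \<alpha> (\<beta> + \<gamma>)"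
    and cocycle_nonzero: "\<eta> \<alpha> \<beta> \<noteq> 0"
    and cocycle_zero_left: "\<eta> 0 \<alpha> = 1"
    and cocycle_skew: "form \<alpha> \<beta> = - 1 \<Longrightarrow> \<eta> \<alpha> \<beta> = - \<eta> \<beta> \<alpha>"
begin

lemma cocycle_zero_right: "\<eta> \<alpha> 0 = 1"
  using cocycle[of \<alpha> 0 0] cocycle_nonzero[of \<alpha> 0] by (simp add: cocycle_zero_left)

text \<open>The cocycle identity for the triple \<alpha>, -\<alpha>, \<alpha>, in which both outer
  factors are normalized to 1.\<close>

lemma cocycle_opposite: "\<alpha> + \<beta> = 0 \<Longrightarrow> \<eta> \<alpha> \<beta> = \<eta> \<beta> \<alpha>"
  using cocycle[of \<alpha> \<beta> \<alpha>] by (simp add: cocycle_zero_left cocycle_zero_right add.commute)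

section \<open>The bracket in root coordinates\<close>

definition scale :: "'k \<Rightarrow> ('l \<Rightarrow> 'k) \<times> ('l \<Rightarrow> 'k) \<Rightarrow> ('l \<Rightarrow> 'k) \<times> ('l \<Rightarrow> 'k)"
  where "scale c x = (\<lambda>\<gamma>. c * fst x \<gamma>, \<lambda>\<gamma>. c * snd x \<gamma>)"

definition root_vector :: "'l \<Rightarrow> ('l \<Rightarrow> 'k) \<times> ('l \<Rightarrow> 'k)"
  where "root_vector \<alpha> = (0, \<lambda>\<gamma>. if \<gamma> = \<alpha> then 1 else 0)"

text \<open>
  A pair \<open>(t, g)\<close> stands for the torus element \<open>t\<close> plus the sum of \<open>g \<alpha>\<close> times \<open>root_vector \<alpha>\<close> over all
  roots. The bracket is a total function, bilinear also outside of \<open>model\<close>.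
\<close>

definition brk :: "('l \<Rightarrow> 'k) \<times> ('l \<Rightarrow> 'k) \<Rightarrow> ('l \<Rightarrow> 'k) \<times> ('l \<Rightarrow> 'k) \<Rightarrow> ('l \<Rightarrow> 'k) \<times> ('l \<Rightarrow> 'k)"
  where "brk x y =
    (\<lambda>\<delta>. \<Sum>\<alpha>\<in>roots. \<eta> \<alpha> (- \<alpha>) * snd x \<alpha> * snd y (- \<alpha>) * of_int (form \<alpha> \<delta>),
     \<lambda>\<gamma>. if \<gamma> \<in> roots then fst x \<gamma> * snd y \<gamma> - fst y \<gamma> * snd x \<gamma> +
       (\<Sum>\<alpha>\<in>{\<alpha>\<in>roots. \<gamma> - \<alpha> \<in> roots}. \<eta> \<alpha> (\<gamma> - \<alpha>) * snd x \<alpha> * snd y (\<gamma> - \<alpha>)) else 0)"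

definition model :: "(('l \<Rightarrow> 'k) \<times> ('l \<Rightarrow> 'k)) set"
  where "model = {x. additive (fst x) \<and> (\<forall>\<gamma>. \<gamma> \<notin> roots \<longrightarrow> snd x \<gamma> = 0)}"

lemma fst_scale [simp]: "fst (scale c x) \<gamma> = c * fst x \<gamma>"
  and snd_scale [simp]: "snd (scale c x) \<gamma> = c * snd x \<gamma>"
  by (simp_all add: scale_def)

lemma model_eqI: "(\<And>\<gamma>. fst x \<gamma> = fst y \<gamma>) \<Longrightarrow> (\<And>\<gamma>. snd x \<gamma> = snd y \<gamma>) \<Longrightarrow> x = y"
  for x y :: "('l \<Rightarrow> 'k) \<times> ('l \<Rightarrow> 'k)"
  by (simp add: prod_eq_iff fun_eq_iff)

lemma scale_simps:
  "scale c 0 = 0" "scale 0 x = 0" "scale 1 x = x" "scale c (scale c' x) = scale (c * c') x"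
  "scale c x + scale c' x = scale (c + c') x" "scale c x + scale c y = scale c (x + y)"
  "- scale c x = scale (- c) x" "scale c (- x) = scale (- c) x"
  by (rule model_eqI; simp add: algebra_simps)+

lemma brk_add:
  "brk (x + y) z = brk x z + brk y z" "brk z (x + y) = brk z x + brk z y"
  by (rule model_eqI; simp add: brk_def algebra_simps sum.distrib)+

lemma brk_scale:
  "brk (scale c x) y = scale c (brk x y)" "brk x (scale c y) = scale c (brk x y)"
  by (rule model_eqI; simp add: brk_def algebra_simps sum_distrib_left)+

lemma brk_zero [simp]: "brk 0 x = 0" "brk x 0 = 0"
  by (rule model_eqI; simp add: brk_def)+

lemma brk_torus:
  "brk (t, 0) x = (0, \<lambda>\<gamma>. if \<gamma> \<in> roots then t \<gamma> * snd x \<gamma> else 0)"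
  "brk x (t, 0) = (0, \<lambda>\<gamma>. if \<gamma> \<in> roots then - (t \<gamma> * snd x \<gamma>) else 0)"
  by (rule model_eqI; simp add: brk_def)+

lemma brk_torus_root_vector:
  "\<alpha> \<in> roots \<Longrightarrow> brk (t, 0) (root_vector \<alpha>) = scale (t \<alpha>) (root_vector \<alpha>)"
  "\<alpha> \<in> roots \<Longrightarrow> brk (root_vector \<alpha>) (t, 0) = scale (- t \<alpha>) (root_vector \<alpha>)"
  by (auto simp: brk_torus scale_def root_vector_def fun_eq_iff)

text \<open>Both defining sums collapse to the single index \<alpha>. The torus sum survives only
  for \<beta> = -\<alpha>, the root sum only in degree \<alpha> + \<beta>.\<close>

lemma brk_root_vector:
  assumes "\<alpha> \<in> roots" "\<beta> \<in> roots"
  shows "brk (root_vector \<alpha>) (root_vector \<beta>) =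
    (if \<alpha> + \<beta> = 0 then scale (\<eta> \<alpha> \<beta>) (coroot \<alpha>, 0)
     else if \<alpha> + \<beta> \<in> roots then scale (\<eta> \<alpha> \<beta>) (root_vector (\<alpha> + \<beta>)) else 0)" (is "?l = ?r")
proof (rule model_eqI)
  fix \<delta>
  have "fst ?l \<delta> = (\<Sum>a\<in>roots. if a = \<alpha> then
      (if \<alpha> + \<beta> = 0 then \<eta> \<alpha> \<beta> * of_int (form \<alpha> \<delta>) else 0) else 0)"
    unfolding brk_def fst_conv
    by (rule sum.cong) (auto simp: root_vector_def add_eq_0_iff minus_equation_iff)
  then show "fst ?l \<delta> = fst ?r \<delta>"
    using assms finite_roots by (simp add: coroot_def root_vector_def)
  have fin: "finite {a \<in> roots. \<delta> - a \<in> roots}" using finite_roots by simp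
  have "(\<Sum>a\<in>{a\<in>roots. \<delta> - a \<in> roots}.
      \<eta> a (\<delta> - a) * snd (root_vector \<alpha>) a * snd (root_vector \<beta>) (\<delta> - a)) =
    (\<Sum>a\<in>{a\<in>roots. \<delta> - a \<in> roots}. if a = \<alpha> then
      (if \<delta> = \<alpha> + \<beta> then \<eta> \<alpha> \<beta> else 0) else 0)"
    by (rule sum.cong) (auto simp: root_vector_def)
  also have "\<dots> = (if \<delta> = \<alpha> + \<beta> then \<eta> \<alpha> \<beta> else 0)"
    using assms fin by simp
  finally show "snd ?l \<delta> = snd ?r \<delta>"
    unfolding brk_def snd_conv by (simp add: root_vector_def)
qed

lemma additive_coroot: "additive (coroot \<gamma> :: 'l \<Rightarrow> 'k)"
  by (simp add: additive_def coroot_def form_add_right)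

lemma torus_model: "additive t \<Longrightarrow> (t, 0) \<in> model"
  by (simp add: model_def)

lemma root_vector_model: "\<alpha> \<in> roots \<Longrightarrow> root_vector \<alpha> \<in> model"
  by (auto simp: model_def root_vector_def additive_def)

lemma zero_model: "0 \<in> model"
  by (simp add: model_def additive_def)

lemma add_model: "x \<in> model \<Longrightarrow> y \<in> model \<Longrightarrow> x + y \<in> model"
  by (simp add: model_def additive_def)

lemma scale_model: "x \<in> model \<Longrightarrow> scale c x \<in> model"
  by (simp add: model_def additive_def scale_def algebra_simps)

lemma brk_model: "brk x y \<in> model"
  by (simp add: model_def additive_def brk_def form_add_right algebra_simps sum.distrib)

text \<open>Reduces linear statements to generators. The torus part is a generator by itself, and
  the root part is built up one root at a time, which terminates because there are finitely many
  roots.\<close>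

lemma model_induct [consumes 1, case_names torus root add scale]:
  assumes x: "x \<in> model"
    and t: "\<And>t. additive t \<Longrightarrow> P (t, 0)"
    and r: "\<And>\<alpha>. \<alpha> \<in> roots \<Longrightarrow> P (root_vector \<alpha>)"
    and a: "\<And>x y. x \<in> model \<Longrightarrow> y \<in> model \<Longrightarrow> P x \<Longrightarrow> P y \<Longrightarrow> P (x + y)"
    and s: "\<And>c x. x \<in> model \<Longrightarrow> P x \<Longrightarrow> P (scale c x)"
  shows "P x"
proof -
  have "P (0, \<lambda>\<gamma>. if \<gamma> \<in> S then g \<gamma> else 0)" if "finite S" "S \<subseteq> roots" for S and g :: "'l \<Rightarrow> 'k"
    using that
  proof (induction S rule: finite_induct)
    case empty
    have "P (\<lambda>_. 0, 0)" by (rule t) (simp add: additive_def)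
    then show ?case by (simp add: zero_fun_def)
  next
    case (insert \<alpha> S)
    have "(0, \<lambda>\<gamma>. if \<gamma> \<in> insert \<alpha> S then g \<gamma> else 0) =
      scale (g \<alpha>) (root_vector \<alpha>) + (0, \<lambda>\<gamma>. if \<gamma> \<in> S then g \<gamma> else 0)"
      using insert.hyps(2) by (intro model_eqI) (auto simp: root_vector_def)
    moreover have "(0, \<lambda>\<gamma>. if \<gamma> \<in> S then g \<gamma> else 0) \<in> model"
      using insert.prems by (auto simp: model_def additive_def)
    moreover have "P (0, \<lambda>\<gamma>. if \<gamma> \<in> S then g \<gamma> else 0)"
      using insert.IH insert.prems by blast
    moreover have "\<alpha> \<in> roots" using insert.prems by blast
    ultimately show ?case
      by (simp only:) (intro a s r scale_model root_vector_model)
  qed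
  from this[OF finite_roots, of "snd x"]
  have "P ((fst x, 0) + (0, \<lambda>\<gamma>. if \<gamma> \<in> roots then snd x \<gamma> else 0))"
    using x by (intro a t) (auto simp: model_def additive_def)
  moreover have "(fst x, 0) + (0, \<lambda>\<gamma>. if \<gamma> \<in> roots then snd x \<gamma> else 0) = x"
    using x by (intro model_eqI) (auto simp: model_def)
  ultimately show ?thesis by simp
qed

text \<open>The two nonzero cases get their sign from different places: for opposite roots
  \<open>\<eta>\<close> is symmetric and the coroot is odd, whereas for inner product -1 the cocycle
  itself is skew.\<close>

lemma brk_root_vector_skew:
  assumes "\<alpha> \<in> roots" "\<beta> \<in> roots"
  shows "brk (root_vector \<alpha>) (root_vector \<beta>) = - brk (root_vector \<beta>) (root_vector \<alpha>)"
proof -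
  have "scale (\<eta> \<alpha> \<beta>) (coroot \<alpha>, 0) = - scale (\<eta> \<beta> \<alpha>) (coroot \<beta>, 0)" if "\<alpha> + \<beta> = 0"
    using that cocycle_opposite[OF that]
    by (intro model_eqI) (auto simp: coroot_def add_eq_0_iff)
  then show ?thesis
    using assms cocycle_skew[of \<alpha> \<beta>] root_add_root_iff[OF assms]
    by (simp add: brk_root_vector add.commute[of \<beta> \<alpha>] scale_simps)
qed

lemma brk_skew:
  assumes "x \<in> model" "y \<in> model"
  shows "brk x y = - brk y x"
  using assms(1)
proof (induction rule: model_induct)
  case (torus t) show ?case by (simp add: brk_torus fun_eq_iff)
next
  case \<alpha>: (root \<alpha>)
  show ?case using assms(2)
  proof (induction rule: model_induct)
    case (torus t) show ?case by (simp add: brk_torus fun_eq_iff)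
  next
    case (root \<beta>) show ?case using \<alpha> root by (rule brk_root_vector_skew)
  qed (simp_all add: brk_add brk_scale scale_simps)
qed (simp_all add: brk_add brk_scale scale_simps)

text \<open>Skew-symmetry makes every coordinate equal to its own negative, and 2 is
  invertible.\<close>

lemma brk_self:
  assumes "x \<in> model"
  shows "brk x x = 0"
proof -
  have "c = 0" if "c = - c" for c :: 'k using that by simp
  moreover have "fst (brk x x) \<gamma> = - fst (brk x x) \<gamma>" "snd (brk x x) \<gamma> = - snd (brk x x) \<gamma>" for \<gamma>
    using brk_skew[OF assms assms] by (metis fst_uminus snd_uminus uminus_apply)+
  ultimately show ?thesis by (intro model_eqI) auto
qed

section \<open>The Jacobi identity\<close>

definition jacobiator where
  "jacobiator x y z = brk x (brk y z) + brk y (brk z x) + brk z (brk x y)"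

text \<open>With this symmetry, linearity in the first argument yields linearity in all three, and
  case distinctions on roots are needed only up to rotation.\<close>

lemma jacobiator_cycle: "jacobiator x y z = jacobiator y z x"
  by (simp add: jacobiator_def add_ac)

lemma jacobiator_add: "jacobiator (x + x') y z = jacobiator x y z + jacobiator x' y z"
  by (simp add: jacobiator_def brk_add add_ac)

lemma jacobiator_scale: "jacobiator (scale c x) y z = scale c (jacobiator x y z)"
  by (simp add: jacobiator_def brk_scale scale_simps)

text \<open>Expresses when a double bracket is nonzero purely through the three pairwise products,
  since \<alpha> pairs with \<beta> + \<gamma> to
  \<open>form \<alpha> \<beta> + form \<gamma> \<alpha>\<close>. The arguments of
  \<open>form\<close> are ordered cyclically so that the three terms of the jacobiator are literal
  rotations of this formula.\<close>

lemma brk_brk_root_vector: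
  assumes "\<alpha> \<in> roots" "\<beta> \<in> roots" "\<gamma> \<in> roots"
  shows "brk (root_vector \<alpha>) (brk (root_vector \<beta>) (root_vector \<gamma>)) =
    (if form \<beta> \<gamma> = - 2 then scale (- \<eta> \<beta> \<gamma> * of_int (form \<alpha> \<beta>)) (root_vector \<alpha>)
     else if form \<beta> \<gamma> = - 1 \<and> form \<alpha> \<beta> + form \<gamma> \<alpha> = - 2
       then scale (\<eta> \<beta> \<gamma> * \<eta> \<alpha> (\<beta> + \<gamma>)) (coroot \<alpha>, 0)
     else if form \<beta> \<gamma> = - 1 \<and> form \<alpha> \<beta> + form \<gamma> \<alpha> = - 1
       then scale (\<eta> \<beta> \<gamma> * \<eta> \<alpha> (\<beta> + \<gamma>)) (root_vector (\<alpha> + \<beta> + \<gamma>))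
     else 0)"
proof -
  have f: "form \<alpha> (\<beta> + \<gamma>) = form \<alpha> \<beta> + form \<gamma> \<alpha>"
    by (simp add: form_add_right form_sym[of \<alpha> \<gamma>])
  consider "form \<beta> \<gamma> = - 2" | "form \<beta> \<gamma> = - 1" | "form \<beta> \<gamma> \<noteq> - 2" "form \<beta> \<gamma> \<noteq> - 1" by blast
  then show ?thesis
  proof cases
    case 1
    then have "\<beta> + \<gamma> = 0" using root_form_bounds(3) assms by blast
    then show ?thesis
      using 1 assms
      by (simp add: brk_root_vector brk_scale brk_torus_root_vector scale_simps coroot_def
          form_sym[of \<beta> \<alpha>])
  next
    case 2
    then have "\<beta> + \<gamma> \<in> roots" "\<beta> + \<gamma> \<noteq> 0"
      using root_add_root_iff[OF assms(2,3)] root_form_bounds(3)[OF assms(2,3)] by auto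
    moreover have "\<alpha> + (\<beta> + \<gamma>) = 0 \<longleftrightarrow> form \<alpha> \<beta> + form \<gamma> \<alpha> = - 2"
      using root_form_bounds(3)[of \<alpha> "\<beta> + \<gamma>"] assms(1) calculation(1) f by simp
    moreover have "\<alpha> + (\<beta> + \<gamma>) \<in> roots \<longleftrightarrow> form \<alpha> \<beta> + form \<gamma> \<alpha> = - 1"
      using root_add_root_iff[of \<alpha> "\<beta> + \<gamma>"] assms(1) calculation(1) f by simp
    ultimately show ?thesis
      using 2 assms by (simp add: brk_root_vector brk_scale scale_simps add.assoc)
  next
    case 3
    then show ?thesis
      using root_add_root_iff[of \<beta> \<gamma>] root_form_bounds(3)[of \<beta> \<gamma>] assms
      by (simp add: brk_root_vector)
  qed
qed

text \<open>Here \<gamma> = -\<beta> and the first term is a multiple of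
  \<open>root_vector \<alpha>\<close> proportional to p, the product of \<alpha> and \<beta>. For p
  = 1 or 2 the second term cancels it, for p = -1 or -2 the third term does, and for p = 0
  everything vanishes. The values 2 and -2 mean that \<alpha> is \<beta> or \<gamma>.\<close>

lemma jacobiator_opposite:
  assumes r: "\<alpha> \<in> roots" "\<beta> \<in> roots" "\<gamma> \<in> roots" and q: "form \<beta> \<gamma> = - 2"
  shows "jacobiator (root_vector \<alpha>) (root_vector \<beta>) (root_vector \<gamma>) = 0"
proof -
  define p where "p = form \<alpha> \<beta>"
  have g: "\<gamma> = - \<beta>"
    using root_form_bounds(3)[OF r(2,3)] q by (simp add: add_eq_0_iff)
  have f: "form \<alpha> \<beta> = p" "form \<gamma> \<alpha> = - p" "form \<beta> \<alpha> = p"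
    by (simp_all add: p_def g form_sym[of \<beta> \<alpha>])
  have p: "p \<in> {- 2, - 1, 0, 1, 2}"
    using root_form_bounds(1,2)[OF r(1,2)] by (auto simp: p_def)
  have e: "\<eta> \<beta> \<gamma> = \<eta> \<gamma> \<beta>" by (rule cocycle_opposite) (simp add: g)
  have pm: "p = - 2 \<longleftrightarrow> \<alpha> = - \<beta>" "p = 2 \<longleftrightarrow> \<alpha> = \<beta>"
    using root_form_bounds(3,4)[OF r(1,2)] by (auto simp: p_def add_eq_0_iff2)
  note N = brk_brk_root_vector[OF r(1,2,3)] brk_brk_root_vector[OF r(2,3,1)]
    brk_brk_root_vector[OF r(3,1,2)]
  have s: "\<alpha> + \<beta> + \<gamma> = \<alpha>" "\<beta> + \<gamma> + \<alpha> = \<alpha>" "\<gamma> + \<alpha> + \<beta> = \<alpha>"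
    by (simp_all add: g)
  \<comment> \<open>The cocycle identity for \<beta>, -\<beta>, \<alpha>; the factor at zero is
    1.\<close>
  have "\<eta> \<gamma> \<alpha> * \<eta> \<beta> (\<gamma> + \<alpha>) = \<eta> \<beta> \<gamma>"
    using cocycle[of \<beta> \<gamma> \<alpha>] by (simp add: g cocycle_zero_left)
  then have b: "brk (root_vector \<beta>) (brk (root_vector \<gamma>) (root_vector \<alpha>)) =
      (if p = 2 then scale (2 * \<eta> \<gamma> \<alpha>) (root_vector \<beta>)
       else if p = 1 then scale (\<eta> \<beta> \<gamma>) (root_vector \<alpha>) else 0)"
    unfolding N(2) q f s using p by (auto simp: mult.commute)
  \<comment> \<open>The same identity for -\<beta>, \<beta>, \<alpha>, but with \<alpha> and \<beta>
    interchanged in one factor. This interchange supplies the minus sign that distinguishes p = -1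
    from p = 1.\<close>
  have "\<eta> \<alpha> \<beta> * \<eta> \<gamma> (\<alpha> + \<beta>) = - \<eta> \<beta> \<gamma>" if "p = - 1"
    using cocycle[of \<gamma> \<beta> \<alpha>] cocycle_skew[of \<alpha> \<beta>] that e
    by (simp add: g cocycle_zero_left f add.commute)
  then have c: "brk (root_vector \<gamma>) (brk (root_vector \<alpha>) (root_vector \<beta>)) =
      (if p = - 2 then scale (- 2 * \<eta> \<alpha> \<beta>) (root_vector \<gamma>)
       else if p = - 1 then scale (- \<eta> \<beta> \<gamma>) (root_vector \<alpha>) else 0)"
    unfolding N(3) q f s using p by (auto simp: mult.commute)
  have a: "brk (root_vector \<alpha>) (brk (root_vector \<beta>) (root_vector \<gamma>)) =
      scale (- \<eta> \<beta> \<gamma> * of_int p) (root_vector \<alpha>)"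
    unfolding N(1) q f by simp
  consider "p = - 2" "\<alpha> = \<gamma>" | "p = 2" "\<alpha> = \<beta>" | "p = - 1" | "p = 0" | "p = 1"
    using p pm g by auto
  then show ?thesis
    unfolding jacobiator_def a b c by cases (simp_all add: scale_simps e)
qed

text \<open>The roots form a chain of type A3 with \<beta> in the middle. The outer roots commute,
  so one term vanishes; the other two are multiples of the vector of \<alpha> + \<beta> + \<gamma>,
  with opposite coefficients by the cocycle law and one skew exchange of \<gamma> with \<alpha> +
  \<beta>.\<close>

lemma jacobiator_chain:
  assumes r: "\<alpha> \<in> roots" "\<beta> \<in> roots" "\<gamma> \<in> roots"
    and q: "form \<alpha> \<beta> = - 1" "form \<beta> \<gamma> = - 1" "form \<gamma> \<alpha> = 0"
  shows "jacobiator (root_vector \<alpha>) (root_vector \<beta>) (root_vector \<gamma>) = 0"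
proof -
  note N = brk_brk_root_vector[OF r(1,2,3)] brk_brk_root_vector[OF r(2,3,1)]
    brk_brk_root_vector[OF r(3,1,2)]
  have "form \<gamma> (\<alpha> + \<beta>) = - 1" using q by (simp add: form_add_right form_sym[of \<gamma> \<beta>])
  then have "\<eta> \<alpha> \<beta> * \<eta> \<gamma> (\<alpha> + \<beta>) = - (\<eta> \<beta> \<gamma> * \<eta> \<alpha> (\<beta> + \<gamma>))"
    using cocycle[of \<alpha> \<beta> \<gamma>] cocycle_skew[of \<gamma> "\<alpha> + \<beta>"] by simp
  then show ?thesis
    unfolding jacobiator_def N using q by (simp add: scale_simps add_ac)
qed

text \<open>The norm of the sum is 6 - 6 = 0, so the three roots add up to zero. All three double
  brackets lie in the torus with the same coefficient, and the coroots also add up to zero.\<close>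

lemma jacobiator_triangle:
  assumes r: "\<alpha> \<in> roots" "\<beta> \<in> roots" "\<gamma> \<in> roots"
    and q: "form \<alpha> \<beta> = - 1" "form \<beta> \<gamma> = - 1" "form \<gamma> \<alpha> = - 1"
  shows "jacobiator (root_vector \<alpha>) (root_vector \<beta>) (root_vector \<gamma>) = 0"
proof -
  note N = brk_brk_root_vector[OF r(1,2,3)] brk_brk_root_vector[OF r(2,3,1)]
    brk_brk_root_vector[OF r(3,1,2)]
  have "form (\<alpha> + \<beta> + \<gamma>) (\<alpha> + \<beta> + \<gamma>) = 0"
    using r q by (simp add: form_add form_add_right mem_roots form_sym[of \<beta> \<alpha>]
        form_sym[of \<gamma> \<beta>] form_sym[of \<alpha> \<gamma>])
  then have s: "\<alpha> + \<beta> + \<gamma> = 0" by simp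
  \<comment> \<open>Since \<alpha> + \<beta> and \<gamma> are opposite, \<open>\<eta>\<close> is
    symmetric on them, which turns the cocycle law into invariance under rotation.\<close>
  have cyc: "\<eta> \<beta> \<gamma> * \<eta> \<alpha> (\<beta> + \<gamma>) = \<eta> \<alpha> \<beta> * \<eta> \<gamma> (\<alpha> + \<beta>)" if "\<alpha> + \<beta> + \<gamma> = 0" for \<alpha> \<beta> \<gamma>
    using cocycle[of \<alpha> \<beta> \<gamma>] cocycle_opposite[OF that] by simp
  have "\<eta> \<beta> \<gamma> * \<eta> \<alpha> (\<beta> + \<gamma>) = \<eta> \<alpha> \<beta> * \<eta> \<gamma> (\<alpha> + \<beta>)"
    "\<eta> \<gamma> \<alpha> * \<eta> \<beta> (\<gamma> + \<alpha>) = \<eta> \<alpha> \<beta> * \<eta> \<gamma> (\<alpha> + \<beta>)"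
    using cyc[of \<alpha> \<beta> \<gamma>] cyc[of \<beta> \<gamma> \<alpha>] s by (simp_all add: add_ac)
  moreover have "(coroot \<alpha>, 0) + (coroot \<beta>, 0) + (coroot \<gamma>, 0) = (0 :: ('l \<Rightarrow> 'k) \<times> ('l \<Rightarrow> 'k))"
  proof (rule model_eqI)
    show "fst ((coroot \<alpha>, 0) + (coroot \<beta>, 0) + (coroot \<gamma>, 0)) \<delta> =
        fst (0 :: ('l \<Rightarrow> 'k) \<times> ('l \<Rightarrow> 'k)) \<delta>" for \<delta>
      using arg_cong[OF s, of "\<lambda>x. of_int (form x \<delta>) :: 'k"] by (simp add: coroot_def form_add)
  qed simp
  ultimately show ?thesis
    unfolding jacobiator_def N using q by (simp add: scale_simps)
qed

text \<open>Up to rotation the patterns treated so far are the only ones in which some double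
  bracket can be nonzero.\<close>

lemma jacobiator_root_vector:
  assumes r: "\<alpha> \<in> roots" "\<beta> \<in> roots" "\<gamma> \<in> roots"
  shows "jacobiator (root_vector \<alpha>) (root_vector \<beta>) (root_vector \<gamma>) = 0"
proof -
  note C = jacobiator_cycle[of "root_vector \<alpha>" "root_vector \<beta>" "root_vector \<gamma>"]
    jacobiator_cycle[of "root_vector \<beta>" "root_vector \<gamma>" "root_vector \<alpha>"]
  \<comment> \<open>Pure integer arithmetic, stated apart from the roots. Once -2 is excluded, a
    product -1 together with a sum of -2 or -1 for the other two forces the triangle or a chain; the
    last alternative denies every condition under which a term survives.\<close>
  have int_cases: "(p = - 2 \<or> q = - 2 \<or> r = - 2) \<or> (p = - 1 \<and> q = - 1 \<and> r = - 1) \<or>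
      (p = - 1 \<and> q = - 1 \<and> r = 0 \<or> r = - 1 \<and> p = - 1 \<and> q = 0 \<or>
        q = - 1 \<and> r = - 1 \<and> p = 0) \<or>
      (\<not> (q = - 1 \<and> (p + r = - 2 \<or> p + r = - 1)) \<and> \<not> (r = - 1 \<and> (q + p = - 2 \<or> q + p = - 1)) \<and>
       \<not> (p = - 1 \<and> (r + q = - 2 \<or> r + q = - 1)) \<and> p \<noteq> - 2 \<and> q \<noteq> - 2 \<and> r \<noteq> - 2)"
    if "- 2 \<le> p" "- 2 \<le> q" "- 2 \<le> r" for p q r :: int
    using that by smt
  consider (opp) "form \<alpha> \<beta> = - 2 \<or> form \<beta> \<gamma> = - 2 \<or> form \<gamma> \<alpha> = - 2"
    | (triangle) "form \<alpha> \<beta> = - 1 \<and> form \<beta> \<gamma> = - 1 \<and> form \<gamma> \<alpha> = - 1"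
    | (chain) "form \<alpha> \<beta> = - 1 \<and> form \<beta> \<gamma> = - 1 \<and> form \<gamma> \<alpha> = 0 \<or>
        form \<gamma> \<alpha> = - 1 \<and> form \<alpha> \<beta> = - 1 \<and> form \<beta> \<gamma> = 0 \<or>
        form \<beta> \<gamma> = - 1 \<and> form \<gamma> \<alpha> = - 1 \<and> form \<alpha> \<beta> = 0"
    | (none) "\<not> (form \<beta> \<gamma> = - 1 \<and> (form \<alpha> \<beta> + form \<gamma> \<alpha> = - 2 \<or> form \<alpha> \<beta> + form \<gamma> \<alpha> = - 1)) \<and>
        \<not> (form \<gamma> \<alpha> = - 1 \<and> (form \<beta> \<gamma> + form \<alpha> \<beta> = - 2 \<or> form \<beta> \<gamma> + form \<alpha> \<beta> = - 1)) \<and>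
        \<not> (form \<alpha> \<beta> = - 1 \<and> (form \<gamma> \<alpha> + form \<beta> \<gamma> = - 2 \<or> form \<gamma> \<alpha> + form \<beta> \<gamma> = - 1)) \<and>
        form \<alpha> \<beta> \<noteq> - 2 \<and> form \<beta> \<gamma> \<noteq> - 2 \<and> form \<gamma> \<alpha> \<noteq> - 2"
    using int_cases[OF root_form_bounds(1)[OF r(1,2)] root_form_bounds(1)[OF r(2,3)]
      root_form_bounds(1)[OF r(3,1)]] by blast
  then show ?thesis
  proof cases
    case opp
    then show ?thesis using jacobiator_opposite r C by metis
  next
    case triangle
    then show ?thesis using jacobiator_triangle r by blast
  next
    case chain
    then show ?thesis using jacobiator_chain r C by metis
  next
    case none
    have "brk (root_vector \<alpha>) (brk (root_vector \<beta>) (root_vector \<gamma>)) = 0"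
      unfolding brk_brk_root_vector[OF r(1,2,3)] using none by presburger
    moreover have "brk (root_vector \<beta>) (brk (root_vector \<gamma>) (root_vector \<alpha>)) = 0"
      unfolding brk_brk_root_vector[OF r(2,3,1)] using none by presburger
    moreover have "brk (root_vector \<gamma>) (brk (root_vector \<alpha>) (root_vector \<beta>)) = 0"
      unfolding brk_brk_root_vector[OF r(3,1,2)] using none by presburger
    ultimately show ?thesis by (simp add: jacobiator_def)
  qed
qed

text \<open>Weights add under the bracket. For opposite roots the bracket lies in the abelian torus,
  and the total weight is zero as well.\<close>

lemma brk_torus_brk_root_vector:
  assumes "additive t" "\<alpha> \<in> roots" "\<beta> \<in> roots"
  shows "brk (t, 0) (brk (root_vector \<alpha>) (root_vector \<beta>)) =
    scale (t \<alpha> + t \<beta>) (brk (root_vector \<alpha>) (root_vector \<beta>))"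
proof -
  have "t \<alpha> + t \<beta> = 0" if "\<alpha> + \<beta> = 0"
    using that additive.add[OF assms(1), of \<alpha> \<beta>] additive.zero[OF assms(1)] by simp
  moreover have "brk (t, 0) (t', 0) = 0" for t' by (rule model_eqI) (simp_all add: brk_torus)
  ultimately show ?thesis
    using assms
    by (simp add: brk_root_vector brk_scale brk_torus_root_vector scale_simps mult.commute
        additive.add[OF assms(1)])
qed

text \<open>Trilinearity is used one argument at a time. In the names of the intermediate facts, t
  stands for a torus element, r for a root vector, and x or y for an arbitrary element; rotation
  moves the argument under induction to the front.\<close>

lemma jacobiator_eq_0:
  assumes "x \<in> model" "y \<in> model" "z \<in> model"
  shows "jacobiator x y z = 0"
proof -
  have ttx: "jacobiator (t, 0) (t', 0) x = 0" for t t' x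
  proof -
    have "brk (t, 0) (t', 0) = 0" by (rule model_eqI) (simp_all add: brk_torus)
    then show ?thesis
      unfolding jacobiator_def brk_torus(2)[of x t] brk_torus(1)[of t' x]
      by (intro model_eqI) (simp_all add: brk_torus(1))
  qed
  have trr: "jacobiator (t, 0) (root_vector \<alpha>) (root_vector \<beta>) = 0"
    if "additive t" "\<alpha> \<in> roots" "\<beta> \<in> roots" for t \<alpha> \<beta>
    using that brk_root_vector_skew[of \<beta> \<alpha>]
    by (simp add: jacobiator_def brk_torus_brk_root_vector brk_torus_root_vector brk_scale
        scale_simps)
  have txr: "jacobiator (t, 0) x (root_vector \<beta>) = 0"
    if "x \<in> model" "additive t" "\<beta> \<in> roots" for t x \<beta>
    using that(1)
  proof (induction rule: model_induct)
    case (add x y)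
    then show ?case
      by (metis jacobiator_add jacobiator_cycle add.right_neutral)
  next
    case (scale c x)
    then show ?case by (metis jacobiator_scale jacobiator_cycle scale_simps(1))
  next
    case (torus t') show ?case by (rule ttx)
  next
    case (root \<alpha>) then show ?case using trr that by blast
  qed
  have txy: "jacobiator (t, 0) x y = 0" if "y \<in> model" "x \<in> model" "additive t" for t x y
    using that(1)
  proof (induction rule: model_induct)
    case (torus t')
    then show ?case by (metis ttx jacobiator_cycle)
  next
    case (add x y)
    then show ?case
      by (metis jacobiator_add jacobiator_cycle add.right_neutral)
  next
    case (scale c x)
    then show ?case by (metis jacobiator_scale jacobiator_cycle scale_simps(1))
  next
    case (root \<alpha>) then show ?case using txr that by blast
  qed
  have rry: "jacobiator (root_vector \<alpha>) (root_vector \<beta>) y = 0"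
    if "y \<in> model" "\<alpha> \<in> roots" "\<beta> \<in> roots" for \<alpha> \<beta> y
    using that(1)
  proof (induction rule: model_induct)
    case (torus t')
    then show ?case using txy that root_vector_model by (metis jacobiator_cycle)
  next
    case (add x y)
    then show ?case
      by (metis jacobiator_add jacobiator_cycle add.right_neutral)
  next
    case (scale c x)
    then show ?case by (metis jacobiator_scale jacobiator_cycle scale_simps(1))
  next
    case (root \<gamma>) then show ?case using jacobiator_root_vector that by blast
  qed
  have rxy: "jacobiator (root_vector \<alpha>) x y = 0"
    if "x \<in> model" "\<alpha> \<in> roots" "y \<in> model" for \<alpha> x y
    using that(1)
  proof (induction rule: model_induct)
    case (torus t')
    then show ?case using txy that root_vector_model by (metis jacobiator_cycle)
  next
    case (add x y)
    then show ?case
      by (metis jacobiator_add jacobiator_cycle add.right_neutral)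
  next
    case (scale c x)
    then show ?case by (metis jacobiator_scale jacobiator_cycle scale_simps(1))
  next
    case (root \<beta>) then show ?case using rry that by blast
  qed
  show ?thesis
    using assms(1)
  proof (induction rule: model_induct)
    case (torus t) then show ?case using txy assms by blast
  next
    case (root \<alpha>) then show ?case using rxy assms by blast
  qed (simp_all add: jacobiator_add jacobiator_scale scale_simps)
qed

text \<open>If some element of the ideal has a nonzero component at a root \<alpha>, brackets with
  torus elements isolate that component. Otherwise the element lies in the torus, and its bracket
  with a suitable root vector is a nonzero multiple of that vector.\<close>

lemma ideal_contains_root_vector:
  assumes sub: "U \<subseteq> model"
    and add: "\<And>x y. x \<in> U \<Longrightarrow> y \<in> U \<Longrightarrow> x + y \<in> U"
    and scale: "\<And>c x. x \<in> U \<Longrightarrow> scale c x \<in> U"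
    and ideal: "\<And>x y. x \<in> model \<Longrightarrow> y \<in> U \<Longrightarrow> brk x y \<in> U"
    and x: "x \<in> U" "x \<noteq> 0"
  shows "\<exists>\<alpha>\<in>roots. root_vector \<alpha> \<in> U"
proof (cases "\<exists>\<alpha>. snd x \<alpha> \<noteq> 0")
  case True
  then obtain \<alpha> where xa: "snd x \<alpha> \<noteq> 0" by blast
  then have \<alpha>: "\<alpha> \<in> roots" using x(1) sub by (auto simp: model_def)
  have "\<exists>y\<in>U. fst y = 0 \<and> snd y \<alpha> \<noteq> 0 \<and> (\<forall>\<beta>\<in>S. snd y \<beta> = 0)"
    if "finite S" "S \<subseteq> roots - {\<alpha>}" for S
    using that
  proof (induction S rule: finite_induct)
    case empty
    \<comment> \<open>This bracket removes the torus part and multiplies the \<alpha>-component by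
      2.\<close>
    have "brk (coroot \<alpha>, 0) x \<in> U" using ideal torus_model additive_coroot x(1) by blast
    then show ?case
      using \<alpha> xa by (intro bexI) (auto simp: brk_torus coroot_def)
  next
    case (insert \<beta> S)
    then obtain y where y: "y \<in> U" "fst y = 0" "snd y \<alpha> \<noteq> 0" "\<forall>\<beta>\<in>S. snd y \<beta> = 0" by blast
    text \<open>\<open>ad h - h \<beta>\<close> for a torus element \<open>h\<close> separating \<open>\<alpha>\<close> from \<open>\<beta>\<close> kills the
      \<open>\<beta>\<close>-component but not the \<open>\<alpha>\<close>-component.\<close>
    define h :: "'l \<Rightarrow> 'k" where "h = coroot (\<alpha> - \<beta>)"
    define z where "z = brk (h, 0) y + scale (- h \<beta>) y"
    have \<beta>: "\<beta> \<in> roots" "\<beta> \<noteq> \<alpha>" using insert.prems by auto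
    have "form (\<alpha> - \<beta>) (\<alpha> - \<beta>) \<noteq> 0" using \<beta>(2) by (metis form_self_eq_0_iff right_minus_eq)
    then have "form (\<alpha> - \<beta>) \<alpha> - form (\<alpha> - \<beta>) \<beta> \<noteq> 0" by (simp add: form_simps)
    then have "h \<alpha> - h \<beta> \<noteq> 0"
      unfolding h_def coroot_def of_int_diff[symmetric] of_int_eq_0_iff .
    then have "snd z \<alpha> \<noteq> 0" using y(3) \<alpha> by (simp add: z_def brk_torus left_diff_distrib[symmetric])
    moreover have "z \<in> U" using y(1) unfolding z_def h_def
      by (intro add scale ideal torus_model additive_coroot)
    moreover have "fst z = 0" using y(2) by (simp add: z_def brk_torus fun_eq_iff)
    moreover have "\<forall>\<gamma>\<in>insert \<beta> S. snd z \<gamma> = 0" using y(4) \<beta> by (simp add: z_def brk_torus)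
    ultimately show ?case by blast
  qed
  from this[of "roots - {\<alpha>}"] finite_roots obtain y
    where y: "y \<in> U" "fst y = 0" "snd y \<alpha> \<noteq> 0" "\<forall>\<beta>\<in>roots - {\<alpha>}. snd y \<beta> = 0" by auto
  have "scale (inverse (snd y \<alpha>)) y = root_vector \<alpha>"
    using y sub by (intro model_eqI) (auto simp: root_vector_def model_def)
  then show ?thesis using scale[OF y(1)] \<alpha> by metis
next
  case False
  then have x0: "x = (fst x, 0)" by (simp add: prod_eq_iff fun_eq_iff)
  \<comment> \<open>The roots generate the lattice, so an additive function vanishing on all of them
    is zero.\<close>
  have "\<exists>\<alpha>\<in>roots. fst x \<alpha> \<noteq> 0"
  proof (rule ccontr)
    assume "\<not> ?thesis"
    then have "fst x \<gamma> = 0" for \<gamma>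
      using additive_eqI_roots[of "fst x" "\<lambda>_. 0" \<gamma>] x(1) sub by (auto simp: model_def additive_def)
    then show False using x0 x(2) by (metis model_eqI False fst_zero snd_zero zero_fun_apply)
  qed
  then obtain \<alpha> where \<alpha>: "\<alpha> \<in> roots" "fst x \<alpha> \<noteq> 0" by blast
  have "brk (root_vector \<alpha>) x = scale (- fst x \<alpha>) (root_vector \<alpha>)"
    using brk_torus_root_vector(2)[OF \<alpha>(1), of "fst x"] x0 by metis
  then have "scale (inverse (- fst x \<alpha>)) (brk (root_vector \<alpha>) x) = root_vector \<alpha>"
    using \<alpha>(2) by (simp add: scale_simps)
  then show ?thesis
    using \<alpha>(1) x(1) ideal root_vector_model scale by metis
qed

end

section \<open>Lie algebras in root coordinates\<close>

lemma ring_of_type_algebra_simps [simp]: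
  "carrier ring_of_type_algebra = UNIV"
  "x \<otimes>\<^bsub>ring_of_type_algebra\<^esub> y = x * y"
  "x \<oplus>\<^bsub>ring_of_type_algebra\<^esub> y = x + y"
  "\<zero>\<^bsub>ring_of_type_algebra\<^esub> = 0"
  "\<one>\<^bsub>ring_of_type_algebra\<^esub> = 1"
  by (simp_all add: ring_of_type_algebra_def)

lemma submodule_type_algebraI:
  fixes M :: "('k::field, 'v, 'm) module_scheme" (structure)
  assumes "module ring_of_type_algebra M"
    and N: "N \<subseteq> carrier M" "\<zero> \<in> N" "\<And>x y. x \<in> N \<Longrightarrow> y \<in> N \<Longrightarrow> x \<oplus> y \<in> N"
      "\<And>c x. x \<in> N \<Longrightarrow> c \<odot>\<^bsub>M\<^esub> x \<in> N"
  shows "submodule N ring_of_type_algebra M"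
proof -
  interpret M: module "ring_of_type_algebra :: 'k ring" M by fact
  show ?thesis
  proof (rule M.submoduleI)
    fix x assume x: "x \<in> N"
    have "\<ominus> x = (\<ominus>\<^bsub>ring_of_type_algebra\<^esub> 1) \<odot>\<^bsub>M\<^esub> x"
      using M.smult_l_minus[of 1 x] M.smult_one[of x] x N(1) by auto
    then show "\<ominus> x \<in> N" using x N(4) by metis
  qed (use N in auto)
qed

text \<open>A vector space with bracket identified with \<open>model\<close>. The Lie-theoretic
  conclusions are drawn here for an arbitrary carrier type, so that they apply to the coset space
  for any bracket that has the right coordinates.\<close>

locale root_coordinates = root_cocycle form \<eta>
  for form :: "'l::ab_group_add \<Rightarrow> 'l \<Rightarrow> int" and \<eta> :: "'l \<Rightarrow> 'l \<Rightarrow> 'k::field_char_0" +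
  fixes L :: "('k, 'v) module" (structure)
    and crd :: "'v \<Rightarrow> ('l \<Rightarrow> 'k) \<times> ('l \<Rightarrow> 'k)"
  assumes crd_bij: "bij_betw crd (carrier L) model"
    and zero_mem: "\<zero> \<in> carrier L"
    and crd_zero: "crd \<zero> = 0"
    and add_mem: "\<lbrakk>x \<in> carrier L; y \<in> carrier L\<rbrakk> \<Longrightarrow> x \<oplus> y \<in> carrier L"
    and crd_add: "\<lbrakk>x \<in> carrier L; y \<in> carrier L\<rbrakk> \<Longrightarrow> crd (x \<oplus> y) = crd x + crd y"
    and smult_mem: "x \<in> carrier L \<Longrightarrow> c \<odot>\<^bsub>L\<^esub> x \<in> carrier L"
    and crd_smult: "x \<in> carrier L \<Longrightarrow> crd (c \<odot>\<^bsub>L\<^esub> x) = scale c (crd x)"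
    and bracket_mem: "\<lbrakk>x \<in> carrier L; y \<in> carrier L\<rbrakk> \<Longrightarrow> x \<otimes> y \<in> carrier L"
    and crd_bracket: "\<lbrakk>x \<in> carrier L; y \<in> carrier L\<rbrakk> \<Longrightarrow> crd (x \<otimes> y) = brk (crd x) (crd y)"
begin

abbreviation (input) K :: "'k ring" where "K \<equiv> ring_of_type_algebra"

definition vec :: "('l \<Rightarrow> 'k) \<times> ('l \<Rightarrow> 'k) \<Rightarrow> 'v"
  where "vec = inv_into (carrier L) crd"

definition cartan :: "'v set"
  where "cartan = {x \<in> carrier L. snd (crd x) = 0}"

definition eval_root :: "'l \<Rightarrow> 'v \<Rightarrow> 'k"
  where "eval_root \<alpha> = (\<lambda>x\<in>cartan. fst (crd x) \<alpha>)"

lemmas mem_simps [simp] = zero_mem add_mem smult_mem bracket_mem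
lemmas crd_simps [simp] = crd_zero crd_add crd_smult crd_bracket

lemma crd_eqI: "\<lbrakk>x \<in> carrier L; y \<in> carrier L; crd x = crd y\<rbrakk> \<Longrightarrow> x = y"
  using crd_bij by (auto simp: bij_betw_def inj_on_def)

lemma crd_model [simp]: "x \<in> carrier L \<Longrightarrow> crd x \<in> model"
  using crd_bij by (auto simp: bij_betw_def)

lemma crd_vec [simp]: "m \<in> model \<Longrightarrow> crd (vec m) = m"
  using crd_bij by (auto simp: vec_def bij_betw_def f_inv_into_f)

lemma vec_mem [simp]: "m \<in> model \<Longrightarrow> vec m \<in> carrier L"
  using crd_bij by (auto simp: vec_def bij_betw_def inv_into_into)

lemma vec_crd [simp]: "x \<in> carrier L \<Longrightarrow> vec (crd x) = x"
  by (rule crd_eqI) simp_all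

lemma vec_add: "\<lbrakk>x \<in> model; y \<in> model\<rbrakk> \<Longrightarrow> vec (x + y) = vec x \<oplus> vec y"
  by (rule crd_eqI) (simp_all add: add_model)

lemma vec_scale: "x \<in> model \<Longrightarrow> vec (scale c x) = c \<odot>\<^bsub>L\<^esub> vec x"
  by (rule crd_eqI) (simp_all add: scale_model)

text \<open>Each axiom becomes an identity between functions after applying \<open>crd\<close> and
  is pulled back by injectivity; the Lie algebra axioms are obtained in the same way.\<close>

lemma module_L: "module K L"
proof (rule moduleI)
  show "cring K" by (rule cring_from_type_algebra)
  show "abelian_group L"
  proof (rule abelian_groupI)
    fix x assume x: "x \<in> carrier L"
    have "- 1 \<odot>\<^bsub>L\<^esub> x \<oplus> x = \<zero>"
      using x by (intro crd_eqI) (simp_all add: prod_eq_iff fun_eq_iff)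
    then show "\<exists>y\<in>carrier L. y \<oplus> x = \<zero>" using x smult_mem by blast
  qed (auto intro!: crd_eqI simp: add_ac)
qed (auto intro!: crd_eqI simp: scale_simps mult.commute add.commute)

sublocale M: module K L
  by (rule module_L)

lemma K_field: "field K"
  by (rule field_from_type_algebra)

lemma submodule_zero_mem: "submodule N K L \<Longrightarrow> \<zero> \<in> N"
  using subgroup.one_closed[of N "add_monoid L"] submodule.axioms(1) by auto

lemma lin_span_subset: "submodule N K L \<Longrightarrow> S \<subseteq> N \<Longrightarrow> lin_span K L S \<subseteq> N"
  by (auto simp: lin_span_def)

text \<open>Spanning is tested on submodules containing \<open>S\<close>, because
  \<open>lin_span\<close> is an intersection. Common to finite dimensionality and to the weight
  space decomposition.\<close>

lemma lin_span_eq_carrierI: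
  assumes "S \<subseteq> carrier L"
    and "\<And>N. submodule N K L \<Longrightarrow> S \<subseteq> N \<Longrightarrow>
      (\<forall>t. additive t \<longrightarrow> vec (t, 0) \<in> N) \<and> (\<forall>\<alpha>\<in>roots. vec (root_vector \<alpha>) \<in> N)"
  shows "lin_span K L S = carrier L"
proof
  show "lin_span K L S \<subseteq> carrier L"
    using assms(1) M.carrier_is_submodule by (intro lin_span_subset)
next
  have "x \<in> N" if x: "x \<in> carrier L" and N: "submodule N K L" "S \<subseteq> N" for x N
  proof -
    have "vec m \<in> N" if "m \<in> model" for m
      using that
    proof (induction rule: model_induct)
      case (add x y) then show ?case using M.submoduleE(5)[OF N(1)] by (simp add: vec_add)
    next
      case (scale c x) then show ?case using M.submoduleE(4)[OF N(1)] by (simp add: vec_scale)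
    qed (use assms(2)[OF N] in auto)
    from this[of "crd x"] show ?thesis using x by simp
  qed
  then show "carrier L \<subseteq> lin_span K L S" by (auto simp: lin_span_def)
qed

section \<open>Semisimplicity\<close>

lemma lie_algebra_L: "lie_algebra K L"
proof -
  have "bilinear_op K L (\<otimes>)"
    unfolding bilinear_op_def by (auto intro!: crd_eqI simp: brk_add brk_scale)
  moreover have "x \<otimes> x = \<zero>" if "x \<in> carrier L" for x
    using that by (intro crd_eqI) (auto simp: brk_self)
  moreover have "x \<otimes> (y \<otimes> z) \<oplus> y \<otimes> (z \<otimes> x) \<oplus> z \<otimes> (x \<otimes> y) = \<zero>"
    if "x \<in> carrier L" "y \<in> carrier L" "z \<in> carrier L" for x y z
    using that jacobiator_eq_0[of "crd x" "crd y" "crd z"]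
    by (intro crd_eqI) (auto simp: jacobiator_def)
  ultimately show ?thesis
    by (intro lie_algebra.intro K_field module_L lie_algebra_axioms.intro)
qed

lemma finite_dimensional_L: "\<exists>S. finite S \<and> S \<subseteq> carrier L \<and> lin_span K L S = carrier L"
proof -
  let ?S = "(\<lambda>\<alpha>. vec (coroot \<alpha>, 0)) ` roots \<union> (\<lambda>\<alpha>. vec (root_vector \<alpha>)) ` roots"
  have S: "?S \<subseteq> carrier L"
    by (auto intro!: vec_mem torus_model additive_coroot root_vector_model)
  have "lin_span K L ?S = carrier L"
  proof (rule lin_span_eq_carrierI[OF S], intro conjI allI impI ballI)
    fix N and t :: "'l \<Rightarrow> 'k" assume N: "submodule N K L" "?S \<subseteq> N" and t: "additive t"
    show "vec (t, 0) \<in> N"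
      using t
    proof (induction rule: additive_coroot_induct)
      case zero
      have "vec 0 = \<zero>" by (rule crd_eqI) (simp_all add: zero_model)
      then show ?case
        using submodule_zero_mem[OF N(1)] by (simp add: zero_prod_def zero_fun_def)
    next
      case (coroot \<alpha>) then show ?case using N(2) by blast
    next
      case (add g h)
      have "(\<lambda>x. g x + h x, 0) = (g, 0) + (h, 0 :: 'l \<Rightarrow> 'k)" by (simp add: fun_eq_iff)
      then show ?case
        using add M.submoduleE(5)[OF N(1)] vec_add[OF torus_model torus_model] by metis
    next
      case (scale c g)
      have eq: "(\<lambda>x. c * g x, 0) = scale c (g, 0)" by (simp add: scale_def fun_eq_iff)
      show ?case
        unfolding eq vec_scale[OF torus_model[OF scale(1)]]
        by (rule M.submoduleE(4)[OF N(1) _ scale(2)]) simp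
    qed
  qed auto
  then show ?thesis using S finite_roots by (intro exI[of _ ?S]) auto
qed

lemma root_vector_nonzero: "root_vector \<alpha> \<noteq> 0"
proof
  assume "root_vector \<alpha> = 0"
  then have "snd (root_vector \<alpha>) \<alpha> = 0" by simp
  then show False by (simp add: root_vector_def)
qed

lemma coroot_brk:
  assumes "\<alpha> \<in> roots"
  shows "brk (coroot \<alpha>, 0) (root_vector \<alpha>) = scale 2 (root_vector \<alpha>)"
    "brk (coroot \<alpha>, 0) (root_vector (- \<alpha>)) = scale (- 2) (root_vector (- \<alpha>))"
    "brk (root_vector \<alpha>) (root_vector (- \<alpha>)) = scale (\<eta> \<alpha> (- \<alpha>)) (coroot \<alpha>, 0)"
  using assms by (simp_all add: brk_torus_root_vector brk_root_vector coroot_def mem_roots)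

text \<open>The root vector supplied by \<open>ideal_contains_root_vector\<close> generates a whole
  sl2-triple inside the ideal, and such a triple persists through every derived step.\<close>

lemma solvable_ideal_trivial_L:
  assumes I: "lie_ideal K L I" and sol: "lie_solvable K L I"
  shows "I = {\<zero>}"
proof (rule ccontr)
  assume "I \<noteq> {\<zero>}"
  have sm: "submodule I K L" and id: "\<And>x y. x \<in> carrier L \<Longrightarrow> y \<in> I \<Longrightarrow> x \<otimes> y \<in> I"
    using I by (auto simp: lie_ideal_def)
  have IL: "I \<subseteq> carrier L" by (rule M.submoduleE(1)[OF sm])
  have Iadd: "x \<oplus> y \<in> I" if "x \<in> I" "y \<in> I" for x y using M.submoduleE(5)[OF sm] that by blast
  have Isc: "c \<odot>\<^bsub>L\<^esub> x \<in> I" if "x \<in> I" for c x using M.submoduleE(4)[OF sm] that by simp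
  define U where "U = crd ` I"
  have vecU: "vec m \<in> I" if "m \<in> U" for m using that IL by (auto simp: U_def)
  have scU: "scale c m \<in> U" if m: "m \<in> U" for c m
  proof -
    obtain v where v: "v \<in> I" "m = crd v" using m by (auto simp: U_def)
    then have "crd (c \<odot>\<^bsub>L\<^esub> v) = scale c m" using IL by auto
    then show ?thesis unfolding U_def using Isc[OF v(1), of c] by (metis image_eqI)
  qed
  have idU: "brk x y \<in> U" if x: "x \<in> model" and y: "y \<in> U" for x y
  proof -
    obtain v where v: "v \<in> I" "y = crd v" using y by (auto simp: U_def)
    then have "vec x \<otimes> v \<in> I" using id x by simp
    moreover have "crd (vec x \<otimes> v) = brk x y" using v IL x by auto
    ultimately show ?thesis unfolding U_def by (metis image_eqI)
  qed
  obtain x where "x \<in> I" "x \<noteq> \<zero>" using \<open>I \<noteq> {\<zero>}\<close> submodule_zero_mem[OF sm] by blast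
  then have "crd x \<in> U" "crd x \<noteq> 0"
    using IL crd_eqI[of x \<zero>] by (auto simp: U_def)
  moreover have "U \<subseteq> model" using IL by (auto simp: U_def)
  moreover have "x + y \<in> U" if xy: "x \<in> U" "y \<in> U" for x y
  proof -
    obtain v w where v: "v \<in> I" "x = crd v" "w \<in> I" "y = crd w" using xy by (auto simp: U_def)
    then have "x + y = crd (v \<oplus> w)" using IL by (simp add: subsetD)
    then show ?thesis using v Iadd by (auto simp: U_def)
  qed
  ultimately obtain \<alpha> where \<alpha>: "\<alpha> \<in> roots" "root_vector \<alpha> \<in> U"
    using ideal_contains_root_vector[of U "crd x"] scU idU by blast
  have m: "- \<alpha> \<in> roots" using \<alpha> by simp
  have cM: "(coroot \<alpha>, 0) \<in> model" by (intro torus_model additive_coroot)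
  have e: "\<eta> \<alpha> (- \<alpha>) \<noteq> 0" by (rule cocycle_nonzero)
  \<comment> \<open>Two successive brackets with the vector of -\<alpha> produce first the coroot
    and then that vector itself; the scalars, a value of \<open>\<eta>\<close> and 2, are
    invertible.\<close>
  have "brk (root_vector (- \<alpha>)) (root_vector \<alpha>) = scale (- \<eta> \<alpha> (- \<alpha>)) (coroot \<alpha>, 0)"
    using brk_root_vector_skew[OF m \<alpha>(1)] coroot_brk(3)[OF \<alpha>(1)] by (simp add: scale_simps)
  then have "scale (- inverse (\<eta> \<alpha> (- \<alpha>))) (brk (root_vector (- \<alpha>)) (root_vector \<alpha>)) = (coroot \<alpha>, 0)"
    using e by (simp add: scale_simps)
  then have hU: "(coroot \<alpha>, 0) \<in> U"
    using scU[OF idU[OF root_vector_model[OF m] \<alpha>(2)]] by metis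
  have "brk (root_vector (- \<alpha>)) (coroot \<alpha>, 0) = scale 2 (root_vector (- \<alpha>))"
    using brk_torus_root_vector(2)[OF m, of "coroot \<alpha>"] \<alpha>(1) by (simp add: coroot_def mem_roots)
  then have "scale (inverse 2) (brk (root_vector (- \<alpha>)) (coroot \<alpha>, 0)) = root_vector (- \<alpha>)"
    by (simp add: scale_simps)
  then have fU: "root_vector (- \<alpha>) \<in> U"
    using scU[OF idU[OF root_vector_model[OF m] hU]] by metis
  define T where "T = {vec (root_vector \<alpha>), vec (root_vector (- \<alpha>)), vec (coroot \<alpha>, 0)}"
  have TL: "T \<subseteq> carrier L"
    using \<alpha>(1) m cM by (auto simp: T_def root_vector_model)
  \<comment> \<open>Each of the three elements is, up to a nonzero scalar, a bracket of two of them.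
    Stating this for every superset \<open>B\<close> makes the induction along the derived series
    immediate.\<close>
  have step: "T \<subseteq> bracket_span K L B B" if B: "T \<subseteq> B" for B
  proof -
    have "T \<subseteq> N" if N: "submodule N K L" "{x \<otimes> y | x y. x \<in> B \<and> y \<in> B} \<subseteq> N" for N
    proof -
      have br: "x \<otimes> y \<in> N" if "x \<in> T" "y \<in> T" for x y using that N(2) B by blast
      have sc: "c \<odot>\<^bsub>L\<^esub> x \<in> N" if "x \<in> N" for c x using M.submoduleE(4)[OF N(1)] that by simp
      have 1: "vec (root_vector \<alpha>) = inverse 2 \<odot>\<^bsub>L\<^esub> (vec (coroot \<alpha>, 0) \<otimes> vec (root_vector \<alpha>))"
        using \<alpha>(1) cM by (intro crd_eqI) (simp_all add: root_vector_model coroot_brk scale_simps)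
      have 2: "vec (root_vector (- \<alpha>)) =
          (- inverse 2) \<odot>\<^bsub>L\<^esub> (vec (coroot \<alpha>, 0) \<otimes> vec (root_vector (- \<alpha>)))"
        using \<alpha>(1) cM by (intro crd_eqI) (simp_all add: root_vector_model coroot_brk scale_simps)
      have 3: "vec (coroot \<alpha>, 0) =
          inverse (\<eta> \<alpha> (- \<alpha>)) \<odot>\<^bsub>L\<^esub> (vec (root_vector \<alpha>) \<otimes> vec (root_vector (- \<alpha>)))"
        using \<alpha>(1) cM e by (intro crd_eqI) (simp_all add: root_vector_model coroot_brk scale_simps)
      have "vec (root_vector \<alpha>) \<in> N" by (subst 1) (intro sc br, auto simp: T_def)
      moreover have "vec (root_vector (- \<alpha>)) \<in> N" by (subst 2) (intro sc br, auto simp: T_def)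
      moreover have "vec (coroot \<alpha>, 0) \<in> N" by (subst 3) (intro sc br, auto simp: T_def)
      ultimately show ?thesis by (simp add: T_def)
    qed
    then show ?thesis by (force simp: bracket_span_def lin_span_def)
  qed
  have "T \<subseteq> ((\<lambda>B. bracket_span K L B B) ^^ n) I" for n
    by (induction n) (use vecU \<alpha>(2) fU hU step in \<open>auto simp: T_def\<close>)
  then have "vec (root_vector \<alpha>) = \<zero>"
    using sol by (force simp: lie_solvable_def T_def)
  then have "root_vector \<alpha> = 0"
    using crd_vec[OF root_vector_model[OF \<alpha>(1)]] by simp
  then show False by (simp add: root_vector_nonzero)
qed

lemma semisimple_L: "semisimple_lie_algebra K L"
  using lie_algebra_L finite_dimensional_L solvable_ideal_trivial_L
  by (intro semisimple_lie_algebra.intro semisimple_lie_algebra_axioms.intro)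

section \<open>The Cartan subalgebra, its weights and the root lattice\<close>

lemma mem_cartan: "x \<in> cartan \<longleftrightarrow> x \<in> carrier L \<and> crd x = (fst (crd x), 0)"
  by (auto simp: cartan_def prod_eq_iff)

lemma vec_torus_cartan: "additive t \<Longrightarrow> vec (t, 0) \<in> cartan"
  by (simp add: cartan_def torus_model)

lemma additive_fst_crd: "x \<in> carrier L \<Longrightarrow> additive (fst (crd x))"
  using crd_model[of x] by (simp add: model_def)

lemma submodule_cartan: "submodule cartan K L"
  by (rule submodule_type_algebraI[OF module_L]) (auto simp: cartan_def fun_eq_iff)

lemma cartan_bracket: "\<lbrakk>x \<in> cartan; y \<in> carrier L\<rbrakk> \<Longrightarrow>
    crd (x \<otimes> y) = (0, \<lambda>\<gamma>. if \<gamma> \<in> roots then fst (crd x) \<gamma> * snd (crd y) \<gamma> else 0)"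
  using brk_torus(1)[of "fst (crd x)" "crd y"] by (simp add: mem_cartan)

lemma cartan_abelian: "\<lbrakk>x \<in> cartan; y \<in> cartan\<rbrakk> \<Longrightarrow> x \<otimes> y = \<zero>"
  by (rule crd_eqI) (auto simp: cartan_bracket fun_eq_iff prod_eq_iff cartan_def simp del: crd_bracket)

text \<open>The torus is abelian, so nilpotency takes one step. It is its own normalizer because an
  element with a nonzero root component is moved out of the torus by the corresponding
  coroot.\<close>

lemma cartan_subalgebra_L: "cartan_subalgebra K L cartan"
  unfolding cartan_subalgebra_def
proof (intro conjI)
  show "lie_subalgebra K L cartan"
    using submodule_cartan submodule_zero_mem[OF submodule_cartan]
    by (simp add: lie_subalgebra_def cartan_abelian)
  have z: "submodule {\<zero>} K L"
    by (rule submodule_type_algebraI[OF module_L]) (auto intro!: crd_eqI simp: scale_simps)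
  have "bracket_span K L cartan cartan = {\<zero>}"
  proof
    show "bracket_span K L cartan cartan \<subseteq> {\<zero>}"
      unfolding bracket_span_def using z by (rule lin_span_subset) (auto simp: cartan_abelian)
    show "{\<zero>} \<subseteq> bracket_span K L cartan cartan"
      using submodule_zero_mem by (auto simp: bracket_span_def lin_span_def)
  qed
  then show "lie_nilpotent K L cartan"
    unfolding lie_nilpotent_def by (intro exI[of _ 1]) simp
  show "lie_normalizer L cartan = cartan"
  proof
    show "lie_normalizer L cartan \<subseteq> cartan"
    proof
      fix x assume "x \<in> lie_normalizer L cartan"
      then have x: "x \<in> carrier L" "\<And>y. y \<in> cartan \<Longrightarrow> x \<otimes> y \<in> cartan"
        by (auto simp: lie_normalizer_def)
      have "snd (crd x) \<gamma> = 0" for \<gamma>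
      proof (cases "\<gamma> \<in> roots")
        case True
        \<comment> \<open>The bracket of \<open>x\<close> with this coroot has \<gamma>-component
          equal to -2 times that of \<open>x\<close>, and the normalizer condition makes it
          vanish.\<close>
        have "vec (coroot \<gamma>, 0) \<in> cartan" by (intro vec_torus_cartan additive_coroot)
        then have "x \<otimes> vec (coroot \<gamma>, 0) \<in> cartan" by (rule x(2))
        then have "snd (brk (crd x) (coroot \<gamma>, 0)) = 0"
          using x(1) by (simp add: cartan_def torus_model additive_coroot)
        then have "snd (brk (crd x) (coroot \<gamma>, 0)) \<gamma> = 0" by simp
        then show ?thesis using True by (simp add: brk_torus coroot_def mem_roots)
      next
        case False
        then show ?thesis using crd_model[OF x(1)] by (simp add: model_def)
      qed
      then show "x \<in> cartan" using x(1) by (simp add: cartan_def fun_eq_iff)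
    qed
    show "cartan \<subseteq> lie_normalizer L cartan"
      using submodule_zero_mem[OF submodule_cartan] by (auto simp: lie_normalizer_def cartan_abelian)
        (simp add: cartan_def)
  qed
qed

lemma eval_root_dual: "eval_root \<alpha> \<in> carrier (dual_group K L cartan)"
proof -
  have "x \<oplus> y \<in> cartan" "c \<odot>\<^bsub>L\<^esub> x \<in> cartan" if "x \<in> cartan" "y \<in> cartan" for x y c
    using M.submoduleE(4,5)[OF submodule_cartan] that by auto
  then show ?thesis by (auto simp: dual_group_def eval_root_def) (auto simp: cartan_def)
qed

lemma root_vector_weight: "\<alpha> \<in> roots \<Longrightarrow> vec (root_vector \<alpha>) \<in> weight_space L cartan (eval_root \<alpha>)"
proof -
  assume \<alpha>: "\<alpha> \<in> roots"
  have "x \<otimes> vec (root_vector \<alpha>) = eval_root \<alpha> x \<odot>\<^bsub>L\<^esub> vec (root_vector \<alpha>)" if x: "x \<in> cartan" for x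
  proof (rule crd_eqI)
    have "brk (fst (crd x), 0) (root_vector \<alpha>) = scale (fst (crd x) \<alpha>) (root_vector \<alpha>)"
      using \<alpha> by (rule brk_torus_root_vector)
    then show "crd (x \<otimes> vec (root_vector \<alpha>)) = crd (eval_root \<alpha> x \<odot>\<^bsub>L\<^esub> vec (root_vector \<alpha>))"
      using x \<alpha> unfolding mem_cartan by (simp add: root_vector_model eval_root_def mem_cartan)
  qed (use x \<alpha> in \<open>simp_all add: cartan_def root_vector_model\<close>)
  then show ?thesis using \<alpha> by (simp add: weight_space_def root_vector_model)
qed

text \<open>The root vectors are weight vectors and the torus is in the weight space of the zero
  functional, so no extension of the field is needed to see all weights.\<close>

lemma lie_split_L: "lie_split K L cartan"
  unfolding lie_split_def
proof (rule lin_span_eq_carrierI)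
  show "(\<Union>\<phi>\<in>carrier (dual_group K L cartan). weight_space L cartan \<phi>) \<subseteq> carrier L"
    by (auto simp: weight_space_def)
  fix N assume N: "(\<Union>\<phi>\<in>carrier (dual_group K L cartan). weight_space L cartan \<phi>) \<subseteq> N"
  have "vec (t, 0) \<in> N" if t: "additive t" for t
  proof -
    have "(\<lambda>x\<in>cartan. 0) \<in> carrier (dual_group K L cartan)"
      using M.submoduleE(4,5)[OF submodule_cartan] by (auto simp: dual_group_def)
    moreover have "vec (t, 0) \<in> weight_space L cartan (\<lambda>x\<in>cartan. 0)"
      using vec_torus_cartan[OF t] t
      by (auto intro!: crd_eqI simp: weight_space_def cartan_abelian torus_model scale_simps)
    ultimately show ?thesis using N by blast
  qed
  moreover have "vec (root_vector \<alpha>) \<in> N" if "\<alpha> \<in> roots" for \<alpha>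
    using root_vector_weight[OF that] eval_root_dual N by blast
  ultimately show "(\<forall>t. additive t \<longrightarrow> vec (t, 0) \<in> N) \<and> (\<forall>\<alpha>\<in>roots. vec (root_vector \<alpha>) \<in> N)"
    by blast
qed

lemma eval_root_vec: "additive t \<Longrightarrow> eval_root \<alpha> (vec (t, 0)) = t \<alpha>"
  by (simp add: eval_root_def vec_torus_cartan torus_model)

text \<open>A vector of nonzero weight cannot have a torus component, so it has a nonzero component
  at some root. Comparing that component on both sides of the eigenvalue equation identifies the
  weight with evaluation at this root.\<close>

lemma lie_roots_L: "lie_roots K L cartan = eval_root ` roots"
proof
  show "eval_root ` roots \<subseteq> lie_roots K L cartan"
  proof clarify
    fix \<alpha> assume \<alpha>: "\<alpha> \<in> roots"
    have "eval_root \<alpha> (vec (coroot \<alpha>, 0)) \<noteq> \<one>\<^bsub>dual_group K L cartan\<^esub> (vec (coroot \<alpha>, 0))"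
      using \<alpha> by (simp add: eval_root_vec additive_coroot dual_group_def vec_torus_cartan)
        (simp add: coroot_def mem_roots)
    then have "eval_root \<alpha> \<noteq> \<one>\<^bsub>dual_group K L cartan\<^esub>" by metis
    moreover have "vec (root_vector \<alpha>) \<noteq> \<zero>"
    proof
      assume "vec (root_vector \<alpha>) = \<zero>"
      then have "root_vector \<alpha> = 0" using crd_vec[OF root_vector_model[OF \<alpha>]] by simp
      then show False by (simp add: root_vector_nonzero)
    qed
    ultimately show "eval_root \<alpha> \<in> lie_roots K L cartan"
      using eval_root_dual root_vector_weight[OF \<alpha>] by (auto simp: lie_roots_def)
  qed
next
  show "lie_roots K L cartan \<subseteq> eval_root ` roots"
  proof
    fix \<phi> assume "\<phi> \<in> lie_roots K L cartan"
    then have dual: "\<phi> \<in> carrier (dual_group K L cartan)" and nz: "\<phi> \<noteq> (\<lambda>x\<in>cartan. 0)"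
      and ws: "weight_space L cartan \<phi> \<noteq> {\<zero>}"
      by (auto simp: lie_roots_def dual_group_def)
    have ext: "\<phi> \<in> extensional cartan" using dual by (auto simp: dual_group_def PiE_def)
    have "\<exists>x\<in>cartan. \<phi> x \<noteq> 0"
    proof (rule ccontr)
      assume "\<not> ?thesis"
      then have "\<phi> = (\<lambda>x\<in>cartan. 0)" using ext by (auto simp: fun_eq_iff extensional_def)
      then show False using nz by blast
    qed
    then obtain y where y: "y \<in> cartan" "\<phi> y \<noteq> 0" by blast
    have "\<zero> \<in> weight_space L cartan \<phi>"
      by (auto intro!: crd_eqI simp: weight_space_def scale_simps cartan_def)
    then obtain x where x: "x \<in> weight_space L cartan \<phi>" "x \<noteq> \<zero>" using ws by blast
    have xL: "x \<in> carrier L" using x(1) by (simp add: weight_space_def)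
    have w: "(0, \<lambda>\<gamma>. if \<gamma> \<in> roots then fst (crd z) \<gamma> * snd (crd x) \<gamma> else 0) = scale (\<phi> z) (crd x)"
      if z: "z \<in> cartan" for z
    proof -
      have "z \<otimes> x = \<phi> z \<odot>\<^bsub>L\<^esub> x" using x(1) z by (simp add: weight_space_def)
      then have "crd (z \<otimes> x) = scale (\<phi> z) (crd x)" using xL by simp
      then show ?thesis using cartan_bracket[OF z xL] by simp
    qed
    \<comment> \<open>A bracket with a Cartan element has no torus part; comparison at
      \<open>y\<close>, where the weight is nonzero, shows that \<open>x\<close> has none
      either.\<close>
    have "fst (crd x) \<gamma> = 0" for \<gamma>
      using arg_cong[OF w[OF y(1)], of "\<lambda>u. fst u \<gamma>"] y(2) by simp
    moreover have "crd x \<noteq> 0" using x(2) xL crd_eqI[of x \<zero>] by auto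
    ultimately obtain \<gamma> where g: "snd (crd x) \<gamma> \<noteq> 0" by (auto simp: prod_eq_iff fun_eq_iff)
    have \<gamma>: "\<gamma> \<in> roots" using g crd_model[OF xL] by (auto simp: model_def)
    have "\<phi> z = eval_root \<gamma> z" for z
    proof (cases "z \<in> cartan")
      case True
      have "fst (crd z) \<gamma> * snd (crd x) \<gamma> = \<phi> z * snd (crd x) \<gamma>"
        using arg_cong[OF w[OF True], of "\<lambda>u. snd u \<gamma>"] \<gamma> by simp
      then show ?thesis using g True by (simp add: eval_root_def)
    next
      case False
      then show ?thesis using ext by (simp add: eval_root_def extensional_def)
    qed
    then have "\<phi> = eval_root \<gamma>" by blast
    then show "\<phi> \<in> eval_root ` roots" using \<gamma> by blast
  qed
qed

lemma group_dual: "group (dual_group K L cartan)" (is "group ?D")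
proof (rule groupI)
  note cl = M.submoduleE(4,5)[OF submodule_cartan]
  show "x \<otimes>\<^bsub>?D\<^esub> y \<in> carrier ?D" if "x \<in> carrier ?D" "y \<in> carrier ?D" for x y
    using that cl by (auto simp: dual_group_def algebra_simps)
  show "\<one>\<^bsub>?D\<^esub> \<in> carrier ?D" using cl by (auto simp: dual_group_def)
  show "x \<otimes>\<^bsub>?D\<^esub> y \<otimes>\<^bsub>?D\<^esub> z = x \<otimes>\<^bsub>?D\<^esub> (y \<otimes>\<^bsub>?D\<^esub> z)"
    if "x \<in> carrier ?D" "y \<in> carrier ?D" "z \<in> carrier ?D" for x y z
    by (auto simp: dual_group_def fun_eq_iff)
  show "\<one>\<^bsub>?D\<^esub> \<otimes>\<^bsub>?D\<^esub> x = x" if "x \<in> carrier ?D" for x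
    using that by (auto simp: dual_group_def fun_eq_iff PiE_def extensional_def)
  show "\<exists>y\<in>carrier ?D. y \<otimes>\<^bsub>?D\<^esub> x = \<one>\<^bsub>?D\<^esub>" if "x \<in> carrier ?D" for x
    using that cl
    by (intro bexI[of _ "\<lambda>z\<in>cartan. - x z"]) (auto simp: dual_group_def fun_eq_iff algebra_simps)
qed

text \<open>A homomorphism carries the subgroup generated by the roots onto the one generated by
  their images, which gives surjectivity. Injectivity comes from positive definiteness.\<close>

lemma eval_root_iso: "eval_root \<in> iso additive_group (root_lattice_group K L cartan)"
proof -
  let ?D = "dual_group K L cartan"
  interpret A: comm_group "additive_group :: 'l monoid" by (rule comm_group_additive_group)
  interpret D: group ?D by (rule group_dual)
  have hom: "eval_root \<in> hom additive_group ?D"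
    using eval_root_dual
    by (auto simp: hom_def additive_group_def dual_group_def eval_root_def fun_eq_iff cartan_def
        additive.add[OF additive_fst_crd])
  interpret H: group_hom "additive_group :: 'l monoid" ?D eval_root
    by (simp add: group_hom_def group_hom_axioms_def hom A.is_group D.is_group)
  have "eval_root ` UNIV = generate ?D (eval_root ` roots)"
    using H.generate_img[of roots] generated_by_roots by (simp add: additive_group_def)
  moreover have "carrier (root_lattice_group K L cartan) = generate ?D (eval_root ` roots)"
    using eval_root_dual
    by (simp add: root_lattice_group_def carrier_subgroup_generated lie_roots_L Int_absorb1 image_subset_iff)
  moreover have "inj eval_root"
  proof (rule injI)
    fix \<alpha> \<beta> assume "eval_root \<alpha> = eval_root \<beta>"
    \<comment> \<open>The two functionals are compared on the coroot of \<alpha> - \<beta>, so that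
      their difference there is the norm of \<alpha> - \<beta>.\<close>
    then have "(coroot (\<alpha> - \<beta>) \<alpha> :: 'k) = coroot (\<alpha> - \<beta>) \<beta>"
      using eval_root_vec[OF additive_coroot] by metis
    then have "form (\<alpha> - \<beta>) \<alpha> = form (\<alpha> - \<beta>) \<beta>" by (simp add: coroot_def del: form_simps)
    then have "form (\<alpha> - \<beta>) (\<alpha> - \<beta>) = 0" using form_simps(6) by (metis diff_self)
    then show "\<alpha> = \<beta>" by (metis form_self_eq_0_iff right_minus_eq)
  qed
  ultimately show ?thesis
    using hom by (auto simp: iso_def hom_def bij_betw_def additive_group_def root_lattice_group_def)
qed

end

section \<open>The cocycle of the central extension\<close>

context extension_datum
begin

lemma zeta_nonzero: "\<zeta> \<noteq> 0"
  using \<zeta>_primitive(1) w_order(1) by (cases "\<zeta> = 0") (simp_all add: power_0_left)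

lemma carrier_power_group: "carrier (power_group \<zeta>) = range (\<lambda>n::nat. \<zeta> ^ n)"
  by (simp add: power_group_def)

lemma power_group_nonzero: "z \<in> carrier (power_group \<zeta>) \<Longrightarrow> z \<noteq> 0"
  using zeta_nonzero by (auto simp: carrier_power_group)

lemma power_group_mult:
  "\<lbrakk>y \<in> carrier (power_group \<zeta>); z \<in> carrier (power_group \<zeta>)\<rbrakk> \<Longrightarrow> y * z \<in> carrier (power_group \<zeta>)"
  by (auto simp: carrier_power_group power_add[symmetric])

lemma power_group_one: "1 \<in> carrier (power_group \<zeta>)"
  by (auto simp: carrier_power_group intro: range_eqI[of _ _ 0])

lemma power_group_zeta: "\<zeta> \<in> carrier (power_group \<zeta>)"
  by (auto simp: carrier_power_group intro: range_eqI[of _ _ 1])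

lemma iota_closed [simp]: "z \<in> carrier (power_group \<zeta>) \<Longrightarrow> \<iota> z \<in> carrier H"
  using \<iota>_mon by (auto simp: mon_def hom_def)

lemma iota_mult:
  "\<lbrakk>y \<in> carrier (power_group \<zeta>); z \<in> carrier (power_group \<zeta>)\<rbrakk> \<Longrightarrow> \<iota> (y * z) = \<iota> y \<otimes> \<iota> z"
  using \<iota>_mon by (auto simp: mon_def hom_def power_group_def)

lemma iota_inj:
  "\<lbrakk>\<iota> y = \<iota> z; y \<in> carrier (power_group \<zeta>); z \<in> carrier (power_group \<zeta>)\<rbrakk> \<Longrightarrow> y = z"
  using \<iota>_mon by (auto simp: mon_def inj_on_def)

lemma iota_one [simp]: "\<iota> 1 = \<one>"
  using iota_mult[OF power_group_one power_group_one] iota_closed[OF power_group_one]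
  by (simp add: r_cancel_one')

lemma iota_cancel:
  assumes "\<iota> y \<otimes> h = \<iota> z \<otimes> h" "y \<in> carrier (power_group \<zeta>)" "z \<in> carrier (power_group \<zeta>)"
    "h \<in> carrier H"
  shows "y = z"
  using assms iota_inj by simp

section \<open>Coinvariants and the fibres of the projection\<close>

lemma normal_one_minus_image: "one_minus_image w \<lhd> additive_group"
proof -
  interpret A: comm_group "additive_group :: 'l monoid" by (rule comm_group_additive_group)
  interpret w: additive w using w_automorphism by (simp add: automorphisms_def)
  have "subgroup (one_minus_image w) additive_group"
  proof (rule A.subgroupI)
    show "inv\<^bsub>additive_group\<^esub> a \<in> one_minus_image w" if "a \<in> one_minus_image w" for a
    proof -
      obtain x where "a = x - w x" using \<open>a \<in> one_minus_image w\<close> by (auto simp: one_minus_image_def)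
      then have "- a = - x - w (- x)" by (simp add: w.minus)
      then show ?thesis by (simp add: inv_additive_group one_minus_image_def)
    qed
    show "a \<otimes>\<^bsub>additive_group\<^esub> b \<in> one_minus_image w"
      if "a \<in> one_minus_image w" "b \<in> one_minus_image w" for a b
    proof -
      obtain x y where "a = x - w x" "b = y - w y"
        using \<open>a \<in> one_minus_image w\<close> \<open>b \<in> one_minus_image w\<close> by (auto simp: one_minus_image_def)
      then have "a + b = (x + y) - w (x + y)" by (simp add: w.add)
      then show ?thesis by (simp add: additive_group_def one_minus_image_def)
    qed
  qed (auto simp: additive_group_def one_minus_image_def)
  then show ?thesis by (rule A.subgroup_imp_normal)
qed

lemma group_coinvariants: "group (coinvariants w)"
  unfolding coinvariants_def by (rule normal.factorgroup_is_group[OF normal_one_minus_image])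

lemma coinvariant_class_mem: "coinvariant_class w \<alpha> \<in> carrier (coinvariants w)"
  using normal.r_coset_hom_Mod[OF normal_one_minus_image]
  by (auto simp: hom_def coinvariants_def coinvariant_class_def additive_group_def Pi_def)

lemma coinvariant_class_add:
  "coinvariant_class w (\<alpha> + \<beta>) = coinvariant_class w \<alpha> \<otimes>\<^bsub>coinvariants w\<^esub> coinvariant_class w \<beta>"
  using normal.r_coset_hom_Mod[OF normal_one_minus_image]
  by (auto simp: hom_def coinvariants_def coinvariant_class_def additive_group_def)

lemma group_hom_pi: "group_hom H (coinvariants w) \<pi>"
  using \<pi>_epi group_coinvariants
  by (auto simp: group_hom_def group_hom_axioms_def epi_def intro: is_group)

lemma coinvariant_class_zero: "coinvariant_class w 0 = \<one>\<^bsub>coinvariants w\<^esub>"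
proof -
  interpret Q: group "coinvariants w" by (rule group_coinvariants)
  show ?thesis
    using coinvariant_class_add[of 0 0] coinvariant_class_mem[of 0] by (simp add: Q.r_cancel_one')
qed

lemma pi_mult: "\<lbrakk>g \<in> carrier H; h \<in> carrier H\<rbrakk> \<Longrightarrow> \<pi> (g \<otimes> h) = \<pi> g \<otimes>\<^bsub>coinvariants w\<^esub> \<pi> h"
  using group_hom.hom_mult[OF group_hom_pi] .

lemma pi_iota: "z \<in> carrier (power_group \<zeta>) \<Longrightarrow> \<pi> (\<iota> z) = \<one>\<^bsub>coinvariants w\<^esub>"
  using exact by (auto simp: kernel_def)

lemma same_fibre:
  assumes "g \<in> carrier H" "h \<in> carrier H" "\<pi> g = \<pi> h"
  shows "\<exists>z\<in>carrier (power_group \<zeta>). g = \<iota> z \<otimes> h"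
proof -
  interpret p: group_hom H "coinvariants w" \<pi> by (rule group_hom_pi)
  have "g \<otimes> inv h \<in> kernel H (coinvariants w) \<pi>"
    using assms by (simp add: kernel_def)
  then obtain z where z: "z \<in> carrier (power_group \<zeta>)" "\<iota> z = g \<otimes> inv h"
    unfolding exact[symmetric] by force
  then have "g = \<iota> z \<otimes> h" using assms by (simp add: m_assoc)
  then show ?thesis using z(1) by blast
qed

text \<open>The value at zero is fixed to be the identity, which normalizes the resulting cocycle;
  every other value is an arbitrary lift.\<close>

definition sec :: "'l \<Rightarrow> 'h"
  where "sec \<alpha> = (if \<alpha> = 0 then \<one> else SOME h. h \<in> carrier H \<and> \<pi> h = coinvariant_class w \<alpha>)"

lemma sec: "sec \<alpha> \<in> carrier H" "\<pi> (sec \<alpha>) = coinvariant_class w \<alpha>"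
proof -
  interpret p: group_hom H "coinvariants w" \<pi> by (rule group_hom_pi)
  have "coinvariant_class w \<alpha> \<in> \<pi> ` carrier H"
    using \<pi>_epi coinvariant_class_mem[of \<alpha>] by (simp add: epi_def)
  then have "\<exists>h. h \<in> carrier H \<and> \<pi> h = coinvariant_class w \<alpha>" by force
  from someI_ex[OF this]
  show "sec \<alpha> \<in> carrier H" "\<pi> (sec \<alpha>) = coinvariant_class w \<alpha>"
    by (auto simp: sec_def coinvariant_class_zero)
qed

lemma sec_zero [simp]: "sec 0 = \<one>"
  by (simp add: sec_def)

lemma mem_ext_lattice:
  "a \<in> carrier ext_lattice \<longleftrightarrow> snd a \<in> carrier H \<and> \<pi> (snd a) = coinvariant_class w (fst a)"
  by (cases a) (simp add: ext_lattice_def)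

lemma mult_ext_lattice: "a \<otimes>\<^bsub>ext_lattice\<^esub> b = (fst a + fst b, snd a \<otimes> snd b)"
  by (simp add: ext_lattice_def mult_DirProd' additive_group_def)

lemma mult_ext_lattice_mem:
  "\<lbrakk>a \<in> carrier ext_lattice; b \<in> carrier ext_lattice\<rbrakk> \<Longrightarrow> a \<otimes>\<^bsub>ext_lattice\<^esub> b \<in> carrier ext_lattice"
  by (simp add: mem_ext_lattice mult_ext_lattice pi_mult coinvariant_class_add)

lemma ext_incl_mem: "z \<in> carrier (power_group \<zeta>) \<Longrightarrow> ext_incl z \<in> carrier ext_lattice"
  by (simp add: mem_ext_lattice ext_incl_def pi_iota coinvariant_class_zero)

lemma sec_ext_lattice: "(\<alpha>, sec \<alpha>) \<in> carrier ext_lattice"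
  by (simp add: mem_ext_lattice sec)

text \<open>The power of \<zeta> by which an element of the extension differs from the section
  element above the same lattice vector.\<close>

definition coef :: "'l \<times> 'h \<Rightarrow> 'k"
  where "coef a = (SOME z. z \<in> carrier (power_group \<zeta>) \<and> snd a = \<iota> z \<otimes> sec (fst a))"

lemma coef:
  assumes "a \<in> carrier ext_lattice"
  shows "coef a \<in> carrier (power_group \<zeta>)" "snd a = \<iota> (coef a) \<otimes> sec (fst a)"
proof -
  have "\<exists>z. z \<in> carrier (power_group \<zeta>) \<and> snd a = \<iota> z \<otimes> sec (fst a)"
    using same_fibre[of "snd a" "sec (fst a)"] assms by (auto simp: mem_ext_lattice sec)
  from someI_ex[OF this]
  show "coef a \<in> carrier (power_group \<zeta>)" "snd a = \<iota> (coef a) \<otimes> sec (fst a)"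
    by (auto simp: coef_def)
qed

lemma coef_eqI:
  assumes "z \<in> carrier (power_group \<zeta>)" "snd a = \<iota> z \<otimes> sec (fst a)"
  shows "coef a = z"
proof -
  have "a \<in> carrier ext_lattice"
    using assms group.is_monoid[OF group_coinvariants] coinvariant_class_mem[of "fst a"]
    by (simp add: mem_ext_lattice pi_mult pi_iota sec monoid.l_one)
  from coef[OF this] show ?thesis using assms iota_cancel sec by metis
qed

lemma coef_sec: "coef (\<alpha>, sec \<alpha>) = 1"
  by (rule coef_eqI) (simp_all add: power_group_one sec)

definition sec_cocycle :: "'l \<Rightarrow> 'l \<Rightarrow> 'k"
  where "sec_cocycle \<alpha> \<beta> = coef (\<alpha> + \<beta>, sec \<alpha> \<otimes> sec \<beta>)"

lemma sec_mult:
  "sec_cocycle \<alpha> \<beta> \<in> carrier (power_group \<zeta>)"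
  "sec \<alpha> \<otimes> sec \<beta> = \<iota> (sec_cocycle \<alpha> \<beta>) \<otimes> sec (\<alpha> + \<beta>)"
proof -
  have "(\<alpha> + \<beta>, sec \<alpha> \<otimes> sec \<beta>) \<in> carrier ext_lattice"
    using mult_ext_lattice_mem[OF sec_ext_lattice sec_ext_lattice, of \<alpha> \<beta>]
    by (simp add: mult_ext_lattice)
  from coef[OF this] show "sec_cocycle \<alpha> \<beta> \<in> carrier (power_group \<zeta>)"
    "sec \<alpha> \<otimes> sec \<beta> = \<iota> (sec_cocycle \<alpha> \<beta>) \<otimes> sec (\<alpha> + \<beta>)"
    by (simp_all add: sec_cocycle_def)
qed

lemma iota_lift_mult:
  assumes "y \<in> carrier (power_group \<zeta>)" "z \<in> carrier (power_group \<zeta>)"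
    "g \<in> carrier H" "h \<in> carrier H"
  shows "(\<iota> y \<otimes> g) \<otimes> (\<iota> z \<otimes> h) = \<iota> (y * z) \<otimes> (g \<otimes> h)"
proof -
  have "(\<iota> y \<otimes> g) \<otimes> (\<iota> z \<otimes> h) = \<iota> y \<otimes> (g \<otimes> \<iota> z) \<otimes> h"
    using assms by (simp add: m_assoc)
  also have "\<dots> = \<iota> y \<otimes> (\<iota> z \<otimes> g) \<otimes> h" using central assms by simp
  also have "\<dots> = \<iota> (y * z) \<otimes> (g \<otimes> h)" using assms by (simp add: m_assoc iota_mult)
  finally show ?thesis .
qed

lemma coef_mult:
  assumes "a \<in> carrier ext_lattice" "b \<in> carrier ext_lattice"
  shows "coef (a \<otimes>\<^bsub>ext_lattice\<^esub> b) = coef a * coef b * sec_cocycle (fst a) (fst b)"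
proof (rule coef_eqI)
  note ca = coef[OF assms(1)] and cb = coef[OF assms(2)] and sm = sec_mult[of "fst a" "fst b"]
  show "coef a * coef b * sec_cocycle (fst a) (fst b) \<in> carrier (power_group \<zeta>)"
    by (intro power_group_mult ca cb sm)
  have "snd a \<otimes> snd b = \<iota> (coef a * coef b) \<otimes> (sec (fst a) \<otimes> sec (fst b))"
    using iota_lift_mult[OF ca(1) cb(1) sec(1) sec(1)] ca(2) cb(2) by metis
  also have "\<dots> = \<iota> (coef a * coef b * sec_cocycle (fst a) (fst b)) \<otimes> sec (fst a + fst b)"
    unfolding sm(2) using ca(1) cb(1) sm(1)
    by (simp add: iota_mult power_group_mult sec m_assoc)
  finally show "snd (a \<otimes>\<^bsub>ext_lattice\<^esub> b) =
      \<iota> (coef a * coef b * sec_cocycle (fst a) (fst b)) \<otimes> sec (fst (a \<otimes>\<^bsub>ext_lattice\<^esub> b))"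
    by (simp add: mult_ext_lattice)
qed

lemma sec_cocycle_zero_left: "sec_cocycle 0 \<alpha> = 1"
  by (simp add: sec_cocycle_def sec coef_sec)

lemma coef_ext_incl:
  assumes "z \<in> carrier (power_group \<zeta>)"
  shows "coef (ext_incl z) = z"
  using assms by (intro coef_eqI) (simp_all add: ext_incl_def)

lemma coef_ext_incl_mult:
  assumes "z \<in> carrier (power_group \<zeta>)" "a \<in> carrier ext_lattice"
  shows "coef (ext_incl z \<otimes>\<^bsub>ext_lattice\<^esub> a) = z * coef a"
proof -
  have "fst (ext_incl z) = 0" by (simp add: ext_incl_def)
  then show ?thesis
    using coef_mult[OF ext_incl_mem[OF assms(1)] assms(2)] assms(1)
    by (simp add: coef_ext_incl sec_cocycle_zero_left)
qed

lemma ext_incl_coef_sec: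
  assumes "a \<in> carrier ext_lattice"
  shows "ext_incl (coef a) \<otimes>\<^bsub>ext_lattice\<^esub> (fst a, sec (fst a)) = a"
  using coef(2)[OF assms] by (cases a) (simp add: mult_ext_lattice ext_incl_def)

text \<open>Associativity in \<open>H\<close>: the product of three section values is a central
  multiple of \<open>sec (\<alpha> + \<beta> + \<gamma>)\<close>, and the two ways of bracketing
  compute the same central factor.\<close>

lemma sec_cocycle_assoc:
  "sec_cocycle \<alpha> \<beta> * sec_cocycle (\<alpha> + \<beta>) \<gamma> = sec_cocycle \<beta> \<gamma> * sec_cocycle \<alpha> (\<beta> + \<gamma>)"
proof (rule iota_cancel)
  note m = sec_mult and c = sec(1)
  have "\<iota> (sec_cocycle \<alpha> \<beta> * sec_cocycle (\<alpha> + \<beta>) \<gamma>) \<otimes> sec (\<alpha> + \<beta> + \<gamma>) = sec \<alpha> \<otimes> sec \<beta> \<otimes> sec \<gamma>"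
    unfolding m(2)[of \<alpha> \<beta>]
    using m(1) c by (simp add: iota_mult m_assoc m(2)[of "\<alpha> + \<beta>" \<gamma>])
  also have "\<dots> = sec \<alpha> \<otimes> (\<iota> (sec_cocycle \<beta> \<gamma>) \<otimes> sec (\<beta> + \<gamma>))"
    using c by (simp add: m_assoc m(2)[symmetric])
  \<comment> \<open>The factor \<open>\<iota> 1\<close> gives the product the shape in which
    \<open>iota_lift_mult\<close> moves the central element past
    \<open>sec \<alpha>\<close>.\<close>
  also have "\<dots> = \<iota> 1 \<otimes> sec \<alpha> \<otimes> (\<iota> (sec_cocycle \<beta> \<gamma>) \<otimes> sec (\<beta> + \<gamma>))"
    using c by simp
  also have "\<dots> = \<iota> (sec_cocycle \<beta> \<gamma>) \<otimes> (sec \<alpha> \<otimes> sec (\<beta> + \<gamma>))"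
    using iota_lift_mult[OF power_group_one m(1)[of \<beta> \<gamma>] c[of \<alpha>] c[of "\<beta> + \<gamma>"]] by simp
  also have "\<dots> = \<iota> (sec_cocycle \<beta> \<gamma> * sec_cocycle \<alpha> (\<beta> + \<gamma>)) \<otimes> sec (\<alpha> + \<beta> + \<gamma>)"
    unfolding m(2)[of \<alpha> "\<beta> + \<gamma>"]
    using m(1) c by (simp add: iota_mult m_assoc add.assoc)
  finally show "\<iota> (sec_cocycle \<alpha> \<beta> * sec_cocycle (\<alpha> + \<beta>) \<gamma>) \<otimes> sec (\<alpha> + \<beta> + \<gamma>) =
    \<iota> (sec_cocycle \<beta> \<gamma> * sec_cocycle \<alpha> (\<beta> + \<gamma>)) \<otimes> sec (\<alpha> + \<beta> + \<gamma>)" .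
qed (simp_all add: sec_mult power_group_mult sec)

text \<open>The pairing is a definite description over all lifts. The commutator of the section
  lifts therefore has to be shown to work for every pair of lifts and to be the only such scalar;
  the claim follows by expanding both orders of the product.\<close>

lemma sec_cocycle_pairing: "sec_cocycle \<alpha> \<beta> = pairing \<alpha> \<beta> * sec_cocycle \<beta> \<alpha>"
proof -
  let ?C = "\<lambda>z. z \<in> carrier (power_group \<zeta>) \<and> (\<forall>g\<in>carrier H. \<forall>h\<in>carrier H.
    \<pi> g = coinvariant_class w \<alpha> \<and> \<pi> h = coinvariant_class w \<beta> \<longrightarrow> g \<otimes> h = \<iota> z \<otimes> (h \<otimes> g))"
  have "\<pi> (sec \<alpha> \<otimes> sec \<beta>) = \<pi> (sec \<beta> \<otimes> sec \<alpha>)"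
    using sec by (simp add: pi_mult coinvariant_class_add[symmetric] add.commute)
  then obtain z where z: "z \<in> carrier (power_group \<zeta>)" "sec \<alpha> \<otimes> sec \<beta> = \<iota> z \<otimes> (sec \<beta> \<otimes> sec \<alpha>)"
    using same_fibre sec by (metis m_closed)
  \<comment> \<open>Arbitrary lifts are central multiples of the section lifts, and the same central
    factor appears in both orders of the product.\<close>
  have "?C z"
  proof (intro conjI ballI impI z(1))
    fix g h assume gh: "g \<in> carrier H" "h \<in> carrier H"
      "\<pi> g = coinvariant_class w \<alpha> \<and> \<pi> h = coinvariant_class w \<beta>"
    obtain x where x: "x \<in> carrier (power_group \<zeta>)" "g = \<iota> x \<otimes> sec \<alpha>"
      using same_fibre[of g "sec \<alpha>"] gh sec by auto
    obtain y where y: "y \<in> carrier (power_group \<zeta>)" "h = \<iota> y \<otimes> sec \<beta>"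
      using same_fibre[of h "sec \<beta>"] gh sec by auto
    have "g \<otimes> h = \<iota> (x * y) \<otimes> (sec \<alpha> \<otimes> sec \<beta>)"
      unfolding x(2) y(2) by (intro iota_lift_mult x y sec)
    also have "\<dots> = \<iota> (x * y) \<otimes> (\<iota> z \<otimes> (sec \<beta> \<otimes> sec \<alpha>))"
      by (simp add: z(2))
    also have "\<dots> = \<iota> (z * (y * x)) \<otimes> (sec \<beta> \<otimes> sec \<alpha>)"
      using x(1) y(1) z(1) sec
      by (simp add: m_assoc[symmetric] iota_mult[symmetric] power_group_mult mult_ac)
    also have "\<dots> = \<iota> z \<otimes> (\<iota> (y * x) \<otimes> (sec \<beta> \<otimes> sec \<alpha>))"
      using x(1) y(1) z(1) sec by (simp add: iota_mult[of z] power_group_mult m_assoc)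
    also have "\<iota> (y * x) \<otimes> (sec \<beta> \<otimes> sec \<alpha>) = h \<otimes> g"
      unfolding x(2) y(2) by (intro iota_lift_mult[symmetric] x y sec)
    finally show "g \<otimes> h = \<iota> z \<otimes> (h \<otimes> g)" .
  qed
  moreover have "y = z" if "?C y" for y
  proof (rule iota_cancel)
    show "\<iota> y \<otimes> (sec \<beta> \<otimes> sec \<alpha>) = \<iota> z \<otimes> (sec \<beta> \<otimes> sec \<alpha>)"
      using that z sec by metis
  qed (use that z sec in auto)
  ultimately have p: "pairing \<alpha> \<beta> = z"
    unfolding pairing_def commutator_pairing_def by (rule the_equality)
  have "\<iota> (sec_cocycle \<alpha> \<beta>) \<otimes> sec (\<alpha> + \<beta>) = \<iota> (z * sec_cocycle \<beta> \<alpha>) \<otimes> sec (\<alpha> + \<beta>)"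
    using z(1) sec_mult(1) sec
    by (simp add: sec_mult(2)[symmetric] z(2) iota_mult m_assoc) (simp add: sec_mult(2) add.commute)
  then show ?thesis
    unfolding p by (rule iota_cancel) (simp_all add: z sec_mult power_group_mult sec)
qed

end

section \<open>The structure constants\<close>

context input_datum
begin

definition structure_cocycle :: "'l \<Rightarrow> 'l \<Rightarrow> 'k"
  where "structure_cocycle \<alpha> \<beta> = \<epsilon> \<alpha> \<beta> * sec_cocycle \<alpha> \<beta>"

text \<open>A bimultiplicative function is a cocycle, both sides of the identity being the product
  of its three pairwise values, and a product of cocycles is again one. For the sign, the pairing in
  condition (1) turns the section cocycle into its transpose.\<close>

lemma root_cocycle_structure: "root_cocycle form structure_cocycle"
proof unfold_locales
  fix \<alpha> \<beta> \<gamma> :: 'l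
  show "structure_cocycle \<alpha> \<beta> * structure_cocycle (\<alpha> + \<beta>) \<gamma> =
      structure_cocycle \<beta> \<gamma> * structure_cocycle \<alpha> (\<beta> + \<gamma>)"
    using sec_cocycle_assoc[of \<alpha> \<beta> \<gamma>]
    by (simp add: structure_cocycle_def \<epsilon>_left \<epsilon>_right mult_ac)
  show "structure_cocycle \<alpha> \<beta> \<noteq> 0"
    using \<epsilon>_nonzero power_group_nonzero[OF sec_mult(1)] by (simp add: structure_cocycle_def)
  show "structure_cocycle 0 \<alpha> = 1"
    using \<epsilon>_left[of 0 0 \<alpha>] \<epsilon>_nonzero[of 0 \<alpha>]
    by (simp add: structure_cocycle_def sec_cocycle_zero_left)
  show "structure_cocycle \<alpha> \<beta> = - structure_cocycle \<beta> \<alpha>" if "form \<alpha> \<beta> = - 1"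
  proof -
    have "\<epsilon> \<alpha> \<beta> = - pairing \<beta> \<alpha> * \<epsilon> \<beta> \<alpha>"
      using \<epsilon>_commutator[OF that] \<epsilon>_nonzero[of \<beta> \<alpha>] by (simp add: field_simps)
    then show ?thesis
      using sec_cocycle_pairing[of \<beta> \<alpha>] by (simp add: structure_cocycle_def)
  qed
qed

end

section \<open>Coordinates on the space of symbols\<close>

lemma lookup_map_mult [simp]:
  "Poly_Mapping.lookup (Poly_Mapping.map ((*) c) p) a = (c::'k::field) * Poly_Mapping.lookup p a"
  by (simp add: map.rep_eq when_def)

lemma keys_map_mult: "Poly_Mapping.keys (Poly_Mapping.map ((*) (c::'k::field)) p) \<subseteq> Poly_Mapping.keys p"
  by (auto simp: in_keys_iff)

lemma free_module_simps [simp]: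
  "f \<in> carrier (free_module S) \<longleftrightarrow> Poly_Mapping.keys f \<subseteq> S"
  "f \<oplus>\<^bsub>free_module S\<^esub> g = f + g"
  "\<zero>\<^bsub>free_module S\<^esub> = 0"
  "c \<odot>\<^bsub>free_module S\<^esub> f = Poly_Mapping.map ((*) c) f"
  by (simp_all add: free_module_def)

lemma module_free_module: "module ring_of_type_algebra (free_module S :: ('k::field, 'a \<Rightarrow>\<^sub>0 'k) module)"
proof (rule moduleI)
  show "cring (ring_of_type_algebra :: 'k ring)" by (rule cring_from_type_algebra)
  show "abelian_group (free_module S :: ('k, 'a \<Rightarrow>\<^sub>0 'k) module)"
  proof (rule abelian_groupI)
    fix x y :: "'a \<Rightarrow>\<^sub>0 'k"
    assume "x \<in> carrier (free_module S)"
    then show "\<exists>y\<in>carrier (free_module S). y \<oplus>\<^bsub>free_module S\<^esub> x = \<zero>\<^bsub>free_module S\<^esub>"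
      by (intro bexI[of _ "- x"]) simp_all
    assume "y \<in> carrier (free_module S)"
    then show "x \<oplus>\<^bsub>free_module S\<^esub> y \<in> carrier (free_module S)"
      using \<open>x \<in> carrier (free_module S)\<close> Poly_Mapping.keys_add[of x y] by auto
  qed (simp_all add: add_ac)
next
  fix c and x :: "'a \<Rightarrow>\<^sub>0 'k"
  assume "x \<in> carrier (free_module S)"
  then show "c \<odot>\<^bsub>free_module S\<^esub> x \<in> carrier (free_module S)"
    using keys_map_mult[of c x] by auto
qed (auto intro!: poly_mapping_eqI simp: lookup_add algebra_simps)

context extension_datum
begin

text \<open>In the quotient, the symbol of \<open>a\<close> is \<open>coef a\<close> times the
  symbol of the section element below it. Adding these weights over all symbols above \<gamma> gives
  the coefficient of the basis vector at \<gamma>.\<close>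

definition coord :: "('l \<times> 'h \<Rightarrow>\<^sub>0 'k) \<Rightarrow> 'l \<Rightarrow> 'k"
  where "coord p \<gamma> = (\<Sum>a\<in>Poly_Mapping.keys p. if fst a = \<gamma> then Poly_Mapping.lookup p a * coef a else 0)"

lemma coord_superset:
  assumes "finite A" "Poly_Mapping.keys p \<subseteq> A"
  shows "coord p \<gamma> = (\<Sum>a\<in>A. if fst a = \<gamma> then Poly_Mapping.lookup p a * coef a else 0)"
  unfolding coord_def using assms by (intro sum.mono_neutral_left) (auto simp: in_keys_iff)

lemma coord_add: "coord (p + q) \<gamma> = coord p \<gamma> + coord q \<gamma>"
proof -
  let ?A = "Poly_Mapping.keys p \<union> Poly_Mapping.keys q"
  show ?thesis
    using Poly_Mapping.keys_add[of p q]
    by (subst (1 2 3) coord_superset[of ?A])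
      (auto simp: sum.distrib[symmetric] lookup_add algebra_simps intro!: sum.cong)
qed

lemma coord_smult: "coord (Poly_Mapping.map ((*) c) p) \<gamma> = c * coord p \<gamma>"
  using keys_map_mult[of c p]
  by (subst (1 2) coord_superset[of "Poly_Mapping.keys p"])
    (auto simp: sum_distrib_left algebra_simps intro!: sum.cong)

lemma coord_zero [simp]: "coord 0 \<gamma> = 0"
  by (simp add: coord_def)

lemma coord_diff: "coord (p - q) \<gamma> = coord p \<gamma> - coord q \<gamma>"
  using coord_add[of "p - q" q \<gamma>] by simp

lemma coord_single: "coord (Poly_Mapping.single a x) \<gamma> = (if \<gamma> = fst a then x * coef a else 0)"
  by (subst coord_superset[of "{a}"]) auto

lemma coord_sum: "coord (sum f A) \<gamma> = (\<Sum>i\<in>A. coord (f i) \<gamma>)"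
  by (induction A rule: infinite_finite_induct) (simp_all add: coord_add)

lemma coord_outside_roots:
  "Poly_Mapping.keys p \<subseteq> ext_roots \<Longrightarrow> \<gamma> \<notin> roots \<Longrightarrow> coord p \<gamma> = 0"
  unfolding coord_def by (rule sum.neutral) (auto simp: ext_roots_def)

lemma ext_roots_lattice: "a \<in> ext_roots \<Longrightarrow> a \<in> carrier ext_lattice" "a \<in> ext_roots \<Longrightarrow> fst a \<in> roots"
  by (simp_all add: ext_roots_def)

lemma sec_ext_roots: "\<alpha> \<in> roots \<Longrightarrow> (\<alpha>, sec \<alpha>) \<in> ext_roots"
  by (simp add: ext_roots_def sec_ext_lattice)

lemma ext_incl_ext_roots:
  "\<lbrakk>z \<in> carrier (power_group \<zeta>); a \<in> ext_roots\<rbrakk> \<Longrightarrow> ext_incl z \<otimes>\<^bsub>ext_lattice\<^esub> a \<in> ext_roots"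
  by (simp add: ext_roots_def mult_ext_lattice_mem ext_incl_mem)
    (simp add: mult_ext_lattice ext_incl_def)

definition relators :: "('l \<times> 'h \<Rightarrow>\<^sub>0 'k) set"
  where "relators = {Poly_Mapping.single (ext_incl \<zeta> \<otimes>\<^bsub>ext_lattice\<^esub> a) 1 - Poly_Mapping.single a \<zeta> | a.
       a \<in> ext_roots}"

text \<open>The defining relation moves a single factor \<zeta>, whereas \<open>coef\<close> may be
  any power of it. The scalar \<open>x\<close> stays arbitrary in the induction because each
  application of the relation multiplies it by \<zeta>.\<close>

lemma relator_power:
  assumes N: "submodule N ring_of_type_algebra (free_module ext_roots)" "relators \<subseteq> N"
    and a: "a \<in> ext_roots"
  shows "Poly_Mapping.single (ext_incl (\<zeta> ^ n) \<otimes>\<^bsub>ext_lattice\<^esub> a) x - Poly_Mapping.single a (x * \<zeta> ^ n) \<in> N"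
proof (induction n arbitrary: x)
  interpret F: module "ring_of_type_algebra :: 'k ring" "free_module ext_roots" by (rule module_free_module)
  case 0
  have "ext_incl 1 \<otimes>\<^bsub>ext_lattice\<^esub> a = a"
    using ext_roots_lattice(1)[OF a]
    by (cases a) (simp add: mult_ext_lattice ext_incl_def mem_ext_lattice)
  moreover have "0 \<in> N"
    using subgroup.one_closed[OF submodule.axioms(1)[OF N(1)]] by simp
  ultimately show ?case by simp
next
  interpret F: module "ring_of_type_algebra :: 'k ring" "free_module ext_roots" by (rule module_free_module)
  case (Suc n)
  let ?b = "ext_incl (\<zeta> ^ n) \<otimes>\<^bsub>ext_lattice\<^esub> a"
  have zn: "\<zeta> ^ n \<in> carrier (power_group \<zeta>)" by (simp add: carrier_power_group)
  have b: "?b \<in> ext_roots" by (rule ext_incl_ext_roots[OF zn a])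
  have e: "ext_incl (\<zeta> ^ Suc n) \<otimes>\<^bsub>ext_lattice\<^esub> a = ext_incl \<zeta> \<otimes>\<^bsub>ext_lattice\<^esub> ?b"
    using zn power_group_zeta ext_roots_lattice(1)[OF a]
    by (simp add: mult_ext_lattice ext_incl_def iota_mult m_assoc mem_ext_lattice)
  have "Poly_Mapping.single (ext_incl \<zeta> \<otimes>\<^bsub>ext_lattice\<^esub> ?b) 1 - Poly_Mapping.single ?b \<zeta> \<in> N" (is "?r \<in> N")
    using N(2) b unfolding relators_def by blast
  from F.submoduleE(4)[OF N(1) _ this, of x]
  have "Poly_Mapping.map ((*) x) ?r \<in> N" by simp
  also have "Poly_Mapping.map ((*) x) ?r =
      Poly_Mapping.single (ext_incl \<zeta> \<otimes>\<^bsub>ext_lattice\<^esub> ?b) x - Poly_Mapping.single ?b (x * \<zeta>)"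
    by (rule poly_mapping_eqI) (simp add: lookup_minus lookup_single when_def algebra_simps)
  finally have 1: "Poly_Mapping.single (ext_incl \<zeta> \<otimes>\<^bsub>ext_lattice\<^esub> ?b) x - Poly_Mapping.single ?b (x * \<zeta>) \<in> N" .
  have "(Poly_Mapping.single (ext_incl \<zeta> \<otimes>\<^bsub>ext_lattice\<^esub> ?b) x - Poly_Mapping.single ?b (x * \<zeta>)) +
      (Poly_Mapping.single ?b (x * \<zeta>) - Poly_Mapping.single a (x * \<zeta> * \<zeta> ^ n)) \<in> N"
    using F.submoduleE(5)[OF N(1) 1 Suc.IH[of "x * \<zeta>"]] by (simp only: free_module_simps)
  then show ?case unfolding e by (simp add: mult.assoc)
qed

text \<open>This shows that there are no hidden further relations to impose: modulo \<open>N\<close>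
  every symbol is a multiple of a section symbol, and the coefficients of the section symbols
  collected from \<open>p\<close> are exactly its coordinates, which vanish.\<close>

lemma coord_zero_mem:
  assumes N: "submodule N ring_of_type_algebra (free_module ext_roots)" "relators \<subseteq> N"
    and p: "Poly_Mapping.keys p \<subseteq> ext_roots" "\<And>\<gamma>. coord p \<gamma> = 0"
  shows "p \<in> N"
proof -
  interpret F: module "ring_of_type_algebra :: 'k ring" "free_module ext_roots" by (rule module_free_module)
  let ?s = "\<lambda>a. Poly_Mapping.single (fst a, sec (fst a)) (Poly_Mapping.lookup p a * coef a)"
  have N0: "0 \<in> N"
    using subgroup.one_closed[OF submodule.axioms(1)[OF N(1)]] by simp
  have "Poly_Mapping.single a x - Poly_Mapping.single (fst a, sec (fst a)) (x * coef a) \<in> N"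
    if a: "a \<in> ext_roots" for a x
  proof -
    obtain n where n: "coef a = \<zeta> ^ n"
      using coef(1)[OF ext_roots_lattice(1)[OF a]] by (auto simp: carrier_power_group)
    show ?thesis
      using relator_power[OF N sec_ext_roots[OF ext_roots_lattice(2)[OF a]], of n x]
        ext_incl_coef_sec[OF ext_roots_lattice(1)[OF a]] n by simp
  qed
  note single = this
  have "(\<Sum>a\<in>A. Poly_Mapping.single a (Poly_Mapping.lookup p a) - ?s a) \<in> N"
    if "finite A" "A \<subseteq> ext_roots" for A
    using that
  proof (induction A rule: finite_induct)
    case (insert a A)
    then show ?case using F.submoduleE(5)[OF N(1)] single by simp
  qed (simp add: N0)
  from this[OF finite_keys p(1)]
  have "(\<Sum>a\<in>Poly_Mapping.keys p. Poly_Mapping.single a (Poly_Mapping.lookup p a)) -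
      (\<Sum>a\<in>Poly_Mapping.keys p. ?s a) \<in> N"
    by (simp add: sum_subtractf)
  moreover have "(\<Sum>a\<in>Poly_Mapping.keys p. ?s a) = 0"
  proof (rule poly_mapping_eqI)
    fix b
    \<comment> \<open>Only section symbols occur in this sum, and the one above a lattice vector
      collects all keys of \<open>p\<close> over that vector.\<close>
    have "Poly_Mapping.lookup (\<Sum>a\<in>Poly_Mapping.keys p. ?s a) b =
      (if b = (fst b, sec (fst b)) then coord p (fst b) else 0)"
      unfolding lookup_sum coord_def
      by (cases b) (auto simp: lookup_single when_def intro!: sum.cong sum.neutral)
    then show "Poly_Mapping.lookup (\<Sum>a\<in>Poly_Mapping.keys p. ?s a) b = Poly_Mapping.lookup 0 b"
      by (simp add: p(2))
  qed
  moreover have "(\<Sum>a\<in>Poly_Mapping.keys p. Poly_Mapping.single a (Poly_Mapping.lookup p a)) = p"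
    by (rule poly_mapping_eqI) (auto simp: lookup_sum lookup_single when_def in_keys_iff)
  ultimately show ?thesis by simp
qed

definition fibre :: "('l \<Rightarrow> 'k) \<Rightarrow> ('l \<times> 'h \<Rightarrow>\<^sub>0 'k) set"
  where "fibre g = {p. Poly_Mapping.keys p \<subseteq> ext_roots \<and> coord p = g}"

definition supported :: "('l \<Rightarrow> 'k) \<Rightarrow> bool"
  where "supported g \<longleftrightarrow> (\<forall>\<gamma>. \<gamma> \<notin> roots \<longrightarrow> g \<gamma> = 0)"

text \<open>The elements of \<open>root_part\<close>, which are cosets, are exactly the fibres of \<open>coord\<close>.\<close>

lemma symbol_relations_eq: "symbol_relations = fibre 0"
proof
  have "submodule (fibre 0) ring_of_type_algebra (free_module ext_roots)"
  proof (rule submodule_type_algebraI[OF module_free_module])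
    show "x \<oplus>\<^bsub>free_module ext_roots\<^esub> y \<in> fibre 0" if "x \<in> fibre 0" "y \<in> fibre 0" for x y
      using that Poly_Mapping.keys_add[of x y] by (auto simp: fibre_def fun_eq_iff coord_add)
    show "c \<odot>\<^bsub>free_module ext_roots\<^esub> x \<in> fibre 0" if "x \<in> fibre 0" for x c
      using that keys_map_mult[of c x] by (auto simp: fibre_def fun_eq_iff coord_smult)
  qed (auto simp: fibre_def fun_eq_iff)
  moreover have "relators \<subseteq> fibre 0"
  proof
    fix r assume "r \<in> relators"
    then obtain a where a: "a \<in> ext_roots"
      "r = Poly_Mapping.single (ext_incl \<zeta> \<otimes>\<^bsub>ext_lattice\<^esub> a) 1 - Poly_Mapping.single a \<zeta>"
      by (auto simp: relators_def)
    have "Poly_Mapping.keys r \<subseteq> ext_roots"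
      using a(1) ext_incl_ext_roots[OF power_group_zeta a(1)] keys_diff[of "Poly_Mapping.single (ext_incl \<zeta> \<otimes>\<^bsub>ext_lattice\<^esub> a) 1" "Poly_Mapping.single a \<zeta>"]
      unfolding a(2) by (auto split: if_splits)
    moreover have "coord r \<gamma> = 0" for \<gamma>
      using coef_ext_incl_mult[OF power_group_zeta ext_roots_lattice(1)[OF a(1)]]
      unfolding a(2) coord_diff coord_single by (simp add: mult_ext_lattice ext_incl_def)
    ultimately show "r \<in> fibre 0" by (auto simp: fibre_def)
  qed
  ultimately show "symbol_relations \<subseteq> fibre 0"
    by (auto simp: symbol_relations_def lin_span_def relators_def)
  show "fibre 0 \<subseteq> symbol_relations"
    using coord_zero_mem unfolding symbol_relations_def lin_span_def relators_def[symmetric]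
    by (auto simp: fibre_def)
qed

lemma coset_symbol_relations:
  assumes "Poly_Mapping.keys p \<subseteq> ext_roots"
  shows "symbol_relations +>\<^bsub>free_module ext_roots\<^esub> p = fibre (coord p)"
proof
  show "symbol_relations +>\<^bsub>free_module ext_roots\<^esub> p \<subseteq> fibre (coord p)"
  proof
    fix q assume "q \<in> symbol_relations +>\<^bsub>free_module ext_roots\<^esub> p"
    then obtain n where "n \<in> fibre 0" "q = n + p"
      by (auto simp: symbol_relations_eq a_r_coset_def')
    then show "q \<in> fibre (coord p)"
      using assms Poly_Mapping.keys_add[of n p] by (auto simp: fibre_def fun_eq_iff coord_add)
  qed
  show "fibre (coord p) \<subseteq> symbol_relations +>\<^bsub>free_module ext_roots\<^esub> p"
  proof
    fix q assume q: "q \<in> fibre (coord p)"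
    then have "q - p \<in> fibre 0"
      using assms keys_diff[of q p] by (auto simp: fibre_def fun_eq_iff coord_diff)
    then show "q \<in> symbol_relations +>\<^bsub>free_module ext_roots\<^esub> p"
      by (auto simp: symbol_relations_eq a_r_coset_def' intro!: bexI[of _ "q - p"])
  qed
qed

lemma fibre_nonempty:
  assumes "supported g"
  shows "\<exists>p. p \<in> fibre g"
proof -
  let ?p = "\<Sum>\<gamma>\<in>roots. Poly_Mapping.single (\<gamma>, sec \<gamma>) (g \<gamma>)"
  have "Poly_Mapping.keys (\<Sum>\<gamma>\<in>A. Poly_Mapping.single (\<gamma>, sec \<gamma>) (g \<gamma>)) \<subseteq> ext_roots"
    if "A \<subseteq> roots" for A
    using that
  proof (induction A rule: infinite_finite_induct)
    case (insert \<alpha> A)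
    let ?s = "Poly_Mapping.single (\<alpha>, sec \<alpha>) (g \<alpha>)"
    let ?t = "\<Sum>\<gamma>\<in>A. Poly_Mapping.single (\<gamma>, sec \<gamma>) (g \<gamma>)"
    have "Poly_Mapping.keys ?s \<subseteq> ext_roots" "Poly_Mapping.keys ?t \<subseteq> ext_roots"
      using insert sec_ext_roots by auto
    then show ?case
      using insert.hyps Poly_Mapping.keys_add[of ?s ?t] by auto
  qed simp_all
  moreover have "coord ?p = g"
    using assms finite_roots by (auto simp: fun_eq_iff coord_sum coord_single coef_sec supported_def)
  ultimately show ?thesis by (auto simp: fibre_def)
qed

lemma supported_coord: "Poly_Mapping.keys p \<subseteq> ext_roots \<Longrightarrow> supported (coord p)"
  by (simp add: supported_def coord_outside_roots)

lemma carrier_root_part: "carrier root_part = fibre ` {g. supported g}"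
proof -
  have "carrier root_part = (\<lambda>p. fibre (coord p)) ` {p. Poly_Mapping.keys p \<subseteq> ext_roots}"
    by (auto simp: root_part_def quotient_module_def A_RCOSETS_def' coset_symbol_relations)
  also have "\<dots> = fibre ` {g. supported g}"
    using fibre_nonempty supported_coord by (force simp: fibre_def image_iff)
  finally show ?thesis .
qed

lemma add_root_part:
  assumes "supported g" "supported h"
  shows "fibre g \<oplus>\<^bsub>root_part\<^esub> fibre h = fibre (g + h)"
proof -
  have "fibre g <+>\<^bsub>free_module ext_roots\<^esub> fibre h = fibre (g + h)"
  proof
    show "fibre g <+>\<^bsub>free_module ext_roots\<^esub> fibre h \<subseteq> fibre (g + h)"
    proof
      fix r assume "r \<in> fibre g <+>\<^bsub>free_module ext_roots\<^esub> fibre h"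
      then obtain p q where "p \<in> fibre g" "q \<in> fibre h" "r = p + q"
        by (auto simp: set_add_def')
      then show "r \<in> fibre (g + h)"
        using Poly_Mapping.keys_add[of p q] by (auto simp: fibre_def fun_eq_iff coord_add)
    qed
    obtain p where p: "p \<in> fibre g" using fibre_nonempty[OF assms(1)] by blast
    show "fibre (g + h) \<subseteq> fibre g <+>\<^bsub>free_module ext_roots\<^esub> fibre h"
    proof
      fix r assume "r \<in> fibre (g + h)"
      then have "r - p \<in> fibre h"
        using p keys_diff[of r p] by (auto simp: fibre_def fun_eq_iff coord_diff)
      moreover have "r = p + (r - p)" by simp
      ultimately show "r \<in> fibre g <+>\<^bsub>free_module ext_roots\<^esub> fibre h"
        using p unfolding set_add_def' free_module_simps by blast
    qed
  qed
  then show ?thesis by (simp add: root_part_def quotient_module_def)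
qed

lemma smult_root_part:
  assumes "supported g"
  shows "c \<odot>\<^bsub>root_part\<^esub> fibre g = fibre (\<lambda>\<gamma>. c * g \<gamma>)"
proof -
  have "symbol_relations +>\<^bsub>free_module ext_roots\<^esub> Poly_Mapping.map ((*) c) p = fibre (\<lambda>\<gamma>. c * g \<gamma>)"
    if "p \<in> fibre g" for p
  proof -
    have "Poly_Mapping.keys (Poly_Mapping.map ((*) c) p) \<subseteq> ext_roots"
      using that keys_map_mult[of c p] by (auto simp: fibre_def)
    moreover have "coord (Poly_Mapping.map ((*) c) p) = (\<lambda>\<gamma>. c * g \<gamma>)"
      using that by (auto simp: fibre_def fun_eq_iff coord_smult)
    ultimately show ?thesis by (simp add: coset_symbol_relations)
  qed
  \<comment> \<open>Scalar multiplication of a coset is a union over its representatives. All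
    members of the union agree, and nonemptiness makes the union equal to their common
    value.\<close>
  moreover have "fibre g \<noteq> {}" using fibre_nonempty[OF assms] by blast
  ultimately show ?thesis by (simp add: root_part_def quotient_module_def)
qed

lemma zero_root_part: "\<zero>\<^bsub>root_part\<^esub> = fibre 0"
  by (simp add: root_part_def quotient_module_def symbol_relations_eq)

lemma root_vec_fibre:
  "b \<in> ext_roots \<Longrightarrow> root_vec b = fibre (\<lambda>\<gamma>. if \<gamma> = fst b then coef b else 0)"
  using coset_symbol_relations[of "Poly_Mapping.single b 1"]
  by (simp add: root_vec_def coord_single[abs_def] cong: if_cong)

text \<open>Since \<open>coord\<close> is constant on every coset, the choice of a representative
  does not affect the result.\<close>

definition hcoord :: "('l \<Rightarrow> 'k) \<times> ('l \<times> 'h \<Rightarrow>\<^sub>0 'k) set \<Rightarrow> ('l \<Rightarrow> 'k) \<times> ('l \<Rightarrow> 'k)"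
  where "hcoord x = (fst x, coord (SOME p. p \<in> snd x))"

lemma hcoord_fibre:
  assumes "supported g"
  shows "hcoord (t, fibre g) = (t, g)"
proof -
  have "(SOME p. p \<in> fibre g) \<in> fibre g" using fibre_nonempty[OF assms] by (rule someI_ex)
  then show ?thesis by (simp add: hcoord_def fibre_def)
qed

lemma mem_hspace: "x \<in> carrier hspace \<longleftrightarrow> (\<exists>t g. additive t \<and> supported g \<and> x = (t, fibre g))"
  by (cases x) (auto simp: hspace_def direct_sum_module_def torus_def carrier_root_part)

lemma supported_add: "supported g \<Longrightarrow> supported h \<Longrightarrow> supported (g + h)"
  and supported_smult: "supported g \<Longrightarrow> supported (\<lambda>\<gamma>. c * g \<gamma>)"
  and supported_zero: "supported 0"
  by (simp_all add: supported_def)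

lemma zero_hspace: "\<zero>\<^bsub>hspace\<^esub> = (0, fibre 0)"
  by (simp add: hspace_def direct_sum_module_def zero_root_part torus_def zero_fun_def)

lemma hcoord_add:
  assumes "x \<in> carrier hspace" "y \<in> carrier hspace"
  shows "x \<oplus>\<^bsub>hspace\<^esub> y \<in> carrier hspace" "hcoord (x \<oplus>\<^bsub>hspace\<^esub> y) = hcoord x + hcoord y"
proof -
  obtain t g t' g' where xy: "additive t" "supported g" "x = (t, fibre g)"
    "additive t'" "supported g'" "y = (t', fibre g')"
    using assms by (auto simp: mem_hspace)
  have "x \<oplus>\<^bsub>hspace\<^esub> y = (t + t', fibre (g + g'))"
    using xy by (simp add: hspace_def direct_sum_module_def add_root_part torus_def plus_fun_def)
  moreover have "additive (t + t')" using xy by (simp add: additive_def)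
  ultimately show "x \<oplus>\<^bsub>hspace\<^esub> y \<in> carrier hspace" "hcoord (x \<oplus>\<^bsub>hspace\<^esub> y) = hcoord x + hcoord y"
    using xy supported_add by (auto simp: mem_hspace hcoord_fibre)
qed

lemma hcoord_smult:
  assumes "x \<in> carrier hspace"
  shows "c \<odot>\<^bsub>hspace\<^esub> x \<in> carrier hspace"
    "hcoord (c \<odot>\<^bsub>hspace\<^esub> x) = (\<lambda>\<gamma>. c * fst (hcoord x) \<gamma>, \<lambda>\<gamma>. c * snd (hcoord x) \<gamma>)"
proof -
  obtain t g where x: "additive t" "supported g" "x = (t, fibre g)"
    using assms by (auto simp: mem_hspace)
  have "c \<odot>\<^bsub>hspace\<^esub> x = (\<lambda>\<gamma>. c * t \<gamma>, fibre (\<lambda>\<gamma>. c * g \<gamma>))"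
    using x by (simp add: hspace_def direct_sum_module_def smult_root_part torus_def)
  moreover have "additive (\<lambda>\<gamma>. c * t \<gamma>)" using x by (simp add: additive_def algebra_simps)
  ultimately show "c \<odot>\<^bsub>hspace\<^esub> x \<in> carrier hspace"
    "hcoord (c \<odot>\<^bsub>hspace\<^esub> x) = (\<lambda>\<gamma>. c * fst (hcoord x) \<gamma>, \<lambda>\<gamma>. c * snd (hcoord x) \<gamma>)"
    using x supported_smult by (auto simp: mem_hspace hcoord_fibre)
qed

lemma hcoord_zero: "\<zero>\<^bsub>hspace\<^esub> \<in> carrier hspace" "hcoord \<zero>\<^bsub>hspace\<^esub> = 0"
proof -
  have "additive (0 :: 'l \<Rightarrow> 'k)" by (simp add: additive_def)
  then show "\<zero>\<^bsub>hspace\<^esub> \<in> carrier hspace"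
    unfolding mem_hspace zero_hspace using supported_zero by blast
  show "hcoord \<zero>\<^bsub>hspace\<^esub> = 0"
    using supported_zero by (simp add: zero_hspace hcoord_fibre zero_prod_def)
qed

lemma in_torus_hspace:
  assumes "additive t"
  shows "in_torus t \<in> carrier hspace" "hcoord (in_torus t) = (t, 0)"
  using assms supported_zero by (auto simp: in_torus_def zero_root_part mem_hspace hcoord_fibre)

lemma root_vec_hspace:
  assumes "b \<in> ext_roots"
  shows "in_root_part (root_vec b) \<in> carrier hspace"
    "hcoord (in_root_part (root_vec b)) = (0, \<lambda>\<gamma>. if \<gamma> = fst b then coef b else 0)"
proof -
  have s: "supported (\<lambda>\<gamma>. if \<gamma> = fst b then coef b else 0)"
    using ext_roots_lattice[OF assms] by (auto simp: supported_def)
  have e: "in_root_part (root_vec b) = (0, fibre (\<lambda>\<gamma>. if \<gamma> = fst b then coef b else 0))"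
    using assms by (simp add: in_root_part_def torus_def root_vec_fibre zero_fun_def)
  have "additive (0 :: 'l \<Rightarrow> 'k)" by (simp add: additive_def)
  then show "in_root_part (root_vec b) \<in> carrier hspace" unfolding mem_hspace e using s by blast
  show "hcoord (in_root_part (root_vec b)) = (0, \<lambda>\<gamma>. if \<gamma> = fst b then coef b else 0)"
    unfolding e by (rule hcoord_fibre[OF s])
qed

lemma hcartan_eq: "hcartan = {x \<in> carrier hspace. snd (hcoord x) = 0}"
proof -
  have "x \<in> hcartan" if "x \<in> carrier hspace" "snd (hcoord x) = 0" for x
    using that by (auto simp: hcartan_def in_torus_def zero_root_part mem_hspace hcoord_fibre torus_def)
  moreover have "x \<in> carrier hspace \<and> snd (hcoord x) = 0" if "x \<in> hcartan" for x
    using that in_torus_hspace by (auto simp: hcartan_def torus_def)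
  ultimately show ?thesis by blast
qed

lemma scalar_of_eq:
  assumes "a \<in> carrier ext_lattice" "fst a = 0"
  shows "scalar_of a = coef a"
proof -
  have "a = ext_incl (coef a)"
    using coef[OF assms(1)] assms by (cases a) (simp add: ext_incl_def)
  moreover have "inj_on ext_incl (carrier (power_group \<zeta>))"
    by (auto simp: inj_on_def ext_incl_def intro: iota_inj)
  ultimately show ?thesis
    unfolding scalar_of_def using coef(1)[OF assms(1)] by (metis inv_into_f_f)
qed

end

section \<open>The bracket\<close>

context input_datum
begin

sublocale S: root_cocycle form structure_cocycle
  by (rule root_cocycle_structure)

lemma hcoord_bij: "bij_betw hcoord (carrier hspace) S.model"
  unfolding bij_betw_def
proof
  show "inj_on hcoord (carrier hspace)"
    by (auto simp: inj_on_def mem_hspace hcoord_fibre)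
  show "hcoord ` carrier hspace = S.model"
  proof
    show "hcoord ` carrier hspace \<subseteq> S.model"
      by (auto simp: mem_hspace hcoord_fibre S.model_def supported_def)
    show "S.model \<subseteq> hcoord ` carrier hspace"
    proof
      fix m assume "m \<in> S.model"
      then have m: "additive (fst m)" "supported (snd m)" by (auto simp: S.model_def supported_def)
      then have "(fst m, fibre (snd m)) \<in> carrier hspace" "hcoord (fst m, fibre (snd m)) = m"
        by (auto simp: mem_hspace hcoord_fibre)
      then show "m \<in> hcoord ` carrier hspace" by (metis image_eqI)
    qed
  qed
qed

text \<open>The linear part of the coordinate axioms does not involve the bracket, so each candidate
  bracket has to supply only its own compatibility with \<open>S.brk\<close>.\<close>

lemma root_coordinates_hspace:
  assumes "\<And>x y. x \<in> carrier hspace \<Longrightarrow> y \<in> carrier hspace \<Longrightarrow> br x y \<in> carrier hspace"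
    and "\<And>x y. x \<in> carrier hspace \<Longrightarrow> y \<in> carrier hspace \<Longrightarrow>
      hcoord (br x y) = S.brk (hcoord x) (hcoord y)"
  shows "root_coordinates form structure_cocycle (hspace\<lparr>monoid.mult := br\<rparr>) hcoord"
  using assms
  by unfold_locales
    (simp_all add: hcoord_bij hcoord_zero hcoord_add hcoord_smult S.scale_def)

text \<open>The witness that \<open>is_bracket\<close> can be satisfied; without one, the choice in
  \<open>halgebra\<close> would be unconstrained.\<close>

definition model_bracket where
  "model_bracket x y = inv_into (carrier hspace) hcoord (S.brk (hcoord x) (hcoord y))"

sublocale M: root_coordinates form structure_cocycle "hspace\<lparr>monoid.mult := model_bracket\<rparr>" hcoord
proof (rule root_coordinates_hspace)
  fix x y
  have "S.brk (hcoord x) (hcoord y) \<in> hcoord ` carrier hspace"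
    using hcoord_bij S.brk_model by (simp add: bij_betw_def)
  then show "model_bracket x y \<in> carrier hspace"
    "hcoord (model_bracket x y) = S.brk (hcoord x) (hcoord y)"
    by (simp_all add: model_bracket_def inv_into_into f_inv_into_f)
qed

lemma hcoord_eqI: "\<lbrakk>x \<in> carrier hspace; y \<in> carrier hspace; hcoord x = hcoord y\<rbrakk> \<Longrightarrow> x = y"
  using hcoord_bij by (auto simp: bij_betw_def inj_on_def)

lemma hcoord_scale: "x \<in> carrier hspace \<Longrightarrow> hcoord (c \<odot>\<^bsub>hspace\<^esub> x) = S.scale c (hcoord x)"
  by (simp add: hcoord_smult S.scale_def)

lemma root_vec_scale:
  "b \<in> ext_roots \<Longrightarrow> hcoord (in_root_part (root_vec b)) = S.scale (coef b) (S.root_vector (fst b))"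
  by (auto simp: root_vec_hspace S.scale_def S.root_vector_def fun_eq_iff)

definition root_bracket where
  "root_bracket a b = (if fst a + fst b = 0 then
       (\<epsilon> (fst a) (fst b) * scalar_of (a \<otimes>\<^bsub>ext_lattice\<^esub> b)) \<odot>\<^bsub>hspace\<^esub> in_torus (coroot (fst a))
     else if fst a + fst b \<in> roots then
       \<epsilon> (fst a) (fst b) \<odot>\<^bsub>hspace\<^esub> in_root_part (root_vec (a \<otimes>\<^bsub>ext_lattice\<^esub> b))
     else \<zero>\<^bsub>hspace\<^esub>)"

text \<open>A scalar comparison: symbols have coordinates \<open>coef a\<close> and
  \<open>coef b\<close>, and \<open>coef_mult\<close> splits the coefficient of their product into
  these two factors and the section cocycle, which joins with \<open>\<epsilon>\<close> to form the
  structure cocycle. For opposite roots the product lies over zero, where \<open>scalar_of\<close>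
  is \<open>coef\<close>.\<close>

lemma root_bracket:
  assumes a: "a \<in> ext_roots" and b: "b \<in> ext_roots"
  shows "root_bracket a b \<in> carrier hspace"
    "hcoord (root_bracket a b) =
      S.brk (hcoord (in_root_part (root_vec a))) (hcoord (in_root_part (root_vec b)))"
proof -
  note la = ext_roots_lattice[OF a] and lb = ext_roots_lattice[OF b]
  have ab: "a \<otimes>\<^bsub>ext_lattice\<^esub> b \<in> carrier ext_lattice" "fst (a \<otimes>\<^bsub>ext_lattice\<^esub> b) = fst a + fst b"
    using mult_ext_lattice_mem[OF la(1) lb(1)] by (simp_all add: mult_ext_lattice)
  have c: "\<epsilon> (fst a) (fst b) * coef (a \<otimes>\<^bsub>ext_lattice\<^esub> b) =
      coef a * (coef b * structure_cocycle (fst a) (fst b))"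
    using la lb by (simp add: coef_mult structure_cocycle_def)
  have rhs: "S.brk (hcoord (in_root_part (root_vec a))) (hcoord (in_root_part (root_vec b))) =
      S.scale (coef a * coef b) (S.brk (S.root_vector (fst a)) (S.root_vector (fst b)))"
    using a b by (simp add: root_vec_scale S.brk_scale S.scale_simps mult.commute)
  consider "fst a + fst b = 0" | "fst a + fst b \<noteq> 0" "fst a + fst b \<in> roots"
    | "fst a + fst b \<noteq> 0" "fst a + fst b \<notin> roots" by blast
  then have "root_bracket a b \<in> carrier hspace \<and> hcoord (root_bracket a b) =
      S.scale (coef a * coef b) (S.brk (S.root_vector (fst a)) (S.root_vector (fst b)))"
  proof cases
    case 1
    then show ?thesis
      using ab la lb
      by (simp add: root_bracket_def S.brk_root_vector in_torus_hspace S.additive_coroot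
          hcoord_smult(1) hcoord_scale scalar_of_eq c S.scale_simps mult.assoc)
  next
    case 2
    then have "a \<otimes>\<^bsub>ext_lattice\<^esub> b \<in> ext_roots" using ab by (simp add: ext_roots_def)
    then show ?thesis
      using 2 ab la lb
      by (simp add: root_bracket_def S.brk_root_vector root_vec_hspace(1) root_vec_scale
          hcoord_smult(1) hcoord_scale c S.scale_simps mult.assoc)
  next
    case 3
    then show ?thesis
      using la lb by (simp add: root_bracket_def S.brk_root_vector hcoord_zero S.scale_simps)
  qed
  then show "root_bracket a b \<in> carrier hspace"
    "hcoord (root_bracket a b) =
      S.brk (hcoord (in_root_part (root_vec a))) (hcoord (in_root_part (root_vec b)))"
    by (simp_all add: rhs)
qed

lemma brk_coroot_root_vec:
  assumes "b \<in> ext_roots"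
  shows "hcoord (of_int (form \<alpha> (fst b)) \<odot>\<^bsub>hspace\<^esub> in_root_part (root_vec b)) =
      S.brk (coroot \<alpha>, 0) (hcoord (in_root_part (root_vec b)))"
    "hcoord (- of_int (form \<alpha> (fst b)) \<odot>\<^bsub>hspace\<^esub> in_root_part (root_vec b)) =
      S.brk (hcoord (in_root_part (root_vec b))) (coroot \<alpha>, 0)"
  using ext_roots_lattice[OF assms] assms root_vec_hspace(1)[OF assms]
  by (simp_all add: hcoord_scale root_vec_scale S.brk_scale S.brk_torus_root_vector S.scale_simps
      coroot_def mult.commute)

section \<open>Existence and uniqueness of the bracket\<close>

lemma is_bracket_iff:
  "is_bracket br \<longleftrightarrow>
    bilinear_op ring_of_type_algebra hspace br \<and>
    (\<forall>f g. additive f \<longrightarrow> additive g \<longrightarrow> br (in_torus f) (in_torus g) = \<zero>\<^bsub>hspace\<^esub>) \<and>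
    (\<forall>\<alpha>\<in>roots. \<forall>b\<in>ext_roots.
       br (in_torus (coroot \<alpha>)) (in_root_part (root_vec b)) =
         of_int (form \<alpha> (fst b)) \<odot>\<^bsub>hspace\<^esub> in_root_part (root_vec b) \<and>
       br (in_root_part (root_vec b)) (in_torus (coroot \<alpha>)) =
         - of_int (form \<alpha> (fst b)) \<odot>\<^bsub>hspace\<^esub> in_root_part (root_vec b)) \<and>
    (\<forall>a\<in>ext_roots. \<forall>b\<in>ext_roots.
       br (in_root_part (root_vec a)) (in_root_part (root_vec b)) = root_bracket a b)"
  unfolding is_bracket_def root_bracket_def by (auto simp: torus_def)

lemma is_bracket_model_bracket: "is_bracket model_bracket"
proof -
  interpret A: lie_algebra "ring_of_type_algebra :: 'k ring" "hspace\<lparr>monoid.mult := model_bracket\<rparr>"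
    by (rule M.lie_algebra_L)
  note mem = M.bracket_mem[simplified] and crd = M.crd_bracket[simplified]
  have "bilinear_op ring_of_type_algebra hspace model_bracket"
    using A.bracket_bilinear by (simp add: bilinear_op_def)
  moreover have "model_bracket (in_torus f) (in_torus g) = \<zero>\<^bsub>hspace\<^esub>"
    if "additive f" "additive g" for f g
    using that
    by (intro hcoord_eqI) (simp_all add: mem crd in_torus_hspace hcoord_zero S.brk_torus prod_eq_iff fun_eq_iff)
  moreover have "model_bracket (in_torus (coroot \<alpha>)) (in_root_part (root_vec b)) =
      of_int (form \<alpha> (fst b)) \<odot>\<^bsub>hspace\<^esub> in_root_part (root_vec b)"
    "model_bracket (in_root_part (root_vec b)) (in_torus (coroot \<alpha>)) =
      - of_int (form \<alpha> (fst b)) \<odot>\<^bsub>hspace\<^esub> in_root_part (root_vec b)"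
    if "b \<in> ext_roots" for \<alpha> b
    using that in_torus_hspace[OF S.additive_coroot] root_vec_hspace(1)[OF that]
    by (intro hcoord_eqI; simp add: mem crd hcoord_smult(1) brk_coroot_root_vec)+
  moreover have "model_bracket (in_root_part (root_vec a)) (in_root_part (root_vec b)) = root_bracket a b"
    if "a \<in> ext_roots" "b \<in> ext_roots" for a b
    using that root_vec_hspace(1) by (intro hcoord_eqI) (simp_all add: mem crd root_bracket)
  ultimately show ?thesis by (simp add: is_bracket_iff)
qed

text \<open>Uniqueness: the relation \<open>E\<close> holds on pairs of generators and passes
  through sums and multiples in either argument. Brackets between torus and root vectors are
  prescribed only for coroots of roots, so this is where the spanning result for the torus is
  needed.\<close>

lemma is_bracket_hcoord:
  assumes br: "is_bracket br" and x: "x \<in> carrier hspace" and y: "y \<in> carrier hspace"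
  shows "br x y \<in> carrier hspace" "hcoord (br x y) = S.brk (hcoord x) (hcoord y)"
proof -
  note br' = br[unfolded is_bracket_iff bilinear_op_def, simplified]
  have mem: "br x y \<in> carrier hspace" if "x \<in> carrier hspace" "y \<in> carrier hspace" for x y
    using br' that by blast
  define E where "E x y \<longleftrightarrow> hcoord (br x y) = S.brk (hcoord x) (hcoord y)" for x y
  have E_add: "E (x \<oplus>\<^bsub>hspace\<^esub> x') y" if "E x y" "E x' y" "x \<in> carrier hspace"
    "x' \<in> carrier hspace" "y \<in> carrier hspace" for x x' y
    using that br' by (simp add: E_def hcoord_add mem S.brk_add)
  have E_add': "E y (x \<oplus>\<^bsub>hspace\<^esub> x')" if "E y x" "E y x'" "x \<in> carrier hspace"
    "x' \<in> carrier hspace" "y \<in> carrier hspace" for x x' y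
    using that br' by (simp add: E_def hcoord_add mem S.brk_add)
  have E_smult: "E (c \<odot>\<^bsub>hspace\<^esub> x) y" if "E x y" "x \<in> carrier hspace" "y \<in> carrier hspace" for c x y
    using that br' by (simp add: E_def hcoord_scale mem S.brk_scale)
  have E_smult': "E y (c \<odot>\<^bsub>hspace\<^esub> x)" if "E y x" "x \<in> carrier hspace" "y \<in> carrier hspace" for c x y
    using that br' by (simp add: E_def hcoord_scale mem S.brk_scale)
  have tt: "E (in_torus f) (in_torus g)" if "additive f" "additive g" for f g
  proof -
    have "br (in_torus f) (in_torus g) = \<zero>\<^bsub>hspace\<^esub>" using br' that by blast
    moreover have "S.brk (f, 0) (g, 0) = 0" by (simp add: S.brk_torus prod_eq_iff fun_eq_iff)
    ultimately show ?thesis using that by (simp add: E_def in_torus_hspace hcoord_zero)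
  qed
  have tsum: "in_torus (\<lambda>x. g x + h x) = in_torus g \<oplus>\<^bsub>hspace\<^esub> in_torus h"
    if "additive g" "additive h" for g h
  proof (rule hcoord_eqI)
    have "additive (\<lambda>x. g x + h x)" using that by (simp add: additive_def)
    then show "in_torus (\<lambda>x. g x + h x) \<in> carrier hspace"
      "hcoord (in_torus (\<lambda>x. g x + h x)) = hcoord (in_torus g \<oplus>\<^bsub>hspace\<^esub> in_torus h)"
      using that by (simp_all add: in_torus_hspace hcoord_add plus_fun_def zero_fun_def)
  qed (use that in \<open>simp add: in_torus_hspace hcoord_add\<close>)
  have tscale: "in_torus (\<lambda>x. c * g x) = c \<odot>\<^bsub>hspace\<^esub> in_torus g" if "additive g" for c g
  proof (rule hcoord_eqI)
    have "additive (\<lambda>x. c * g x)" using that by (simp add: additive_def algebra_simps)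
    then show "in_torus (\<lambda>x. c * g x) \<in> carrier hspace"
      "hcoord (in_torus (\<lambda>x. c * g x)) = hcoord (c \<odot>\<^bsub>hspace\<^esub> in_torus g)"
      using that by (simp_all add: in_torus_hspace hcoord_smult zero_fun_def)
  qed (use that in \<open>simp add: in_torus_hspace hcoord_smult\<close>)
  have tr: "E (in_torus f) (in_root_part (root_vec b)) \<and> E (in_root_part (root_vec b)) (in_torus f)"
    if f: "additive f" and b: "b \<in> ext_roots" for f b
    using f
  proof (induction rule: additive_coroot_induct)
    case zero
    \<comment> \<open>The zero functional is rewritten as 0 times itself, so that bilinearity alone
      makes both brackets vanish.\<close>
    have "additive (\<lambda>_::'l. 0::'k)" by (simp add: additive_def)
    then have "in_torus (\<lambda>_. 0) \<in> carrier hspace" "in_torus (\<lambda>_. 0) = 0 \<odot>\<^bsub>hspace\<^esub> in_torus (\<lambda>_. 0)"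
      using tscale[of "\<lambda>_. 0" 0] in_torus_hspace(1) by auto
    moreover have "E (0 \<odot>\<^bsub>hspace\<^esub> x) y" "E y (0 \<odot>\<^bsub>hspace\<^esub> x)"
      if "x \<in> carrier hspace" "y \<in> carrier hspace" for x y
      using that br' by (simp_all add: E_def hcoord_scale mem S.scale_simps)
    ultimately show ?case using root_vec_hspace(1)[OF b] by metis
  next
    case (coroot \<alpha>)
    then show ?case
      using br' b in_torus_hspace(2)[OF S.additive_coroot] by (simp add: E_def brk_coroot_root_vec)
  next
    case (add g h)
    then show ?case
      using tsum E_add E_add' in_torus_hspace(1) root_vec_hspace(1)[OF b] by simp
  next
    case (scale c g)
    then show ?case
      using tscale E_smult E_smult' in_torus_hspace(1) root_vec_hspace(1)[OF b] by simp
  qed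
  have rr: "E (in_root_part (root_vec a)) (in_root_part (root_vec b))"
    if "a \<in> ext_roots" "b \<in> ext_roots" for a b
    using that br' by (simp add: E_def root_bracket)
  \<comment> \<open>The inverse of the coordinate map is borrowed from the algebra with
    \<open>model_bracket\<close>. It depends only on the carrier and on \<open>hcoord\<close>, so it
    serves equally for \<open>br\<close> and lets \<open>S.model_induct\<close> run over the
    elements of the space.\<close>
  define V where "V = M.vec"
  have V: "V m \<in> carrier hspace" "hcoord (V m) = m" if "m \<in> S.model" for m
    using M.vec_mem[of m] M.crd_vec[of m] that by (simp_all add: V_def)
  have Vt: "V (t, 0) = in_torus t" if "additive t" for t
    using that V[OF S.torus_model[OF that]] by (intro hcoord_eqI) (simp_all add: in_torus_hspace)
  have Vr: "V (S.root_vector \<alpha>) = in_root_part (root_vec (\<alpha>, sec \<alpha>))" if "\<alpha> \<in> roots" for \<alpha>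
    using V[OF S.root_vector_model[OF that]] sec_ext_roots[OF that]
    by (intro hcoord_eqI) (simp_all add: root_vec_hspace(1) root_vec_scale coef_sec S.scale_simps)
  have Va: "V (m + m') = V m \<oplus>\<^bsub>hspace\<^esub> V m'" if "m \<in> S.model" "m' \<in> S.model" for m m'
    using M.vec_add[OF that] by (simp add: V_def)
  have Vs: "V (S.scale c m) = c \<odot>\<^bsub>hspace\<^esub> V m" if "m \<in> S.model" for c m
    using M.vec_scale[OF that, of c] by (simp add: V_def)
  have tV: "E (in_torus t) (V m)" if "m \<in> S.model" and t: "additive t" for t m
    using that(1)
  proof (induction rule: S.model_induct)
    case (torus t') then show ?case using tt t by (simp add: Vt)
  next
    case (root \<alpha>) then show ?case using tr t sec_ext_roots by (simp add: Vr)
  next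
    case (add m m') then show ?case using E_add' V in_torus_hspace(1)[OF t] by (simp add: Va)
  next
    case (scale c m) then show ?case using E_smult' V in_torus_hspace(1)[OF t] by (simp add: Vs)
  qed
  have rV: "E (in_root_part (root_vec b)) (V m)" if "m \<in> S.model" and b: "b \<in> ext_roots" for b m
    using that(1)
  proof (induction rule: S.model_induct)
    case (torus t') then show ?case using tr b by (simp add: Vt)
  next
    case (root \<alpha>) then show ?case using rr b sec_ext_roots by (simp add: Vr)
  next
    case (add m m') then show ?case using E_add' V root_vec_hspace(1)[OF b] by (simp add: Va)
  next
    case (scale c m) then show ?case using E_smult' V root_vec_hspace(1)[OF b] by (simp add: Vs)
  qed
  have VV: "E (V m) (V m')" if "m \<in> S.model" and m': "m' \<in> S.model" for m m'
    using that(1)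
  proof (induction rule: S.model_induct)
    case (torus t) then show ?case using tV m' by (simp add: Vt)
  next
    case (root \<alpha>) then show ?case using rV m' sec_ext_roots by (simp add: Vr)
  next
    case (add m m'') then show ?case using E_add V m' by (simp add: Va)
  next
    case (scale c m) then show ?case using E_smult V m' by (simp add: Vs)
  qed
  have "V (hcoord z) = z" "hcoord z \<in> S.model" if "z \<in> carrier hspace" for z
    using M.vec_crd[of z] M.crd_model[of z] that by (simp_all add: V_def)
  then have "E x y" using VV x y by metis
  then show "br x y \<in> carrier hspace" "hcoord (br x y) = S.brk (hcoord x) (hcoord y)"
    using mem x y by (auto simp: E_def)
qed

lemma root_coordinates_halgebra: "root_coordinates form structure_cocycle halgebra hcoord"
proof -
  have "is_bracket (SOME br. is_bracket br)"
    using is_bracket_model_bracket by (rule someI[of is_bracket])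
  from is_bracket_hcoord[OF this] show ?thesis
    unfolding halgebra_def by (rule root_coordinates_hspace)
qed

lemma lie_algebra_structure:
  "semisimple_lie_algebra ring_of_type_algebra halgebra \<and>
   cartan_subalgebra ring_of_type_algebra halgebra hcartan \<and>
   lie_split ring_of_type_algebra halgebra hcartan \<and>
   evaluation \<in> iso additive_group (root_lattice_group ring_of_type_algebra halgebra hcartan) \<and>
   evaluation ` roots = lie_roots ring_of_type_algebra halgebra hcartan"
proof -
  interpret A: root_coordinates form structure_cocycle halgebra hcoord
    by (rule root_coordinates_halgebra)
  have carrier_h: "carrier halgebra = carrier hspace" by (simp add: halgebra_def)
  have c: "A.cartan = hcartan"
    using carrier_h by (simp add: A.cartan_def hcartan_eq)
  have "A.eval_root = evaluation"
    by (simp add: fun_eq_iff A.eval_root_def evaluation_def c hcoord_def)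
  then show ?thesis
    using A.semisimple_L A.cartan_subalgebra_L A.lie_split_L A.eval_root_iso A.lie_roots_L
    by (simp add: c)
qed

end

theorem theorem2p2:
  fixes form :: "'l::ab_group_add \<Rightarrow> 'l \<Rightarrow> int"
    and w :: "'l \<Rightarrow> 'l"
    and d :: nat
    and \<zeta> :: "'k::field_char_0"
    and H :: "'h monoid"
    and \<iota> :: "'k \<Rightarrow> 'h"
    and \<pi> :: "'h \<Rightarrow> 'l set"
    and \<epsilon> :: "'l \<Rightarrow> 'l \<Rightarrow> 'k"
  assumes "input_datum form w d \<zeta> H \<iota> \<pi> \<epsilon>"
  shows "let K = (ring_of_type_algebra :: 'k ring);
             \<hh> = input_datum.halgebra form w \<zeta> H \<iota> \<pi> \<epsilon>;
             \<tt> = extension_datum.hcartan form w \<zeta> H \<iota> \<pi>;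
             ev = extension_datum.evaluation form w \<zeta> H \<iota> \<pi>
         in semisimple_lie_algebra K \<hh> \<and>
            cartan_subalgebra K \<hh> \<tt> \<and>
            lie_split K \<hh> \<tt> \<and>
            ev \<in> iso additive_group (root_lattice_group K \<hh> \<tt>) \<and>
            ev ` integral_lattice.roots form = lie_roots K \<hh> \<tt>"
proof -
  interpret input_datum form w d \<zeta> H \<iota> \<pi> \<epsilon> by fact
  show ?thesis unfolding Let_def by (rule lie_algebra_structure)
qed

end
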